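(* Let $q^{1/2}$ be a primitive $2N$-th root of unity, $N\ge1$, and $t=q^k$, where $k$ is normalized by $-N/2\le k<N/2$ when $k\in\mathbb Z/2$. The perfect representations $V$ of $\mathcal H\!\mathcal H$ are exactly those in the following cases: (a) $2k\in\mathbb Z_+$, $0<k<N/2$; (b) $k=-1/2-n$, $n\in\mathbb Z$, $0\le n<N/2$. In both cases $V$ is the quotient of $\mathcal P$ by the radical $Rad$ of the form $\{f,g\}=f(Y^{-1})(g)(-k/2)$. It is isomorphic to the space of functions on the set $\bowtie'$, where in case (a) $$\bowtie'=\Bigl\{\tfrac{k-N+1}{2},\tfrac{k-N+2}{2},\ldots,-\tfrac k2,\tfrac{k+1}{2},\ldots,\tfrac{N-k}{2}\Bigr\}$$ and in case (b) $$\bowtie'=\Bigl\{\tfrac{1/2-n}{2},\tfrac{3/2-n}{2},\ldots,-\tfrac14,\tfrac14,\tfrac34,\ldots,\tfrac{1/2+n}{2}\Bigr\}.$$ The action of $\mathcal H\!\mathcal H$ on functions on $\bowtie'$ is given by $(Xf)(z)=q^zf(z)$, $(\pi f)(z)=f(1/2-z)$, $$(Tf)(z)=\frac{t^{1/2}q^{2z}-t^{-1/2}}{q^{2z}-1}f(-z)-\frac{t^{1/2}-t^{-1/2}}{q^{2z}-1}f(z),$$ where the first term is omitted if its coefficient is zero. The invariant form (the form with anti-involution $\star$) is $$\langle f,g\rangle'=\sum_{m_\#\in\bowtie'}f(m_\#)\,\overline{g(m_\#)}\,\mu^1(m_\#),$$ the sum being over the points of $\bowtie'$, where for $m>0$ 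$$\mu^1(m_\#)=\mu^1((1-m)_\#)=q^{-k(m-1)}\prod_{i=1}^{m-1}\frac{1-q^{2k+i}}{1-q^i}.$$
   Context: The double affine Hecke algebra $\mathcal H\!\mathcal H$ (type $A_1$) is generated by $X^{\pm1},Y^{\pm1},T$ with relations $TXT=X^{-1}$, $TY^{-1}T=Y$, $Y^{-1}X^{-1}YXT^2q^{1/2}=1$, $(T-t^{1/2})(T+t^{-1/2})=0$, $t^{1/2}=q^{k/2}$; $\pi=YT^{-1}$. A root $q^{1/4}$ and other needed fractional powers of $q$ are fixed. The field of constants is $\mathbb Q(q^{1/4},t^{1/2})$ (or an extension of it), with the involution bar inverting $q^{1/4}$ and $t^{1/2}$. Polynomial representation $\mathcal P$ (Laurent polynomials in $X=q^x$): $X$ acts by multiplication, $T=t^{1/2}s+\frac{t^{1/2}-t^{-1/2}}{X^2-1}(s-1)$, $Y=\pi T$, with $s(X)=X^{-1}$, $\pi(X)=q^{1/2}X^{-1}$. $f(-k/2)$ is the value at $X=t^{-1/2}$; in $f(Y^{-1})$, $Y^{-1}$ is substituted for $X$. $m_\#=(m+\mathrm{sgn}(m)k)/2$, $\mathrm{sgn}(0)=-1$. Automorphisms of $\mathcal H\!\mathcal H$: $\tau_+$: $X\mapsto X$, $T\mapsto T$, $Y\mapsto q^{-1/4}XY$; $\tau_-$: $Y\mapsto Y$, $T\mapsto T$, $X\mapsto q^{1/4}YX$; the antilinear $\epsilon$: $X\mapsto Y$, $Y\mapsto X$, $T\mapsto T^{-1}$, $q\mapsto q^{-1}$, $t\mapsto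 t^{-1}$ (also on fractional powers). The anti-involution $\star$: $X,Y,T,q,t\mapsto X^{-1},Y^{-1},T^{-1},q^{-1},t^{-1}$ (also on fractional powers). A finite dimensional irreducible $\mathcal H\!\mathcal H$-module $V$ is called perfect if: (1) it is spherical, i.e. there is a surjection of $\mathcal H\!\mathcal H$-modules $\mathcal P\to V$; (2) it is $\{\tau_\pm,\epsilon\}$-invariant: there are invertible (linear for $\tau_\pm$, antilinear for $\epsilon$) operators on $V$ inducing the automorphisms $\tau_\pm$ and $\epsilon$ of $\mathcal H\!\mathcal H$ and satisfying $\tau_+\tau_-^{-1}\tau_+=\tau_-^{-1}\tau_+\tau_-^{-1}$, $\epsilon^2=1$, $\epsilon\tau_+=\tau_-\epsilon$; (3) it is $X$-pseudo-unitary: there is a nondegenerate form $\langle\cdot,\cdot\rangle$ on $V$ (linear in the first and bar-antilinear in the second argument) whose corresponding anti-involution of $\mathcal H\!\mathcal H$ is $\star$, and $\langle e,e\rangle\ne0$ for any $X$-eigenvector $e\in V$.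
   Formalization: The case k=0 (t^{1/2}=1) is excluded: there a perfect representation exists (functions on the 2N-th roots of unity, e.g. N=1, q^{1/4}=i, X=diag(1,-1), Y the swap, T=1), although k=0 is in neither (a) nor (b), so "exactly" fails. *)

theory Defs
  imports
    "HOL-Algebra.QuotRing"
    "HOL-Algebra.Module"
    "HOL-Algebra.Algebraic_Closure_Type"
    "HOL-Library.Poly_Mapping"
begin

text \<open>
  Conventions.  The field of constants is a type \<open>'k\<close> of class \<open>field_char_0\<close>; the
  variables \<open>q4\<close> and \<open>t2\<close> stand for \<open>q^(1/4)\<close> and \<open>t^(1/2)\<close>.
  All other fractional powers of \<open>q\<close> that occur are integral powers of \<open>q4\<close>.
\<close>

section \<open>Constants\<close>

definition prim_root_of_unity :: "nat \<Rightarrow> 'k::field_char_0 \<Rightarrow> bool" where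
  "prim_root_of_unity n x \<longleftrightarrow> n > 0 \<and> x ^ n = 1 \<and> (\<forall>d. 0 < d \<and> d < n \<longrightarrow> x ^ d \<noteq> 1)"

text \<open>\<open>qpow q4 z\<close> is \<open>q^z\<close>; it is only meaningful (and only used) if \<open>4 * z\<close> is an integer.\<close>

definition qpow :: "'k::field_char_0 \<Rightarrow> rat \<Rightarrow> 'k" where
  "qpow q4 z = q4 powi \<lfloor>4 * z\<rfloor>"

text \<open>\<open>t^(1/2) = q^(k/2)\<close> for a half-integer \<open>k\<close>.  If no such \<open>k\<close> exists,
  then \<open>t^(1/2) = q^(k/2)\<close> is just a name for the parameter \<open>t^(1/2)\<close>.\<close>

definition half_int_exponent :: "'k::field_char_0 \<Rightarrow> 'k \<Rightarrow> rat \<Rightarrow> bool" where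
  "half_int_exponent q4 t2 k \<longleftrightarrow> 2 * k \<in> \<int> \<and> t2 = qpow q4 (k / 2)"

definition bar_involution :: "'k::field_char_0 \<Rightarrow> 'k \<Rightarrow> ('k \<Rightarrow> 'k) \<Rightarrow> bool" where
  "bar_involution q4 t2 bar \<longleftrightarrow>
     (\<forall>a b. bar (a + b) = bar a + bar b) \<and> (\<forall>a b. bar (a * b) = bar a * bar b) \<and>
     bar 1 = 1 \<and> (\<forall>a. bar (bar a) = a) \<and> bar q4 = inverse q4 \<and> bar t2 = inverse t2"

section \<open>Modules over the double affine Hecke algebra\<close>

text \<open>
  The algebra is presented by the generators \<open>X\<close>, \<open>Y\<close> (invertible) and \<open>T\<close> and relations, so a
  module over it is a vector space with operators \<open>X\<close>, \<open>Y\<close>, \<open>T\<close> satisfying these relations.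
  Likewise (anti-)automorphisms are given by their values on generators, and conditions
  involving them are imposed on generators.
  The components \<open>mult\<close> and \<open>one\<close> that the record inherits from HOL-Algebra's modules are
  irrelevant.
\<close>

record ('k, 'v) daha_rep = "('k, 'v) module" +
  opX :: "'v \<Rightarrow> 'v"
  opY :: "'v \<Rightarrow> 'v"
  opT :: "'v \<Rightarrow> 'v"

definition op_inv :: "('k, 'v, 'm) daha_rep_scheme \<Rightarrow> ('v \<Rightarrow> 'v) \<Rightarrow> 'v \<Rightarrow> 'v" where
  "op_inv V A = inv_into (carrier V) A"

definition semilinear_map ::
  "('k \<Rightarrow> 'k) \<Rightarrow> ('k::field_char_0, 'v) daha_rep \<Rightarrow> ('k, 'w) daha_rep \<Rightarrow> ('v \<Rightarrow> 'w) \<Rightarrow> bool" where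
  "semilinear_map \<sigma> V W A \<longleftrightarrow>
     A \<in> carrier V \<rightarrow> carrier W \<and>
     (\<forall>u\<in>carrier V. \<forall>v\<in>carrier V. A (u \<oplus>\<^bsub>V\<^esub> v) = A u \<oplus>\<^bsub>W\<^esub> A v) \<and>
     (\<forall>c. \<forall>v\<in>carrier V. A (c \<odot>\<^bsub>V\<^esub> v) = \<sigma> c \<odot>\<^bsub>W\<^esub> A v)"

definition daha_module :: "'k::field_char_0 \<Rightarrow> 'k \<Rightarrow> ('k, 'v) daha_rep \<Rightarrow> bool" where
  "daha_module q4 t2 V \<longleftrightarrow>
     module ring_of_type_algebra V \<and>
     semilinear_map id V V (opX V) \<and> semilinear_map id V V (opY V) \<and>
     semilinear_map id V V (opT V) \<and>
     bij_betw (opX V) (carrier V) (carrier V) \<and> bij_betw (opY V) (carrier V) (carrier V) \<and>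
     (\<forall>v\<in>carrier V.
        opT V (opX V (opT V v)) = op_inv V (opX V) v \<and>
        opT V (op_inv V (opY V) (opT V v)) = opY V v \<and>
        (q4 ^ 2) \<odot>\<^bsub>V\<^esub>
          op_inv V (opY V) (op_inv V (opX V) (opY V (opX V (opT V (opT V v))))) = v \<and>
        opT V (opT V v \<oplus>\<^bsub>V\<^esub> inverse t2 \<odot>\<^bsub>V\<^esub> v) \<ominus>\<^bsub>V\<^esub>
          t2 \<odot>\<^bsub>V\<^esub> (opT V v \<oplus>\<^bsub>V\<^esub> inverse t2 \<odot>\<^bsub>V\<^esub> v) = \<zero>\<^bsub>V\<^esub>)"

definition daha_hom ::
  "('k::field_char_0, 'v) daha_rep \<Rightarrow> ('k, 'w) daha_rep \<Rightarrow> ('v \<Rightarrow> 'w) \<Rightarrow> bool" where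
  "daha_hom V W \<phi> \<longleftrightarrow>
     semilinear_map id V W \<phi> \<and>
     (\<forall>v\<in>carrier V. \<phi> (opX V v) = opX W (\<phi> v) \<and> \<phi> (opY V v) = opY W (\<phi> v) \<and>
                    \<phi> (opT V v) = opT W (\<phi> v))"

definition daha_iso :: "('k::field_char_0, 'v) daha_rep \<Rightarrow> ('k, 'w) daha_rep \<Rightarrow> bool" where
  "daha_iso V W \<longleftrightarrow> (\<exists>\<phi>. daha_hom V W \<phi> \<and> bij_betw \<phi> (carrier V) (carrier W))"

definition daha_submodule :: "('k::field_char_0, 'v) daha_rep \<Rightarrow> 'v set \<Rightarrow> bool" where
  "daha_submodule V U \<longleftrightarrow>
     submodule U ring_of_type_algebra V \<and>
     (\<forall>u\<in>U. opX V u \<in> U \<and> op_inv V (opX V) u \<in> U \<and>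
            opY V u \<in> U \<and> op_inv V (opY V) u \<in> U \<and> opT V u \<in> U)"

definition daha_irreducible :: "('k::field_char_0, 'v) daha_rep \<Rightarrow> bool" where
  "daha_irreducible V \<longleftrightarrow>
     carrier V \<noteq> {\<zero>\<^bsub>V\<^esub>} \<and>
     (\<forall>U. daha_submodule V U \<longrightarrow> U = {\<zero>\<^bsub>V\<^esub>} \<or> U = carrier V)"

definition finite_dim :: "('k::field_char_0, 'v) daha_rep \<Rightarrow> bool" where
  "finite_dim V \<longleftrightarrow>
     (\<exists>B. finite B \<and> B \<subseteq> carrier V \<and>
          (\<forall>v\<in>carrier V. \<exists>c. v = finsum V (\<lambda>b. c b \<odot>\<^bsub>V\<^esub> b) B))"

section \<open>The polynomial representation\<close>

type_synonym 'k laurent = "int \<Rightarrow>\<^sub>0 'k"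

definition laurent_eval :: "'k::field_char_0 laurent \<Rightarrow> 'k \<Rightarrow> 'k" where
  "laurent_eval f x = (\<Sum>n\<in>Poly_Mapping.keys f. Poly_Mapping.lookup f n * x powi n)"

text \<open>The substitution \<open>X \<mapsto> c X^(-1)\<close>: it is \<open>s\<close> for \<open>c = 1\<close> and \<open>\<pi>\<close> for \<open>c = q^(1/2)\<close>.\<close>

definition subst_inv :: "'k::field_char_0 \<Rightarrow> 'k laurent \<Rightarrow> 'k laurent" where
  "subst_inv c f =
     (\<Sum>n\<in>Poly_Mapping.keys f. Poly_Mapping.single (- n) (Poly_Mapping.lookup f n * c powi n))"

text \<open>\<open>(f(X^(-1)) - f(X)) / (X^2 - 1)\<close>\<close>

definition divided_diff :: "'k::field_char_0 laurent \<Rightarrow> 'k laurent" where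
  "divided_diff f = (THE g. (Poly_Mapping.single 2 1 - 1) * g = subst_inv 1 f - f)"

definition polT :: "'k::field_char_0 \<Rightarrow> 'k laurent \<Rightarrow> 'k laurent" where
  "polT t2 f = Poly_Mapping.single 0 t2 * subst_inv 1 f
             + Poly_Mapping.single 0 (t2 - inverse t2) * divided_diff f"

definition polY :: "'k::field_char_0 \<Rightarrow> 'k \<Rightarrow> 'k laurent \<Rightarrow> 'k laurent" where
  "polY q4 t2 f = subst_inv (q4 ^ 2) (polT t2 f)"

definition pol_rep :: "'k::field_char_0 \<Rightarrow> 'k \<Rightarrow> ('k, 'k laurent) daha_rep" where
  "pol_rep q4 t2 =
     \<lparr> carrier = UNIV, monoid.mult = (*), one = 1, ring.zero = 0, add = (+),
       module.smult = (\<lambda>c f. Poly_Mapping.single 0 c * f),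
       opX = (\<lambda>f. Poly_Mapping.single 1 1 * f), opY = polY q4 t2, opT = polT t2 \<rparr>"

text \<open>\<open>f(Y^(-1)) g\<close>, the result of applying \<open>f\<close> with \<open>Y^(-1)\<close> substituted for \<open>X\<close> to \<open>g\<close>\<close>

definition eval_at_Yinv ::
  "'k::field_char_0 \<Rightarrow> 'k \<Rightarrow> 'k laurent \<Rightarrow> 'k laurent \<Rightarrow> 'k laurent" where
  "eval_at_Yinv q4 t2 f g =
     (\<Sum>n\<in>Poly_Mapping.keys f. Poly_Mapping.single 0 (Poly_Mapping.lookup f n) *
        (if n \<ge> 0 then (inv_into UNIV (polY q4 t2) ^^ nat n) g else (polY q4 t2 ^^ nat (- n)) g))"

definition ev_form :: "'k::field_char_0 \<Rightarrow> 'k \<Rightarrow> 'k laurent \<Rightarrow> 'k laurent \<Rightarrow> 'k" where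
  "ev_form q4 t2 f g = laurent_eval (eval_at_Yinv q4 t2 f g) (inverse t2)"

definition Rad :: "'k::field_char_0 \<Rightarrow> 'k \<Rightarrow> 'k laurent set" where
  "Rad q4 t2 = {f. \<forall>g. ev_form q4 t2 f g = 0}"

text \<open>The additive group of \<open>quot_rep V U\<close> consists of the cosets of \<open>U\<close>; the operators
  are applied to representatives.\<close>

definition quot_rep :: "('k::field_char_0, 'v) daha_rep \<Rightarrow> 'v set \<Rightarrow> ('k, 'v set) daha_rep" where
  "quot_rep V U =
     (let lift = (\<lambda>A C. \<Union>v\<in>C. U +>\<^bsub>V\<^esub> A v) in
      \<lparr> carrier = a_rcosets\<^bsub>V\<^esub> U, monoid.mult = rcoset_mult V U, one = U +>\<^bsub>V\<^esub> \<one>\<^bsub>V\<^esub>,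
        ring.zero = U, add = set_add V, module.smult = (\<lambda>c. lift (\<lambda>v. c \<odot>\<^bsub>V\<^esub> v)),
        opX = lift (opX V), opY = lift (opY V), opT = lift (opT V) \<rparr>)"

section \<open>Perfect representations\<close>

definition spherical :: "'k::field_char_0 \<Rightarrow> 'k \<Rightarrow> ('k, 'v) daha_rep \<Rightarrow> bool" where
  "spherical q4 t2 V \<longleftrightarrow>
     (\<exists>\<phi>. daha_hom (pol_rep q4 t2) V \<phi> \<and> \<phi> ` carrier (pol_rep q4 t2) = carrier V)"

text \<open>An operator \<open>A\<close> induces the automorphism \<open>\<tau>\<close> if \<open>A H A^(-1) = \<tau>(H)\<close>,
  i.e. \<open>A H = \<tau>(H) A\<close>, for the generators \<open>H\<close>.\<close>

definition induces_tau_plus :: "'k::field_char_0 \<Rightarrow> ('k, 'v) daha_rep \<Rightarrow> ('v \<Rightarrow> 'v) \<Rightarrow> bool" where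
  "induces_tau_plus q4 V A \<longleftrightarrow>
     (\<forall>v\<in>carrier V. A (opX V v) = opX V (A v) \<and> A (opT V v) = opT V (A v) \<and>
                    A (opY V v) = inverse q4 \<odot>\<^bsub>V\<^esub> opX V (opY V (A v)))"

definition induces_tau_minus :: "'k::field_char_0 \<Rightarrow> ('k, 'v) daha_rep \<Rightarrow> ('v \<Rightarrow> 'v) \<Rightarrow> bool" where
  "induces_tau_minus q4 V A \<longleftrightarrow>
     (\<forall>v\<in>carrier V. A (opY V v) = opY V (A v) \<and> A (opT V v) = opT V (A v) \<and>
                    A (opX V v) = q4 \<odot>\<^bsub>V\<^esub> opY V (opX V (A v)))"

definition induces_epsilon :: "('k::field_char_0, 'v) daha_rep \<Rightarrow> ('v \<Rightarrow> 'v) \<Rightarrow> bool" where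
  "induces_epsilon V A \<longleftrightarrow>
     (\<forall>v\<in>carrier V. A (opX V v) = opY V (A v) \<and> A (opY V v) = opX V (A v) \<and>
                    A (opT V v) = op_inv V (opT V) (A v))"

definition tau_epsilon_invariant ::
  "'k::field_char_0 \<Rightarrow> ('k \<Rightarrow> 'k) \<Rightarrow> ('k, 'v) daha_rep \<Rightarrow> bool" where
  "tau_epsilon_invariant q4 bar V \<longleftrightarrow>
     (\<exists>P M E.
        semilinear_map id V V P \<and> bij_betw P (carrier V) (carrier V) \<and> induces_tau_plus q4 V P \<and>
        semilinear_map id V V M \<and> bij_betw M (carrier V) (carrier V) \<and> induces_tau_minus q4 V M \<and>
        semilinear_map bar V V E \<and> bij_betw E (carrier V) (carrier V) \<and> induces_epsilon V E \<and>
        (\<forall>v\<in>carrier V.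
           P (op_inv V M (P v)) = op_inv V M (P (op_inv V M v)) \<and>
           E (E v) = v \<and> E (P v) = M (E v)))"

text \<open>Sesquilinear forms with \<open>\<langle>H f, g\<rangle> = \<langle>f, H\<^sup>\<star> g\<rangle>\<close>\<close>

definition star_form ::
  "('k \<Rightarrow> 'k) \<Rightarrow> ('k::field_char_0, 'v) daha_rep \<Rightarrow> ('v \<Rightarrow> 'v \<Rightarrow> 'k) \<Rightarrow> bool" where
  "star_form bar V F \<longleftrightarrow>
     (\<forall>f\<in>carrier V. \<forall>g\<in>carrier V. \<forall>h\<in>carrier V.
        F (f \<oplus>\<^bsub>V\<^esub> g) h = F f h + F g h \<and> F h (f \<oplus>\<^bsub>V\<^esub> g) = F h f + F h g) \<and>
     (\<forall>c. \<forall>f\<in>carrier V. \<forall>g\<in>carrier V.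
        F (c \<odot>\<^bsub>V\<^esub> f) g = c * F f g \<and> F f (c \<odot>\<^bsub>V\<^esub> g) = bar c * F f g) \<and>
     (\<forall>A\<in>{opX V, opY V, opT V}. \<forall>f\<in>carrier V. \<forall>g\<in>carrier V. F (A f) g = F f (op_inv V A g))"

definition nondegenerate_form :: "('k::field_char_0, 'v) daha_rep \<Rightarrow> ('v \<Rightarrow> 'v \<Rightarrow> 'k) \<Rightarrow> bool" where
  "nondegenerate_form V F \<longleftrightarrow>
     (\<forall>f\<in>carrier V. (\<forall>g\<in>carrier V. F f g = 0) \<longrightarrow> f = \<zero>\<^bsub>V\<^esub>) \<and>
     (\<forall>g\<in>carrier V. (\<forall>f\<in>carrier V. F f g = 0) \<longrightarrow> g = \<zero>\<^bsub>V\<^esub>)"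

definition X_pseudo_unitary_form ::
  "('k \<Rightarrow> 'k) \<Rightarrow> ('k::field_char_0, 'v) daha_rep \<Rightarrow> ('v \<Rightarrow> 'v \<Rightarrow> 'k) \<Rightarrow> bool" where
  "X_pseudo_unitary_form bar V F \<longleftrightarrow>
     star_form bar V F \<and> nondegenerate_form V F \<and>
     (\<forall>e\<in>carrier V. \<forall>c. e \<noteq> \<zero>\<^bsub>V\<^esub> \<and> opX V e = c \<odot>\<^bsub>V\<^esub> e \<longrightarrow> F e e \<noteq> 0)"

definition perfect ::
  "'k::field_char_0 \<Rightarrow> 'k \<Rightarrow> ('k \<Rightarrow> 'k) \<Rightarrow> ('k, 'v) daha_rep \<Rightarrow> bool" where
  "perfect q4 t2 bar V \<longleftrightarrow>
     daha_module q4 t2 V \<and> finite_dim V \<and> daha_irreducible V \<and>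
     spherical q4 t2 V \<and> tau_epsilon_invariant q4 bar V \<and>
     (\<exists>F. X_pseudo_unitary_form bar V F)"

section \<open>Functions on finite sets of points\<close>

definition bowtie_a :: "nat \<Rightarrow> rat \<Rightarrow> rat set" where
  "bowtie_a N k =
     {(k - of_nat N + of_nat i) / 2 | i::nat. 1 \<le> i \<and> (k - of_nat N + of_nat i) / 2 \<le> - k / 2} \<union>
     {(k + of_nat i) / 2 | i::nat. 1 \<le> i \<and> (k + of_nat i) / 2 \<le> (of_nat N - k) / 2}"

definition bowtie_b :: "nat \<Rightarrow> rat set" where
  "bowtie_b n =
     {(1/2 - of_nat n + of_nat i) / 2 | i::nat. (1/2 - of_nat n + of_nat i) / 2 \<le> (1/2 + of_nat n) / (2 :: rat)}"

text \<open>Functions on \<open>B\<close> are represented by extensional functions.\<close>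

definition funT :: "'k::field_char_0 \<Rightarrow> 'k \<Rightarrow> rat set \<Rightarrow> (rat \<Rightarrow> 'k) \<Rightarrow> rat \<Rightarrow> 'k" where
  "funT q4 t2 B f =
     (\<lambda>z\<in>B. (let c = (t2 * qpow q4 (2 * z) - inverse t2) / (qpow q4 (2 * z) - 1)
             in if c = 0 then 0 else c * f (- z))
           - (t2 - inverse t2) / (qpow q4 (2 * z) - 1) * f z)"

definition funPi :: "rat set \<Rightarrow> (rat \<Rightarrow> 'k::field_char_0) \<Rightarrow> rat \<Rightarrow> 'k" where
  "funPi B f = (\<lambda>z\<in>B. f (1/2 - z))"

text \<open>Since \<open>\<pi> = Y T^(-1)\<close>, the operator \<open>Y\<close> is \<open>\<pi> T\<close>.\<close>

definition fun_rep :: "'k::field_char_0 \<Rightarrow> 'k \<Rightarrow> rat set \<Rightarrow> ('k, rat \<Rightarrow> 'k) daha_rep" where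
  "fun_rep q4 t2 B =
     \<lparr> carrier = B \<rightarrow>\<^sub>E UNIV, monoid.mult = (\<lambda>f g. \<lambda>z\<in>B. f z * g z), one = (\<lambda>z\<in>B. 1),
       ring.zero = (\<lambda>z\<in>B. 0), add = (\<lambda>f g. \<lambda>z\<in>B. f z + g z),
       module.smult = (\<lambda>c f. \<lambda>z\<in>B. c * f z),
       opX = (\<lambda>f. \<lambda>z\<in>B. qpow q4 z * f z),
       opY = (\<lambda>f. funPi B (funT q4 t2 B f)), opT = funT q4 t2 B \<rparr>"

definition sharp :: "rat \<Rightarrow> int \<Rightarrow> rat" where
  "sharp k m = (of_int m + (if m > 0 then 1 else - 1) * k) / 2"

definition mu1_value :: "'k::field_char_0 \<Rightarrow> rat \<Rightarrow> nat \<Rightarrow> 'k" where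
  "mu1_value q4 k m =
     qpow q4 (- k * (of_nat m - 1)) *
     (\<Prod>i=1..m-1. (1 - qpow q4 (2 * k + of_nat i)) / (1 - qpow q4 (of_nat i)))"

text \<open>\<open>\<mu>\<close> is \<open>\<mu>\<^sup>1\<close> on \<open>B\<close>.  For negative half-integers \<open>k\<close> a point of \<open>B\<close> can be written
  as \<open>m\<^sub>#\<close> both with some \<open>m > 0\<close> and with some \<open>m \<le> 0\<close>, so the existence of \<open>\<mu>\<close> is not
  automatic.\<close>

definition is_mu1 :: "'k::field_char_0 \<Rightarrow> rat \<Rightarrow> rat set \<Rightarrow> (rat \<Rightarrow> 'k) \<Rightarrow> bool" where
  "is_mu1 q4 k B \<mu> \<longleftrightarrow>
     (\<forall>m>0. \<forall>z\<in>B. z = sharp k (int m) \<or> z = sharp k (1 - int m) \<longrightarrow> \<mu> z = mu1_value q4 k m)"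

definition fun_form ::
  "('k::field_char_0 \<Rightarrow> 'k) \<Rightarrow> rat set \<Rightarrow> (rat \<Rightarrow> 'k) \<Rightarrow> (rat \<Rightarrow> 'k) \<Rightarrow> (rat \<Rightarrow> 'k) \<Rightarrow> 'k" where
  "fun_form bar B \<mu> f g = (\<Sum>z\<in>B. f z * bar (g z) * \<mu> z)"

end

theory Submission
  imports Defs "HOL-Computational_Algebra.Polynomial"
begin

text \<open>
  Laurent polynomials are compared by their values off a finite set of points, where \<open>T\<close> acts by
  \<open>(T f)(x) = \<alpha>(x) f(1/x) - \<beta>(x) f(x)\<close>.  The evaluation form is symmetric, so \<open>Rad\<close> is a submodule,
  and it is the only maximal submodule \<open>J\<close> such that \<open>X\<close> has the eigenvalue \<open>t^(-1/2)\<close> on \<open>P/J\<close>.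

  If \<open>V = P/J\<close> is perfect, \<open>\<epsilon>\<close> maps the spherical vector, which is a \<open>Y\<close>-eigenvector, to an \<open>X\<close>-eigenvector
  with eigenvalue \<open>t^(-1/2)\<close>; hence \<open>J = Rad\<close>.  The common zeros of \<open>J\<close> are closed under \<open>x \<mapsto> q^(1/2)/x\<close>,
  and under \<open>x \<mapsto> 1/x\<close> where \<open>\<alpha>(x) \<noteq> 0\<close>, which produces a path that starts in \<open>t^(-1/2)\<close>.  If \<open>t^(1/2)\<close> is not
  a power of \<open>q^(1/4)\<close>, the path is a full orbit, and following the function by which \<open>\<tau>\<^sub>+\<close> acts
  along it gives \<open>t^N = 1\<close>, a contradiction.  If \<open>k\<close> is a negative integer, the path reaches \<open>1\<close>, so all
  elements of \<open>J\<close> have a double zero there and \<open>X\<close> has an isotropic eigenvector.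

  Conversely the path stops after finitely many steps and its points are the values \<open>q^z\<close> at the points of
  the given set.  There \<open>\<tau>\<^sub>+\<close> is multiplication by a Gaussian.  The antilinear map
  \<open>f \<mapsto> (bar f)(Y) \<delta>\<close> induces \<open>\<epsilon>\<close>, again because \<open>Rad\<close> is determined by the eigenvalue of \<open>X\<close>.  Its square is a
  scalar \<open>c\<close>, and since \<open>\<tau>\<^sub>+ \<tau>\<^sub>-\<^sup>-\<^sup>1 \<tau>\<^sub>+\<close> maps \<open>\<delta>\<close> to a multiple \<open>s\<close> of the spherical vector, \<open>c = s (bar s)\<close>; so no
  square roots are needed to normalize \<open>\<epsilon>\<close>.
\<close>

section \<open>Laurent polynomials\<close>

text \<open>The field of constants is an arbitrary one of characteristic zero, so neither
  eigenvalues nor Schur's lemma come for free: every eigenvector has to be exhibited, and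
  intertwiners are shown to be scalar by means of the line of spherical vectors. The vector 1 is the
  source of the other eigenvectors, since T and Y act on it by t^(1/2).

  The fate of a parameter is decided by a race between two events on the path. At x = t^(1/2)
  q^(m/2) the path breaks off if \<alpha>(x) = 0, that is q^(2k + m) = 1, and T is singular if x^2 =
  1, that is q^(k + m) = 1. For 0 < k < N/2 the first event wins, at m = N - 2k. For -N/2 <= k < 0
  it would happen at m = -2k; if k is an integer, the second event precedes it at m = -k, and if k
  is not an integer, the second event never happens.

  All exponents are kept as integers: J = 2k and u = 4z, so that t^(1/2) and q^z become the powers
  of q^(1/4) with exponents J and u, and coincidences become divisibility by 4N.\<close>

abbreviation lC :: "'k::field_char_0 \<Rightarrow> 'k laurent" where "lC c \<equiv> Poly_Mapping.single 0 c"
abbreviation lX :: "int \<Rightarrow> 'k::field_char_0 laurent" where "lX n \<equiv> Poly_Mapping.single n 1"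

lemma laurent_induct_single [case_names single add]:
  fixes f :: "'k::field_char_0 laurent"
  assumes single: "\<And>n c. P (Poly_Mapping.single n c)" and add: "\<And>f g. P f \<Longrightarrow> P g \<Longrightarrow> P (f + g)"
  shows "P f"
proof -
  have "P (\<Sum>n\<in>A. Poly_Mapping.single n (g n))" if "finite A" for A g
    using that
  proof (induction A)
    case empty then show ?case using single[of 0 0] by simp
  next
    case (insert a A) then show ?case using add single by simp
  qed
  moreover have "f = (\<Sum>n\<in>Poly_Mapping.keys f. Poly_Mapping.single n (Poly_Mapping.lookup f n))"
    by (rule poly_mapping_eqI) (simp add: lookup_sum lookup_single when_def in_keys_iff)
  ultimately show ?thesis by (metis finite_keys)
qed

text \<open>The induction principle behind the operator identities: a statement about f only has to
  be carried through multiplication by X and its inverse, and this is what the exchange rules of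
  \<open>T\<close>, \<open>Pi\<close> and \<open>Y\<close> with X describe.\<close>

lemma laurent_induct [case_names const mult_X mult_Xinv add]:
  fixes f :: "'k::field_char_0 laurent"
  assumes c: "\<And>c. P (lC c)" and X: "\<And>f. P f \<Longrightarrow> P (lX 1 * f)"
    and Xi: "\<And>f. P f \<Longrightarrow> P (lX (-1) * f)" and add: "\<And>f g. P f \<Longrightarrow> P g \<Longrightarrow> P (f + g)"
  shows "P f"
proof (induction f rule: laurent_induct_single)
  case (single n c)
  show ?case
  proof (induction n rule: int_induct[where k = 0])
    case base show ?case by (rule c)
  next
    case (step1 i) then show ?case using X[of "Poly_Mapping.single i c"] by (simp add: mult_single add.commute)
  next
    case (step2 i) then show ?case using Xi[of "Poly_Mapping.single i c"] by (simp add: mult_single)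
  qed
qed (rule add)

text \<open>The condition on \<open>g\<close> covers c = 0, where the set of keys is empty instead
  of {n}.\<close>

lemma keys_sum_single:
  assumes "\<And>k. g k 0 = 0"
  shows "(\<Sum>k\<in>Poly_Mapping.keys (Poly_Mapping.single n c). g k (Poly_Mapping.lookup (Poly_Mapping.single n c) k)) = g n c"
  using assms by (cases "c = 0") auto

lemma laurent_eval_single: "laurent_eval (Poly_Mapping.single n c) x = c * x powi n"
  unfolding laurent_eval_def by (subst keys_sum_single) auto

lemma laurent_eval_add: "laurent_eval (f + g) x = laurent_eval f x + laurent_eval g x"
  unfolding laurent_eval_def by (rule setsum_keys_plus_distrib) (auto simp: algebra_simps)

lemma laurent_eval_zero [simp]: "laurent_eval 0 x = 0"
  by (simp add: laurent_eval_def)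

lemma laurent_eval_one [simp]: "laurent_eval 1 x = 1"
  using laurent_eval_single[of 0 1 x] by simp

lemma laurent_eval_minus: "laurent_eval (f - g) x = laurent_eval f x - laurent_eval g x"
  using laurent_eval_add[of "f - g" g x] by simp

lemma laurent_eval_single_mult:
  assumes "x \<noteq> 0"
  shows "laurent_eval (Poly_Mapping.single n c * f) x = c * x powi n * laurent_eval f x"
\<comment> \<open>The monomial stays arbitrary so that a factor X of f can be absorbed into
  it.\<close>
proof (induction f arbitrary: n c rule: laurent_induct)
  case (const d) then show ?case by (simp add: mult_single laurent_eval_single)
next
  case (mult_X f)
  have "laurent_eval (Poly_Mapping.single n c * (lX 1 * f)) x = laurent_eval (Poly_Mapping.single (n+1) c * f) x"
    by (simp add: mult.assoc[symmetric] mult_single)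
  then show ?case using mult_X[of "n+1" c] mult_X[of 1 1] assms by (simp add: power_int_add)
next
  case (mult_Xinv f)
  have "laurent_eval (Poly_Mapping.single n c * (lX (-1) * f)) x = laurent_eval (Poly_Mapping.single (n-1) c * f) x"
    by (simp add: mult.assoc[symmetric] mult_single)
  also have "\<dots> = c * x powi (n - 1) * laurent_eval f x" by (rule mult_Xinv)
  also have "\<dots> = c * x powi n * laurent_eval (lX (-1) * f) x"
    unfolding mult_Xinv[of "-1" 1] using assms by (simp add: power_int_diff power_int_minus divide_inverse)
  finally show ?case .
next
  case (add f g) then show ?case by (simp add: distrib_left laurent_eval_add)
qed

lemma laurent_eval_mult:
  assumes "x \<noteq> 0"
  shows "laurent_eval (f * g) x = laurent_eval f x * laurent_eval g x"
proof (induction f rule: laurent_induct)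
  case (const c) then show ?case using assms by (simp add: laurent_eval_single_mult laurent_eval_single)
next
  case (mult_X f) then show ?case using assms by (simp add: laurent_eval_single_mult mult.assoc)
next
  case (mult_Xinv f) then show ?case using assms by (simp add: laurent_eval_single_mult mult.assoc)
next
  case (add f g') then show ?case by (simp add: distrib_right laurent_eval_add)
qed

lemma laurent_eval_sum: "laurent_eval (\<Sum>i\<in>A. f i) x = (\<Sum>i\<in>A. laurent_eval (f i) x)"
  by (induction A rule: infinite_finite_induct) (auto simp: laurent_eval_add)

lemma laurent_eval_prod:
  "x \<noteq> 0 \<Longrightarrow> laurent_eval (\<Prod>i\<in>A. f i) x = (\<Prod>i\<in>A. laurent_eval (f i) x)"
  by (induction A rule: infinite_finite_induct) (auto simp: laurent_eval_mult)

lemmas laurent_eval_simps =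
  laurent_eval_add laurent_eval_minus laurent_eval_mult laurent_eval_single

text \<open>Bridge to ordinary polynomials, for which root counts and multiplicities are available.
  Distinct exponents n go to distinct degrees n + m, hence p = 0 only for f = 0.\<close>

lemma laurent_times_X_power_is_poly:
  fixes f :: "'k::field_char_0 laurent"
  obtains m p where "\<And>x. x \<noteq> 0 \<Longrightarrow> x ^ m * laurent_eval f x = poly p x" "p = 0 \<Longrightarrow> f = 0"
proof -
  obtain m :: nat where m: "\<And>n. n \<in> Poly_Mapping.keys f \<Longrightarrow> - n \<le> int m"
  proof -
    \<comment> \<open>Including 0 makes the bound nonnegative, so that \<open>nat b\<close> loses
      nothing.\<close>
    have "finite (insert 0 (uminus ` Poly_Mapping.keys f))" by simp
    then obtain b where "\<forall>k\<in>insert 0 (uminus ` Poly_Mapping.keys f). k \<le> b"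
      by (meson bdd_above_def bdd_above_finite)
    then show ?thesis by (intro that[of "nat b"]) auto
  qed
  define p where "p = (\<Sum>n\<in>Poly_Mapping.keys f. monom (Poly_Mapping.lookup f n) (nat (n + int m)))"
  have 1: "x ^ m * laurent_eval f x = poly p x" if "x \<noteq> 0" for x
  proof -
    have "x ^ m * laurent_eval f x = (\<Sum>n\<in>Poly_Mapping.keys f. Poly_Mapping.lookup f n * x ^ nat (n + int m))"
      unfolding laurent_eval_def sum_distrib_left
    proof (rule sum.cong)
      fix n assume "n \<in> Poly_Mapping.keys f"
      then have "0 \<le> n + int m" using m by fastforce
      then have "x ^ nat (n + int m) = x powi (n + int m)" by (simp add: power_int_nonneg_exp)
      also have "\<dots> = x powi n * x ^ m" using that by (simp add: power_int_add)
      finally show "x ^ m * (Poly_Mapping.lookup f n * x powi n) = Poly_Mapping.lookup f n * x ^ nat (n + int m)" by simp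
    qed simp
    then show ?thesis by (simp add: p_def poly_sum poly_monom)
  qed
  have 2: "f = 0" if "p = 0"
  proof (rule poly_mapping_eqI)
    fix n
    show "Poly_Mapping.lookup f n = Poly_Mapping.lookup 0 n"
    proof (cases "n \<in> Poly_Mapping.keys f")
      case True
      have "coeff p (nat (n + int m)) = (\<Sum>k\<in>Poly_Mapping.keys f. if k = n then Poly_Mapping.lookup f k else 0)"
        unfolding p_def coeff_sum coeff_monom
        by (rule sum.cong) (use m True in \<open>force simp: nat_eq_iff\<close>)+
      then show ?thesis using that True by simp
    qed (simp add: in_keys_iff)
  qed
  show ?thesis using that 1 2 by blast
qed

lemma laurent_eval_finite_zeros:
  fixes f :: "'k::field_char_0 laurent"
  assumes "f \<noteq> 0"
  shows "finite {x. x \<noteq> 0 \<and> laurent_eval f x = 0}"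
proof -
  obtain m p where mp: "\<And>x. x \<noteq> 0 \<Longrightarrow> x ^ m * laurent_eval f x = poly p x" "p = 0 \<Longrightarrow> f = 0"
    using laurent_times_X_power_is_poly by blast
  have "{x. x \<noteq> 0 \<and> laurent_eval f x = 0} \<subseteq> {x. poly p x = 0}" using mp(1) by force
  then show ?thesis using poly_roots_finite mp(2) assms finite_subset by blast
qed

text \<open>Operators with denominators can thus be compared pointwise, although their values are
  only given off the zeros of the denominators: a nonzero Laurent polynomial has finitely many
  zeros, whereas a field of characteristic zero is infinite.\<close>

lemma laurent_eqI:
  fixes f g :: "'k::field_char_0 laurent"
  assumes "finite A" "\<And>x. x \<noteq> 0 \<Longrightarrow> x \<notin> A \<Longrightarrow> laurent_eval f x = laurent_eval g x"
  shows "f = g"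
proof (rule ccontr)
  assume "f \<noteq> g"
  then have "finite {x. x \<noteq> 0 \<and> laurent_eval (f - g) x = 0}" by (intro laurent_eval_finite_zeros) simp
  moreover have "UNIV \<subseteq> insert 0 (A \<union> {x. x \<noteq> 0 \<and> laurent_eval (f - g) x = 0})"
    using assms(2) by (auto simp: laurent_eval_minus)
  ultimately have "finite (UNIV :: 'k set)" using assms(1) finite_subset by blast
  then show False using infinite_UNIV_char_0 by blast
qed

lemma subst_inv_single: "subst_inv c (Poly_Mapping.single n a) = Poly_Mapping.single (- n) (a * c powi n)"
  unfolding subst_inv_def by (subst keys_sum_single) auto

lemma subst_inv_add: "subst_inv c (f + g) = subst_inv c f + subst_inv c g"
  unfolding subst_inv_def by (rule setsum_keys_plus_distrib) (auto simp: algebra_simps single_add)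

lemma laurent_eval_subst_inv:
  assumes "x \<noteq> 0" "c \<noteq> 0"
  shows "laurent_eval (subst_inv c f) x = laurent_eval f (c / x)"
proof -
  have "laurent_eval (subst_inv c f) x = (\<Sum>n\<in>Poly_Mapping.keys f. Poly_Mapping.lookup f n * c powi n * x powi (- n))"
    unfolding subst_inv_def laurent_eval_sum by (simp add: laurent_eval_single)
  also have "\<dots> = laurent_eval f (c / x)"
    unfolding laurent_eval_def
    by (rule sum.cong) (auto simp: power_int_minus power_int_divide_distrib divide_inverse power_int_mult_distrib power_int_inverse)
  finally show ?thesis .
qed

text \<open>The quotients for X f and X^(-1) f are computed from the one for f, because the
  substitution is multiplicative and X^(-1) - X is a multiple of X^2 - 1.\<close>

lemma lX_2_minus_1_dvd: "\<exists>g. (lX 2 - 1) * g = subst_inv 1 f - (f :: 'k::field_char_0 laurent)"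
proof (induction f rule: laurent_induct)
  case (const c) then show ?case by (intro exI[of _ 0]) (simp add: subst_inv_single)
next
  case (mult_X f)
  then obtain g where g: "(lX 2 - 1) * g = subst_inv 1 f - f" by blast
  have s: "subst_inv 1 (lX 1 * f) = lX (-1) * subst_inv 1 f"
    by (rule laurent_eqI[of "{}"])
      (simp_all add: laurent_eval_subst_inv laurent_eval_mult laurent_eval_single power_int_minus divide_inverse)
  have "(lX 2 - 1) * (lX (-1) * g - lX (-1) * f) = lX (-1) * ((lX 2 - 1) * g) - (lX 2 - 1) * lX (-1) * f"
    by (simp add: algebra_simps)
  also have "\<dots> = lX (-1) * subst_inv 1 f - lX 1 * f"
    unfolding g by (simp add: algebra_simps mult.assoc[symmetric] mult_single)
  finally show ?case using s by metis
next
  case (mult_Xinv f)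
  then obtain g where g: "(lX 2 - 1) * g = subst_inv 1 f - f" by blast
  have s: "subst_inv 1 (lX (-1) * f) = lX 1 * subst_inv 1 f"
    by (rule laurent_eqI[of "{}"])
      (simp_all add: laurent_eval_subst_inv laurent_eval_mult laurent_eval_single power_int_minus)
  have "(lX 2 - 1) * (lX 1 * g + lX (-1) * f) = lX 1 * ((lX 2 - 1) * g) + (lX 2 - 1) * lX (-1) * f"
    by (simp add: algebra_simps)
  also have "\<dots> = lX 1 * subst_inv 1 f - lX (-1) * f"
    unfolding g by (simp add: algebra_simps mult.assoc[symmetric] mult_single)
  finally show ?case using s by metis
next
  case (add f f')
  then obtain g g' where "(lX 2 - 1) * g = subst_inv 1 f - f" "(lX 2 - 1) * g' = subst_inv 1 f' - f'" by blast
  then show ?case by (intro exI[of _ "g + g'"]) (simp add: subst_inv_add distrib_left)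
qed

lemma lX_2_minus_1_neq_0: "(lX 2 - 1 :: 'k::field_char_0 laurent) \<noteq> 0"
proof
  assume "(lX 2 - 1 :: 'k laurent) = 0"
  then have "Poly_Mapping.lookup (lX 2 - 1 :: 'k laurent) 2 = 0" by simp
  then show False by (simp add: lookup_minus lookup_single lookup_one)
qed

lemma divided_diff: "(lX 2 - 1) * divided_diff f = subst_inv 1 f - (f :: 'k::field_char_0 laurent)"
proof -
  have "\<exists>!g. (lX 2 - 1) * g = subst_inv 1 f - f"
  proof (rule ex_ex1I)
    show "\<exists>g. (lX 2 - 1) * g = subst_inv 1 f - f" by (rule lX_2_minus_1_dvd)
  next
    fix g g' assume "(lX 2 - 1) * g = subst_inv 1 f - f" "(lX 2 - 1) * g' = subst_inv 1 f - f"
    then have "(lX 2 - 1) * g = (lX 2 - 1) * g'" by simp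
    then show "g = g'" using lX_2_minus_1_neq_0 mult_left_cancel by blast
  qed
  then show ?thesis unfolding divided_diff_def by (rule theI')
qed

lemma laurent_eval_divided_diff:
  fixes f :: "'k::field_char_0 laurent"
  assumes "x \<noteq> 0"
  shows "(x\<^sup>2 - 1) * laurent_eval (divided_diff f) x = laurent_eval f (inverse x) - laurent_eval f x"
proof -
  have "laurent_eval ((lX 2 - 1) * divided_diff f) x = laurent_eval (subst_inv 1 f - f) x"
    by (simp only: divided_diff)
  then show ?thesis using assms
    by (simp add: laurent_eval_mult laurent_eval_minus laurent_eval_single laurent_eval_subst_inv inverse_eq_divide)
qed

section \<open>The polynomial representation\<close>

locale daha_param =
  fixes q4 t2 :: "'k::field_char_0"
  assumes q4_nz: "q4 \<noteq> 0" and t2_nz: "t2 \<noteq> 0"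
begin

definition h :: 'k where "h = t2 - inverse t2"
abbreviation T :: "'k laurent \<Rightarrow> 'k laurent" where "T \<equiv> polT t2"
abbreviation Pi :: "'k laurent \<Rightarrow> 'k laurent" where "Pi \<equiv> subst_inv (q4\<^sup>2)"
abbreviation Y :: "'k laurent \<Rightarrow> 'k laurent" where "Y \<equiv> polY q4 t2"
text \<open>The quadratic relation makes \<open>T - h\<close> the inverse of \<open>T\<close>; as
  \<open>Pi\<close> is an involution, \<open>Y = Pi T\<close> then has the inverse
  \<open>Ti Pi\<close>.\<close>

definition Ti :: "'k laurent \<Rightarrow> 'k laurent" where "Ti f = T f - lC h * f"
definition Yi :: "'k laurent \<Rightarrow> 'k laurent" where "Yi f = Ti (Pi f)"

text \<open>The coefficients of the action of T on functions in the theorem, with x in place of q^z.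
  Taking them as functions on the field lets the same identities serve for Laurent polynomials and
  for functions on the finite set.\<close>

definition \<alpha> :: "'k \<Rightarrow> 'k" where "\<alpha> x = (t2 * x\<^sup>2 - inverse t2) / (x\<^sup>2 - 1)"
definition \<beta> :: "'k \<Rightarrow> 'k" where "\<beta> x = h / (x\<^sup>2 - 1)"

lemma laurent_eval_T:
  assumes "x \<noteq> 0" "x\<^sup>2 \<noteq> 1"
  shows "laurent_eval (T f) x = \<alpha> x * laurent_eval f (inverse x) - \<beta> x * laurent_eval f x"
proof -
  have d: "laurent_eval (divided_diff f) x = (laurent_eval f (inverse x) - laurent_eval f x) / (x\<^sup>2 - 1)"
    using laurent_eval_divided_diff[of x f] assms by (simp add: field_simps)
  show ?thesis
    using assms t2_nz
    by (simp add: polT_def laurent_eval_simps laurent_eval_subst_inv d \<alpha>_def \<beta>_def h_def inverse_eq_divide[of x] divide_simps)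
      (simp add: algebra_simps)
qed

lemma laurent_eval_Pi: "x \<noteq> 0 \<Longrightarrow> laurent_eval (Pi f) x = laurent_eval f (q4\<^sup>2 / x)"
  using q4_nz by (simp add: laurent_eval_subst_inv)

lemma finite_square_roots: "finite {x :: 'k. x\<^sup>2 = a}"
proof -
  have "{x :: 'k. x\<^sup>2 = a} = {x. poly ([:- a, 0, 1:]) x = 0}" by (auto simp: power2_eq_square algebra_simps)
  then show ?thesis using poly_roots_finite[of "[:- a, 0, 1:]"] by simp
qed

text \<open>This is T 1 = t^(1/2) read pointwise: on constants the two terms combine to \<alpha> -
  \<beta>.\<close>

lemma \<alpha>_\<beta>: "x\<^sup>2 \<noteq> 1 \<Longrightarrow> \<alpha> x = t2 + \<beta> x"
  using t2_nz by (simp add: \<alpha>_def \<beta>_def h_def field_simps)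

lemma \<beta>_inverse: "x \<noteq> 0 \<Longrightarrow> x\<^sup>2 \<noteq> 1 \<Longrightarrow> \<beta> (inverse x) = - h - \<beta> x"
  using t2_nz by (simp add: \<beta>_def h_def divide_simps power_inverse) (simp add: algebra_simps)

lemma \<alpha>_inverse: "x \<noteq> 0 \<Longrightarrow> x\<^sup>2 \<noteq> 1 \<Longrightarrow> \<alpha> (inverse x) = inverse t2 - \<beta> x"
  using \<alpha>_\<beta>[of "inverse x"] \<beta>_inverse[of x] by (simp add: h_def power_inverse)

lemma laurent_T_eqI:
  assumes "\<And>x. x \<noteq> 0 \<Longrightarrow> x\<^sup>2 \<noteq> 1 \<Longrightarrow> laurent_eval f x = laurent_eval g x"
  shows "f = (g :: 'k laurent)"
  by (rule laurent_eqI[OF finite_square_roots[of 1]]) (use assms in auto)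

lemma T_add: "T (f + g) = T f + T g"
  by (rule laurent_T_eqI) (simp add: laurent_eval_T laurent_eval_simps algebra_simps)

lemma T_minus: "T (f - g) = T f - T g"
  by (rule laurent_T_eqI) (simp add: laurent_eval_T laurent_eval_simps algebra_simps)

lemma T_smult: "T (lC c * f) = lC c * T f"
  by (rule laurent_T_eqI) (simp add: laurent_eval_T laurent_eval_simps algebra_simps)

lemma T_const: "T (lC c) = lC (t2 * c)"
  by (rule laurent_T_eqI) (simp add: laurent_eval_T laurent_eval_simps \<alpha>_\<beta> algebra_simps)

text \<open>At a fixed x the operator only mixes f(x) and f(1/x). The corresponding 2x2 matrix has
  trace \<open>h\<close> and determinant -1, so this is its Cayley-Hamilton identity.\<close>

lemma T_T: "T (T f) = lC h * T f + f"
proof (rule laurent_T_eqI)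
  fix x :: 'k assume x: "x \<noteq> 0" "x\<^sup>2 \<noteq> 1"
  define a b where "a = laurent_eval f x" and "b = laurent_eval f (inverse x)"
  have "(t2 + \<beta> x) * ((inverse t2 - \<beta> x) * a - (- h - \<beta> x) * b) - \<beta> x * ((t2 + \<beta> x) * b - \<beta> x * a)
      = h * ((t2 + \<beta> x) * b - \<beta> x * a) + a"
    using t2_nz by (simp add: h_def field_simps)
  then show "laurent_eval (T (T f)) x = laurent_eval (lC h * T f + f) x"
    using x by (simp add: laurent_eval_T laurent_eval_simps \<alpha>_inverse \<beta>_inverse power_inverse a_def b_def)
      (simp add: \<alpha>_\<beta>)
qed

text \<open>The relation T X T = X^(-1) with the last T moved to the other side as T - h, which is
  the form that an induction over monomials can use.\<close>

lemma T_X: "T (lX 1 * f) = lX (-1) * T f - lC h * (lX (-1) * f)"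
proof (rule laurent_T_eqI)
  fix x :: 'k assume x: "x \<noteq> 0" "x\<^sup>2 \<noteq> 1"
  have "\<beta> x * x = h * inverse x + \<beta> x * inverse x" using x by (simp add: \<beta>_def divide_simps power2_eq_square) (simp add: algebra_simps)
  then have "\<beta> x * (x * laurent_eval f x) = (h * inverse x + \<beta> x * inverse x) * laurent_eval f x"
    by (metis mult.assoc)
  then show "laurent_eval (T (lX 1 * f)) x = laurent_eval (lX (-1) * T f - lC h * (lX (-1) * f)) x"
    using x by (simp add: laurent_eval_T laurent_eval_simps power_int_minus algebra_simps)
qed

lemma T_Xi: "T (lX (-1) * f) = lX 1 * T f + lC h * (lX (-1) * f)"
proof (rule laurent_T_eqI)
  fix x :: 'k assume x: "x \<noteq> 0" "x\<^sup>2 \<noteq> 1"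
  have "\<beta> x * x = h * inverse x + \<beta> x * inverse x" using x by (simp add: \<beta>_def divide_simps power2_eq_square) (simp add: algebra_simps)
  then have "\<beta> x * (x * laurent_eval f x) = (h * inverse x + \<beta> x * inverse x) * laurent_eval f x"
    by (metis mult.assoc)
  then show "laurent_eval (T (lX (-1) * f)) x = laurent_eval (lX 1 * T f + lC h * (lX (-1) * f)) x"
    using x by (simp add: laurent_eval_T laurent_eval_simps power_int_minus algebra_simps)
qed

lemma X_Xi [simp]: "lX 1 * (lX (-1) * f) = (f :: 'k laurent)" "lX (-1) * (lX 1 * f) = f"
  by (simp_all add: mult.assoc[symmetric] mult_single)

lemma lC_lC: "lC a * (lC b * f) = lC (a * b) * (f :: 'k laurent)"
  by (simp add: mult.assoc[symmetric] mult_single)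

lemma T_Ti [simp]: "T (Ti f) = f" by (simp add: Ti_def T_minus T_T T_smult)
lemma Ti_T [simp]: "Ti (T f) = f" by (simp add: Ti_def T_T)

lemma Pi_add: "Pi (f + g) = Pi f + Pi g" by (rule subst_inv_add)

lemma Pi_minus: "Pi (f - g) = Pi f - Pi g" using Pi_add[of "f - g" g] by simp

lemma Pi_smult: "Pi (lC c * f) = lC c * Pi f"
  by (rule laurent_eqI[of "{}"]) (use q4_nz in \<open>auto simp: laurent_eval_Pi laurent_eval_simps\<close>)

lemma Pi_const: "Pi (lC c) = lC c" by (simp add: subst_inv_single)

lemma Pi_Pi [simp]: "Pi (Pi f) = f"
  by (rule laurent_eqI[of "{}"]) (use q4_nz in \<open>auto simp: laurent_eval_Pi\<close>)

lemma Pi_X: "Pi (lX 1 * f) = lC (q4\<^sup>2) * (lX (-1) * Pi f)"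
  by (rule laurent_eqI[of "{}"])
    (use q4_nz in \<open>auto simp: laurent_eval_Pi laurent_eval_simps power_int_minus divide_inverse\<close>)

lemma Pi_Xi: "Pi (lX (-1) * f) = lC (inverse (q4\<^sup>2)) * (lX 1 * Pi f)"
  by (rule laurent_eqI[of "{}"])
    (use q4_nz in \<open>auto simp: laurent_eval_Pi laurent_eval_simps power_int_minus divide_inverse\<close>)

lemma Y_eq: "Y f = Pi (T f)" by (simp add: polY_def)
lemma Y_Yi [simp]: "Y (Yi f) = f" by (simp add: Y_eq Yi_def)
lemma Yi_Y [simp]: "Yi (Y f) = f" by (simp add: Y_eq Yi_def)

lemma Ti_add: "Ti (f + g) = Ti f + Ti g" by (simp add: Ti_def T_add algebra_simps)
lemma Ti_smult: "Ti (lC c * f) = lC c * Ti f" by (simp add: Ti_def T_smult right_diff_distrib mult.left_commute)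
lemma Y_add: "Y (f + g) = Y f + Y g" by (simp add: Y_eq T_add Pi_add)
lemma Y_smult: "Y (lC c * f) = lC c * Y f" by (simp add: Y_eq T_smult Pi_smult)
lemma Yi_add: "Yi (f + g) = Yi f + Yi g" by (simp add: Yi_def Ti_add Pi_add)
lemma Yi_smult: "Yi (lC c * f) = lC c * Yi f" by (simp add: Yi_def Ti_smult Pi_smult)

lemma T_X_T: "T (lX 1 * T f) = lX (-1) * f" by (simp add: T_X T_T distrib_left mult.left_commute)
lemma Ti_Xi: "Ti (lX (-1) * f) = lX 1 * T f" by (simp add: Ti_def T_Xi)

lemma Ti_const: "Ti (lC c) = lC (inverse t2 * c)"
  by (simp add: Ti_def T_const mult_single single_diff[symmetric] h_def algebra_simps)
lemma Y_const: "Y (lC c) = lC (t2 * c)" by (simp add: Y_eq T_const Pi_const)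
lemma Yi_const: "Yi (lC c) = lC (inverse t2 * c)" by (simp add: Yi_def Ti_const Pi_const)

lemma T_Yi: "T (Yi f) = Y (Ti f)" by (simp add: Yi_def Y_eq)
lemma Ti_Y: "Ti (Y f) = Yi (T f)" by (simp add: Yi_def Y_eq)
lemma T_Y: "T (Y f) = Yi (T f) + lC h * Y f" using Ti_Y[of f] by (simp add: Ti_def algebra_simps)

text \<open>X T turns out to be the adjoint of \<open>Pi\<close> under the evaluation form, where X
  and Y^(-1) are adjoint. This rule and the next one are the adjoints of \<open>Pi_X\<close> and
  \<open>Pi_Xi\<close>.\<close>

lemma XT_Y: "lX 1 * T (Y f) = lC (inverse (q4\<^sup>2)) * Yi (lX 1 * T f)"
  using q4_nz by (simp add: Yi_def Y_eq Pi_X Ti_smult Ti_Xi lC_lC)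

lemma XT_Yi: "lX 1 * T (Yi f) = lC (q4\<^sup>2) * Y (lX 1 * T f)"
  using q4_nz by (simp add: Yi_def Y_eq T_X_T Pi_Xi lC_lC)

lemma inv_Y: "inv_into UNIV Y = Yi"
  by (rule ext, rule inv_into_f_eq) (auto simp: inj_def, metis Yi_Y)

end

section \<open>The evaluation form\<close>

definition opow :: "('a \<Rightarrow> 'a) \<Rightarrow> ('a \<Rightarrow> 'a) \<Rightarrow> int \<Rightarrow> 'a \<Rightarrow> 'a" where
  "opow A A' n g = (if n \<ge> 0 then (A ^^ nat n) g else (A' ^^ nat (- n)) g)"

text \<open>Substitution of an invertible operator for X, with coefficients twisted by \<sigma>. It
  is needed twice: with Y^(-1) and the identity for the evaluation form, and with Y and the bar
  involution for the operator inducing \<epsilon>.\<close>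

locale laurent_action =
  fixes \<sigma> :: "'k::field_char_0 \<Rightarrow> 'k" and A A' :: "'k laurent \<Rightarrow> 'k laurent"
  assumes A_A' [simp]: "A (A' g) = g" and A'_A [simp]: "A' (A g) = g"
    and A_add: "A (f + g) = A f + A g" and A_smult: "A (lC c * g) = lC c * A g"
    and \<sigma>_add: "\<sigma> (a + b) = \<sigma> a + \<sigma> b" and \<sigma>_mult: "\<sigma> (a * b) = \<sigma> a * \<sigma> b"
begin

definition act :: "'k laurent \<Rightarrow> 'k laurent \<Rightarrow> 'k laurent" where
  "act f g = (\<Sum>n\<in>Poly_Mapping.keys f. lC (\<sigma> (Poly_Mapping.lookup f n)) * opow A A' n g)"

lemma A'_add: "A' (f + g) = A' f + A' g" using A_add[of "A' f" "A' g"] A'_A by (metis A_A')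
lemma A'_smult: "A' (lC c * g) = lC c * A' g" using A_smult[of c "A' g"] A'_A by (metis A_A')

lemma \<sigma>_0: "\<sigma> 0 = 0" using \<sigma>_add[of 0 0] by simp

lemma opow_A: "A (opow A A' n g) = opow A A' (n + 1) g"
proof (cases "n \<ge> 0")
  case True
  then have "nat (n + 1) = Suc (nat n)" by simp
  then show ?thesis using True by (simp add: opow_def)
next
  case False
  then have "nat (- n) = Suc (nat (- (n + 1)))" by simp
  then show ?thesis using False by (auto simp: opow_def)
qed

lemma opow_A': "A' (opow A A' n g) = opow A A' (n - 1) g"
  using opow_A[of "n - 1" g] by (metis A'_A diff_add_cancel)

lemma opow_shift: "opow A A' n (A g) = A (opow A A' n g)"
proof (induction n rule: int_induct[where k = 0])
  case base show ?case by (simp add: opow_def)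
next
  case (step1 i) then show ?case by (metis opow_A)
next
  case (step2 i) then show ?case by (metis opow_A' A_A' A'_A)
qed

lemma act_add_left: "act (f + f') g = act f g + act f' g"
  unfolding act_def
  by (rule setsum_keys_plus_distrib) (auto simp: \<sigma>_0 \<sigma>_add single_add algebra_simps)

lemma act_single: "act (Poly_Mapping.single n c) g = lC (\<sigma> c) * opow A A' n g"
  unfolding act_def by (subst keys_sum_single) (auto simp: \<sigma>_0)

lemma act_const: "act (lC c) g = lC (\<sigma> c) * g"
  by (simp add: act_single opow_def)

lemma act_smult_left: "act (lC c * f) g = lC (\<sigma> c) * act f g"
proof (induction f rule: laurent_induct_single)
  case (single n d)
  then show ?case by (simp add: mult_single act_single \<sigma>_mult mult.assoc[symmetric])
qed (simp add: distrib_left act_add_left)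

lemma act_X: "act (lX 1 * f) g = A (act f g)"
proof (induction f rule: laurent_induct_single)
  case (single n c)
  then show ?case by (simp add: mult_single act_single A_smult opow_A add.commute)
qed (simp add: distrib_left act_add_left A_add)

lemma act_Xi: "act (lX (-1) * f) g = A' (act f g)"
proof (induction f rule: laurent_induct_single)
  case (single n c)
  then show ?case by (simp add: mult_single act_single A'_smult opow_A')
qed (simp add: distrib_left act_add_left A'_add)

lemma act_minus_left: "act (f - f') g = act f g - act f' g"
  using act_add_left[of "f - f'" f' g] by simp

lemma act_shift: "act f (A g) = A (act f g)"
proof (induction f rule: laurent_induct_single)
  case (single n c)
  then show ?case by (simp add: act_single opow_shift A_smult)
qed (simp add: act_add_left A_add)

lemma act_shift': "act f (A' g) = A' (act f g)"
  using act_shift[of f "A' g"] by (metis A_A' A'_A)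

lemma opow_add: "opow A A' n (f + g) = opow A A' n f + opow A A' n g"
proof (induction n rule: int_induct[where k = 0])
  case base show ?case by (simp add: opow_def)
next
  case (step1 i) then show ?case by (metis opow_A A_add)
next
  case (step2 i) then show ?case by (metis opow_A' A'_add)
qed

lemma opow_smult: "opow A A' n (lC c * f) = lC c * opow A A' n f"
proof (induction n rule: int_induct[where k = 0])
  case base show ?case by (simp add: opow_def)
next
  case (step1 i) then show ?case by (metis opow_A A_smult)
next
  case (step2 i) then show ?case by (metis opow_A' A'_smult)
qed

lemma act_add_right: "act f (g + g') = act f g + act f g'"
  by (simp add: act_def opow_add distrib_left sum.distrib)

lemma act_smult_right: "act f (lC c * g) = lC c * act f g"
  by (simp add: act_def opow_smult sum_distrib_left mult.left_commute)

lemma act_minus_right: "act f (g - g') = act f g - act f g'"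
  using act_add_right[of f "g - g'" g'] by simp

end

lemma laurent_divide_linear:
  fixes x :: "'k::field_char_0"
  assumes "x \<noteq> 0"
  shows "\<exists>u. f - lC (laurent_eval f x) = (lX 1 - lC x) * u"
proof (induction f rule: laurent_induct)
  case (const c) then show ?case by (intro exI[of _ 0]) (simp add: laurent_eval_single)
next
  case (mult_X f)
  then obtain u where u: "f - lC (laurent_eval f x) = (lX 1 - lC x) * u" by blast
  have e: "lC (laurent_eval (lX 1 * f) x) = lC x * lC (laurent_eval f x)"
    using assms by (simp add: laurent_eval_single_mult mult_single)
  have "lX 1 * f - lC (laurent_eval (lX 1 * f) x)
      = lX 1 * (f - lC (laurent_eval f x)) + (lX 1 - lC x) * lC (laurent_eval f x)"
    unfolding e by (simp add: algebra_simps)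
  also have "\<dots> = (lX 1 - lC x) * (lX 1 * u + lC (laurent_eval f x))"
    unfolding u by (simp add: algebra_simps)
  finally show ?case by blast
next
  case (mult_Xinv f)
  then obtain u where u: "f - lC (laurent_eval f x) = (lX 1 - lC x) * u" by blast
  have u': "laurent_eval f y - laurent_eval f x = (y - x) * laurent_eval u y" if "y \<noteq> 0" for y
    using arg_cong[OF u, of "\<lambda>p. laurent_eval p y"] that by (simp add: laurent_eval_simps)
  \<comment> \<open>The witness comes from X^(-1) - x^(-1) = - (X - x) / (x X).\<close>
  have "lX (-1) * f - lC (laurent_eval (lX (-1) * f) x)
      = (lX 1 - lC x) * (lX (-1) * u - lC (laurent_eval f x / x) * lX (-1))"
  proof (rule laurent_eqI[of "{}"])
    fix y :: 'k assume y: "y \<noteq> 0"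
    have f: "laurent_eval f y = laurent_eval f x + (y - x) * laurent_eval u y"
      using u'[OF y] by (simp add: algebra_simps)
    show "laurent_eval (lX (-1) * f - lC (laurent_eval (lX (-1) * f) x)) y
        = laurent_eval ((lX 1 - lC x) * (lX (-1) * u - lC (laurent_eval f x / x) * lX (-1))) y"
      using y assms by (simp add: laurent_eval_simps f power_int_minus) (simp add: field_simps)
  qed simp
  then show ?case by blast
next
  case (add f g)
  then obtain u v where "f - lC (laurent_eval f x) = (lX 1 - lC x) * u" "g - lC (laurent_eval g x) = (lX 1 - lC x) * v"
    by blast
  moreover have "f + g - lC (laurent_eval (f + g) x) = (f - lC (laurent_eval f x)) + (g - lC (laurent_eval g x))"
    by (simp add: laurent_eval_add single_add)
  ultimately have "f + g - lC (laurent_eval (f + g) x) = (lX 1 - lC x) * (u + v)"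
    by (simp only: distrib_left)
  then show ?case by blast
qed

text \<open>If t were 1, the evaluation point t^(-1/2) would satisfy x^2 = 1, where the pointwise
  formula for T breaks down, and \<open>h\<close> would vanish.\<close>

locale daha_param_nontriv = daha_param q4 t2 for q4 t2 :: "'k::field_char_0" +
  assumes t2_sq: "t2\<^sup>2 \<noteq> 1"
begin

sublocale Yinv: laurent_action "\<lambda>c. c" Yi Y
  by unfold_locales (auto simp: Yi_add Yi_smult)

abbreviation ev0 :: "'k laurent \<Rightarrow> 'k" where "ev0 f \<equiv> laurent_eval f (inverse t2)"
abbreviation B :: "'k laurent \<Rightarrow> 'k laurent \<Rightarrow> 'k" where "B f g \<equiv> ev0 (Yinv.act f g)"

lemma ev_form_eq: "ev_form q4 t2 f g = B f g"
  by (simp add: ev_form_def eval_at_Yinv_def Yinv.act_def opow_def inv_Y cong: if_cong)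

lemma x0_sq: "(inverse t2)\<^sup>2 \<noteq> 1"
  using t2_sq by (simp add: power_inverse)

lemma h_nz: "h \<noteq> 0"
proof
  assume "h = 0"
  then have "t2 * t2 = 1" using t2_nz by (simp add: h_def field_simps)
  then show False using t2_sq by (simp add: power2_eq_square)
qed

lemma \<alpha>_x0: "\<alpha> (inverse t2) = 0"
  using t2_nz by (simp add: \<alpha>_def field_simps power2_eq_square)

text \<open>Evaluation at t^(-1/2) is an eigenfunctional of T because \<alpha> vanishes there. This
  singles out the point at which the form is evaluated.\<close>

lemma ev0_T: "ev0 (T f) = t2 * ev0 f"
  using \<alpha>_\<beta>[OF x0_sq] \<alpha>_x0 x0_sq t2_nz
  by (simp add: laurent_eval_T eq_neg_iff_add_eq_0 add.commute)
    (metis add_eq_0_iff2 mult_minus_left)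

lemma ev0_add: "ev0 (f + g) = ev0 f + ev0 g" by (rule laurent_eval_add)
lemma ev0_smult: "ev0 (lC c * f) = c * ev0 f" using t2_nz by (simp add: laurent_eval_single_mult)
lemma ev0_X: "ev0 (lX 1 * f) = inverse t2 * ev0 f" using t2_nz by (simp add: laurent_eval_single_mult)
lemma ev0_minus: "ev0 (f - g) = ev0 f - ev0 g" by (rule laurent_eval_minus)

lemmas ev0_simps = ev0_add ev0_smult ev0_X ev0_minus ev0_T

lemma T_Yi_alt: "T (Yi g) = Y (T g) - lC h * Y g"
  by (metis T_Y T_Ti T_Yi T_minus T_smult Ti_def Pi_minus Pi_smult Y_eq)

text \<open>The right argument is arbitrary in the induction, because every X that leaves the left
  argument becomes Y^(-1) in the right one. The exchange rules of T with X and of T with Y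
  correspond to each other under this move.\<close>

lemma B_T: "B (T f) g = B f (T g)"
proof (induction f arbitrary: g rule: laurent_induct)
  case (const c)
  then show ?case by (simp add: T_const Yinv.act_const ev0_simps)
next
  case (mult_X f)
  have "B (T (lX 1 * f)) g = B (T f) (Y g) - h * B f (Y g)"
    by (simp add: T_X Yinv.act_minus_left Yinv.act_smult_left Yinv.act_Xi Yinv.act_shift' ev0_simps)
  also have "\<dots> = B f (T (Y g) - lC h * Y g)"
    by (simp add: mult_X Yinv.act_minus_right Yinv.act_smult_right ev0_simps)
  also have "\<dots> = B (lX 1 * f) (T g)" by (simp add: T_Y Yinv.act_X Yinv.act_shift)
  finally show ?case .
next
  case (mult_Xinv f)
  have "B (T (lX (-1) * f)) g = B (T f) (Yi g) + h * B f (Y g)"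
    by (simp add: T_Xi Yinv.act_add_left Yinv.act_smult_left Yinv.act_Xi Yinv.act_X
        Yinv.act_shift' Yinv.act_shift ev0_simps)
  also have "\<dots> = B f (T (Yi g) + lC h * Y g)"
    by (simp add: mult_Xinv Yinv.act_add_right Yinv.act_smult_right ev0_simps)
  also have "\<dots> = B (lX (-1) * f) (T g)" by (simp add: T_Yi_alt Yinv.act_Xi Yinv.act_shift')
  finally show ?case .
next
  case (add f f')
  then show ?case by (simp add: T_add Yinv.act_add_left ev0_simps)
qed

text \<open>Expected from \<open>Pi = T Yi\<close>: T is self-adjoint and the adjoint of Y^(-1) is
  X. The proof runs in the opposite direction, since the adjoint of Y^(-1) is only derived from this
  rule.\<close>

lemma B_Pi: "B (Pi f) g = B f (lX 1 * T g)"
proof (induction f arbitrary: g rule: laurent_induct)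
  case (const c)
  then show ?case using t2_nz by (simp add: Pi_const Yinv.act_const ev0_simps)
next
  case (mult_X f)
  have "B (Pi (lX 1 * f)) g = q4\<^sup>2 * B (Pi f) (Y g)"
    by (simp add: Pi_X Yinv.act_smult_left Yinv.act_Xi Yinv.act_shift' ev0_simps)
  also have "\<dots> = q4\<^sup>2 * B f (lC (inverse (q4\<^sup>2)) * Yi (lX 1 * T g))"
    unfolding mult_X XT_Y ..
  also have "\<dots> = B (lX 1 * f) (lX 1 * T g)"
    using q4_nz by (simp add: Yinv.act_smult_right ev0_simps Yinv.act_X Yinv.act_shift)
  finally show ?case .
next
  case (mult_Xinv f)
  have "B (Pi (lX (-1) * f)) g = inverse (q4\<^sup>2) * B (Pi f) (Yi g)"
    by (simp add: Pi_Xi Yinv.act_smult_left Yinv.act_X Yinv.act_shift ev0_simps)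
  also have "\<dots> = inverse (q4\<^sup>2) * B f (lC (q4\<^sup>2) * Y (lX 1 * T g))"
    unfolding mult_Xinv XT_Yi ..
  also have "\<dots> = B (lX (-1) * f) (lX 1 * T g)"
    using q4_nz by (simp add: Yinv.act_smult_right ev0_simps Yinv.act_Xi Yinv.act_shift')
  finally show ?case .
next
  case (add f f')
  then show ?case by (simp add: Pi_add Yinv.act_add_left ev0_simps)
qed

lemma B_Ti: "B (Ti f) g = B f (Ti g)"
  by (simp add: Ti_def Yinv.act_minus_left Yinv.act_minus_right Yinv.act_smult_left
      Yinv.act_smult_right ev0_simps B_T)

lemma B_Yi: "B (Yi f) g = B f (lX 1 * g)"
  by (simp add: Yi_def B_Ti B_Pi)

lemma B_Y: "B (Y f) g = B f (lX (-1) * g)"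
  using B_Yi[of "Y f" "lX (-1) * g"] by simp

text \<open>Y acts on 1 by t^(1/2), so f(Y^(-1)) 1 is the constant f(t^(-1/2)).\<close>

lemma act_one_right: "ev0 (Yinv.act f 1) = ev0 f"
proof (induction f rule: laurent_induct)
  case (const c)
  then show ?case by (simp add: Yinv.act_const)
next
  case (mult_X f)
  have "B (lX 1 * f) 1 = B f (lC (inverse t2) * 1)"
    using Yi_const[of 1] by (simp add: Yinv.act_X flip: Yinv.act_shift)
  also have "\<dots> = inverse t2 * B f 1" by (simp only: Yinv.act_smult_right ev0_simps)
  finally show ?case using mult_X by (simp add: ev0_simps)
next
  case (mult_Xinv f)
  have "B (lX (-1) * f) 1 = B f (lC t2 * 1)"
    using Y_const[of 1] by (simp add: Yinv.act_Xi flip: Yinv.act_shift')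
  also have "\<dots> = t2 * B f 1" by (simp only: Yinv.act_smult_right ev0_simps)
  finally show ?case using mult_Xinv t2_nz by (simp add: laurent_eval_single_mult power_int_minus)
next
  case (add f g)
  then show ?case by (simp add: Yinv.act_add_left ev0_simps)
qed

text \<open>Adjointness moves the factors X of the right argument to the left as Y^(-1), where they
  act like the substitution itself; the base case is the value on 1.\<close>

lemma B_sym: "B f g = B g f"
proof (induction g arbitrary: f rule: laurent_induct)
  case (const c)
  have "B f (lC c) = B f (lC c * 1)" by simp
  also have "\<dots> = c * ev0 f" by (simp only: Yinv.act_smult_right ev0_simps act_one_right)
  finally show ?case by (simp add: Yinv.act_const ev0_simps)
next
  case (mult_X g)
  have "B f (lX 1 * g) = B g (Yi f)" using B_Yi[of f g] mult_X[of "Yi f"] by simp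
  then show ?case by (simp add: Yinv.act_X Yinv.act_shift)
next
  case (mult_Xinv g)
  have "B f (lX (-1) * g) = B g (Y f)" using B_Y[of f g] mult_Xinv[of "Y f"] by simp
  then show ?case by (simp add: Yinv.act_Xi Yinv.act_shift')
next
  case (add g g')
  then show ?case by (simp add: Yinv.act_add_left Yinv.act_add_right ev0_simps)
qed

end

section \<open>Submodules of the polynomial representation\<close>

context daha_param
begin

text \<open>Closure under \<open>Pi\<close> replaces closure under \<open>Y\<close> and its inverse.
  This is equivalent, because \<open>Ti\<close> is a combination of \<open>T\<close> and the
  identity, and \<open>Pi\<close> is easier to evaluate pointwise.\<close>

definition polsub :: "'k laurent set \<Rightarrow> bool" where
  "polsub J \<longleftrightarrow> 0 \<in> J \<and> (\<forall>f\<in>J. \<forall>g\<in>J. f + g \<in> J) \<and> (\<forall>c. \<forall>f\<in>J. lC c * f \<in> J) \<and>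
     (\<forall>f\<in>J. lX 1 * f \<in> J \<and> lX (-1) * f \<in> J \<and> T f \<in> J \<and> Pi f \<in> J)"

lemma polsubD:
  assumes "polsub J"
  shows "0 \<in> J" "f \<in> J \<Longrightarrow> g \<in> J \<Longrightarrow> f + g \<in> J" "f \<in> J \<Longrightarrow> lC c * f \<in> J" "f \<in> J \<Longrightarrow> lX 1 * f \<in> J"
    "f \<in> J \<Longrightarrow> lX (-1) * f \<in> J" "f \<in> J \<Longrightarrow> T f \<in> J" "f \<in> J \<Longrightarrow> Pi f \<in> J"
  using assms unfolding polsub_def by blast+

lemma polsub_uminus: "polsub J \<Longrightarrow> f \<in> J \<Longrightarrow> - f \<in> J"
  using polsubD(3)[of J f "-1"] by (simp add: single_uminus)

lemma polsub_minus: "polsub J \<Longrightarrow> f \<in> J \<Longrightarrow> g \<in> J \<Longrightarrow> f - g \<in> J"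
  using polsubD(2)[of J f "- g"] polsub_uminus[of J g] by simp

lemma polsub_mult: "polsub J \<Longrightarrow> f \<in> J \<Longrightarrow> p * f \<in> J"
proof (induction p rule: laurent_induct)
  case (mult_X p) then show ?case using polsubD(4) by (simp add: mult.assoc)
next
  case (mult_Xinv p) then show ?case using polsubD(5) by (simp add: mult.assoc)
next
  case (add p p') then show ?case using polsubD(2) by (simp add: distrib_right)
qed (rule polsubD(3))

lemma polsub_Ti: "polsub J \<Longrightarrow> f \<in> J \<Longrightarrow> Ti f \<in> J"
  unfolding Ti_def by (intro polsub_minus polsubD) 

lemma polsub_Y: "polsub J \<Longrightarrow> f \<in> J \<Longrightarrow> Y f \<in> J"
  unfolding Y_eq by (intro polsubD)

lemma polsub_Yi: "polsub J \<Longrightarrow> f \<in> J \<Longrightarrow> Yi f \<in> J"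
  unfolding Yi_def by (intro polsubD polsub_Ti)

text \<open>A submodule is an ideal. Writing f = f(x) + (X - x) u gives f(x) g = f g - u (X - x) g,
  which lies in J; as g does not, f(x) = 0.\<close>

lemma polsub_eigenvalue_zero:
  assumes J: "polsub J" and g: "g \<notin> J" "(lX 1 - lC x) * g \<in> J" and x: "x \<noteq> 0" and f: "f \<in> J"
  shows "laurent_eval f x = 0"
proof (rule ccontr)
  assume nz: "laurent_eval f x \<noteq> 0"
  obtain u where "f - lC (laurent_eval f x) = (lX 1 - lC x) * u" using laurent_divide_linear[OF x] by blast
  then have e: "lC (laurent_eval f x) = f - (lX 1 - lC x) * u" by (simp add: algebra_simps)
  have "lC (laurent_eval f x) * g = g * f - u * ((lX 1 - lC x) * g)"
    unfolding e by (simp add: algebra_simps)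
  then have "lC (laurent_eval f x) * g \<in> J"
    using polsub_minus[OF J polsub_mult[OF J f] polsub_mult[OF J g(2)]] by simp
  then have "lC (inverse (laurent_eval f x)) * (lC (laurent_eval f x) * g) \<in> J" by (rule polsubD(3)[OF J])
  then show False using nz g(1) by (simp add: lC_lC)
qed

end

context daha_param_nontriv
begin

lemma Rad_eq: "Rad q4 t2 = {f. \<forall>g. B f g = 0}"
  by (simp add: Rad_def ev_form_eq)

lemma one_notin_Rad: "1 \<notin> Rad q4 t2"
proof -
  have "B 1 1 = 1" using Yinv.act_const[of 1 1] by simp
  then show ?thesis unfolding Rad_eq by (metis (mono_tags) mem_Collect_eq zero_neq_one)
qed

lemma polsub_Rad: "polsub (Rad q4 t2)"
  unfolding polsub_def Rad_eq mem_Collect_eq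
  using Yinv.act_const[of 0]
  by (auto simp: Yinv.act_add_left ev0_simps Yinv.act_smult_left B_T B_Pi Yinv.act_X Yinv.act_Xi
      Yinv.act_shift[symmetric] Yinv.act_shift'[symmetric])

text \<open>For f in J all p(Y^(-1)) f lie in J and therefore vanish at t^(-1/2), so by symmetry f
  is in the radical. The radical is proper because the form is 1 on (1, 1), and maximality of J
  gives equality.\<close>

lemma polsub_maximal_eq_Rad:
  assumes J: "polsub J" and max: "\<And>K. polsub K \<Longrightarrow> J \<subseteq> K \<Longrightarrow> K = J \<or> K = UNIV"
    and g: "g \<notin> J" "(lX 1 - lC (inverse t2)) * g \<in> J"
  shows "J = Rad q4 t2"
proof -
  have act: "Yinv.act p f \<in> J" if "f \<in> J" for p f
    using that
  proof (induction p arbitrary: f rule: laurent_induct)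
    case (const c) then show ?case by (simp add: Yinv.act_const polsubD(3)[OF J])
  next
    case (mult_X p) then show ?case by (simp add: Yinv.act_X polsub_Yi[OF J])
  next
    case (mult_Xinv p) then show ?case by (simp add: Yinv.act_Xi polsub_Y[OF J])
  next
    case (add p p') then show ?case by (simp add: Yinv.act_add_left polsubD(2)[OF J])
  qed
  have "B f p = 0" if "f \<in> J" for f p
    using polsub_eigenvalue_zero[OF J g _ act[OF that]] t2_nz B_sym[of f p] by simp
  then have "J \<subseteq> Rad q4 t2" by (auto simp: Rad_eq)
  then show ?thesis using max[OF polsub_Rad] one_notin_Rad by auto
qed

end

section \<open>Modules over the double affine Hecke algebra\<close>

lemma ring_of_type_algebra_sel [simp]:
  "carrier ring_of_type_algebra = UNIV" "x \<otimes>\<^bsub>ring_of_type_algebra\<^esub> y = x * y"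
  "x \<oplus>\<^bsub>ring_of_type_algebra\<^esub> y = x + y" "\<one>\<^bsub>ring_of_type_algebra\<^esub> = 1"
  "\<zero>\<^bsub>ring_of_type_algebra\<^esub> = 0"
  by (simp_all add: ring_of_type_algebra_def)

lemma (in abelian_group) minus_eq_zero_iff:
  assumes "x \<in> carrier G" "y \<in> carrier G"
  shows "x \<ominus> y = \<zero> \<longleftrightarrow> x = y"
  using assms by (metis a_minus_def add.inv_solve_right' l_zero r_neg zero_closed)

lemma op_inv:
  assumes "bij_betw A (carrier V) (carrier V)" "v \<in> carrier V"
  shows op_inv_closed: "op_inv V A v \<in> carrier V" and op_inv_right: "A (op_inv V A v) = v"
    and op_inv_left: "op_inv V A (A v) = v"
  using assms unfolding op_inv_def
  by (metis bij_betw_def inv_into_into, metis bij_betw_inv_into_right, metis bij_betw_inv_into_left)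

lemma op_inv_eqI:
  assumes "bij_betw A (carrier V) (carrier V)" "w \<in> carrier V" "A w = v"
  shows "op_inv V A v = w"
  using op_inv_left[OF assms(1,2)] assms(3) by simp

text \<open>Explicit inverses replace the set-theoretic ones of the definition, and the scalar -1
  supplies additive inverses, so that only closure conditions and equations remain for a concrete
  module.\<close>

lemma daha_moduleI:
  fixes V (structure)
  assumes add: "\<And>u v. u \<in> carrier V \<Longrightarrow> v \<in> carrier V \<Longrightarrow> u \<oplus> v \<in> carrier V"
    "\<zero> \<in> carrier V"
    "\<And>u v w. u \<in> carrier V \<Longrightarrow> v \<in> carrier V \<Longrightarrow> w \<in> carrier V \<Longrightarrow> (u \<oplus> v) \<oplus> w = u \<oplus> (v \<oplus> w)"
    "\<And>u v. u \<in> carrier V \<Longrightarrow> v \<in> carrier V \<Longrightarrow> u \<oplus> v = v \<oplus> u"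
    "\<And>v. v \<in> carrier V \<Longrightarrow> \<zero> \<oplus> v = v"
    "\<And>v. v \<in> carrier V \<Longrightarrow> (-1) \<odot> v \<oplus> v = \<zero>"
    and smult: "\<And>c v. v \<in> carrier V \<Longrightarrow> c \<odot> v \<in> carrier V"
    "\<And>b c v. v \<in> carrier V \<Longrightarrow> (b + c) \<odot> v = b \<odot> v \<oplus> c \<odot> v"
    "\<And>c u v. u \<in> carrier V \<Longrightarrow> v \<in> carrier V \<Longrightarrow> c \<odot> (u \<oplus> v) = c \<odot> u \<oplus> c \<odot> v"
    "\<And>b c v. v \<in> carrier V \<Longrightarrow> (b * c) \<odot> v = b \<odot> (c \<odot> v)"
    "\<And>v. v \<in> carrier V \<Longrightarrow> 1 \<odot> v = v"
    and lin: "semilinear_map id V V (opX V)" "semilinear_map id V V (opY V)" "semilinear_map id V V (opT V)"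
    and inv: "\<And>v. v \<in> carrier V \<Longrightarrow> Xi v \<in> carrier V \<and> opX V (Xi v) = v \<and> Xi (opX V v) = v"
      "\<And>v. v \<in> carrier V \<Longrightarrow> Yi v \<in> carrier V \<and> opY V (Yi v) = v \<and> Yi (opY V v) = v"
    and rel: "\<And>v. v \<in> carrier V \<Longrightarrow> opT V (opX V (opT V v)) = Xi v"
      "\<And>v. v \<in> carrier V \<Longrightarrow> opT V (Yi (opT V v)) = opY V v"
      "\<And>v. v \<in> carrier V \<Longrightarrow> (q4 ^ 2) \<odot> Yi (Xi (opY V (opX V (opT V (opT V v))))) = v"
      "\<And>v. v \<in> carrier V \<Longrightarrow> opT V (opT V v \<oplus> inverse t2 \<odot> v) = t2 \<odot> (opT V v \<oplus> inverse t2 \<odot> v)"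
  shows "daha_module (q4 :: 'k::field_char_0) t2 V"
proof -
  have ab: "abelian_group V"
    by (rule abelian_groupI[OF add(1-5)]) (use add(6) smult(1) in blast)+
  have mod: "module ring_of_type_algebra V"
    by (rule moduleI) (use ab smult cring_from_type_algebra in auto)
  interpret abelian_group V by (rule ab)
  have cl: "opX V v \<in> carrier V" "opY V v \<in> carrier V" "opT V v \<in> carrier V" if "v \<in> carrier V" for v
    using lin that by (auto simp: semilinear_map_def)
  have bX: "bij_betw (opX V) (carrier V) (carrier V)"
    by (rule bij_betw_byWitness[where f' = Xi]) (use inv cl in auto)
  have bY: "bij_betw (opY V) (carrier V) (carrier V)"
    by (rule bij_betw_byWitness[where f' = Yi]) (use inv cl in auto)
  have iX: "op_inv V (opX V) v = Xi v" if "v \<in> carrier V" for v using op_inv_eqI[OF bX] inv that by blast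
  have iY: "op_inv V (opY V) v = Yi v" if "v \<in> carrier V" for v using op_inv_eqI[OF bY] inv that by blast
  show ?thesis
    unfolding daha_module_def
    using mod lin bX bY iX iY rel cl inv smult(1) by (simp add: minus_eq_zero_iff)
qed

locale daha_mod =
  fixes q4 t2 :: "'k::field_char_0" and V :: "('k, 'v) daha_rep" (structure)
  assumes daha: "daha_module q4 t2 V"
begin

lemma module: "module ring_of_type_algebra V" using daha by (simp add: daha_module_def)

sublocale M: module ring_of_type_algebra V by (rule module)

lemma smult_l_distr: "v \<in> carrier V \<Longrightarrow> (a + b) \<odot> v = a \<odot> v \<oplus> b \<odot> v"
  using M.smult_l_distr[of a b v] by simp
lemma smult_r_distr: "u \<in> carrier V \<Longrightarrow> v \<in> carrier V \<Longrightarrow> a \<odot> (u \<oplus> v) = a \<odot> u \<oplus> a \<odot> v"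
  using M.smult_r_distr[of a u v] by simp
lemma smult_closed [simp]: "v \<in> carrier V \<Longrightarrow> a \<odot> v \<in> carrier V"
  using M.smult_closed[of a v] by simp
lemma smult_smult: "v \<in> carrier V \<Longrightarrow> a \<odot> (b \<odot> v) = (a * b) \<odot> v"
  using M.smult_assoc1[of a b v] by simp
lemma smult_one [simp]: "v \<in> carrier V \<Longrightarrow> 1 \<odot> v = v"
  using M.smult_one[of v] by simp
lemma smult_zero_left [simp]: "v \<in> carrier V \<Longrightarrow> 0 \<odot> v = \<zero>"
  using M.smult_l_null[of v] by simp
lemma smult_zero_right [simp]: "a \<odot> \<zero> = \<zero>"
  using M.smult_r_null[of a] by simp
lemma smult_minus_one: "v \<in> carrier V \<Longrightarrow> (-1) \<odot> v \<oplus> v = \<zero>"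
  using smult_l_distr[of v "-1" 1] by simp

lemma a_inv_eq: "v \<in> carrier V \<Longrightarrow> \<ominus> v = (-1) \<odot> v"
  by (metis M.minus_equality smult_closed smult_minus_one)

lemma linX: "semilinear_map id V V (opX V)" and linY: "semilinear_map id V V (opY V)"
  and linT: "semilinear_map id V V (opT V)"
  and bijX: "bij_betw (opX V) (carrier V) (carrier V)" and bijY: "bij_betw (opY V) (carrier V) (carrier V)"
  using daha by (auto simp: daha_module_def)

abbreviation "Xi \<equiv> op_inv V (opX V)"
abbreviation "Yi \<equiv> op_inv V (opY V)"

lemma closed [simp]: "v \<in> carrier V \<Longrightarrow> opX V v \<in> carrier V" "v \<in> carrier V \<Longrightarrow> opY V v \<in> carrier V"
  "v \<in> carrier V \<Longrightarrow> opT V v \<in> carrier V" "v \<in> carrier V \<Longrightarrow> Xi v \<in> carrier V" "v \<in> carrier V \<Longrightarrow> Yi v \<in> carrier V"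
  using linX linY linT op_inv_closed[OF bijX] op_inv_closed[OF bijY] by (auto simp: semilinear_map_def)

lemma op_add: "u \<in> carrier V \<Longrightarrow> v \<in> carrier V \<Longrightarrow> opX V (u \<oplus> v) = opX V u \<oplus> opX V v"
  "u \<in> carrier V \<Longrightarrow> v \<in> carrier V \<Longrightarrow> opY V (u \<oplus> v) = opY V u \<oplus> opY V v"
  "u \<in> carrier V \<Longrightarrow> v \<in> carrier V \<Longrightarrow> opT V (u \<oplus> v) = opT V u \<oplus> opT V v"
  using linX linY linT by (auto simp: semilinear_map_def)

lemma op_smult: "v \<in> carrier V \<Longrightarrow> opX V (c \<odot> v) = c \<odot> opX V v"
  "v \<in> carrier V \<Longrightarrow> opY V (c \<odot> v) = c \<odot> opY V v"
  "v \<in> carrier V \<Longrightarrow> opT V (c \<odot> v) = c \<odot> opT V v"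
  using linX linY linT by (auto simp: semilinear_map_def)

lemma XXi [simp]: "v \<in> carrier V \<Longrightarrow> opX V (Xi v) = v" "v \<in> carrier V \<Longrightarrow> Xi (opX V v) = v"
  by (auto intro: op_inv_right[OF bijX] op_inv_left[OF bijX])

lemma YYi [simp]: "v \<in> carrier V \<Longrightarrow> opY V (Yi v) = v" "v \<in> carrier V \<Longrightarrow> Yi (opY V v) = v"
  by (auto intro: op_inv_right[OF bijY] op_inv_left[OF bijY])

lemma rel_TXT: "v \<in> carrier V \<Longrightarrow> opT V (opX V (opT V v)) = Xi v"
  and rel_TYT: "v \<in> carrier V \<Longrightarrow> opT V (Yi (opT V v)) = opY V v"
  and rel_YX: "v \<in> carrier V \<Longrightarrow> (q4 ^ 2) \<odot> Yi (Xi (opY V (opX V (opT V (opT V v))))) = v"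
  using daha by (auto simp: daha_module_def)

lemma Hecke: "v \<in> carrier V \<Longrightarrow> opT V (opT V v \<oplus> inverse t2 \<odot> v) = t2 \<odot> (opT V v \<oplus> inverse t2 \<odot> v)"
  using daha by (auto simp: daha_module_def M.minus_eq_zero_iff)

text \<open>Invertibility of T is not an axiom of a module but follows from the quadratic relation,
  which provides T - (t^(1/2) - t^(-1/2)) as the inverse.\<close>

lemma bijT:
  assumes "t2 \<noteq> 0"
  shows "bij_betw (opT V) (carrier V) (carrier V)"
proof -
  define Ti where "Ti v = opT V v \<oplus> (inverse t2 - t2) \<odot> v" for v
  have H: "opT V (opT V v) \<oplus> inverse t2 \<odot> opT V v = t2 \<odot> opT V v \<oplus> v" if "v \<in> carrier V" for v
    using Hecke[OF that] that assms by (simp add: op_add op_smult smult_r_distr smult_smult)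
  have "opT V (opT V v) \<oplus> (inverse t2 - t2) \<odot> opT V v
      = (opT V (opT V v) \<oplus> inverse t2 \<odot> opT V v) \<oplus> (- t2) \<odot> opT V v" if "v \<in> carrier V" for v
    using that smult_l_distr[of "opT V v" "inverse t2" "- t2"] by (simp add: M.a_assoc)
  also have "\<dots> v = v \<oplus> (t2 + - t2) \<odot> opT V v" if "v \<in> carrier V" for v
    using that unfolding H[OF that] smult_l_distr[OF closed(3)[OF that], of t2 "- t2"]
    by (simp add: M.a_ac)
  finally have e: "opT V (opT V v) \<oplus> (inverse t2 - t2) \<odot> opT V v = v" if "v \<in> carrier V" for v
    using that by simp
  show ?thesis
    by (rule bij_betw_byWitness[where f' = Ti]) (auto simp: Ti_def op_add op_smult e)
qed

end

text \<open>Nothing but closure and compatibility with \<Phi> is known about Q in advance; each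
  axiom of Q is the preimage of the axiom of W. This is used for the quotient, whose elements are
  cosets.\<close>

lemma daha_module_transfer:
  fixes Q :: "('k::field_char_0, 'w) daha_rep" and W :: "('k, 'v) daha_rep"
  assumes W: "daha_module q4 t2 W" and bij: "bij_betw \<Phi> (carrier Q) (carrier W)"
    and add: "\<And>u v. u \<in> carrier Q \<Longrightarrow> v \<in> carrier Q \<Longrightarrow> u \<oplus>\<^bsub>Q\<^esub> v \<in> carrier Q \<and> \<Phi> (u \<oplus>\<^bsub>Q\<^esub> v) = \<Phi> u \<oplus>\<^bsub>W\<^esub> \<Phi> v"
    and zero: "\<zero>\<^bsub>Q\<^esub> \<in> carrier Q" "\<Phi> \<zero>\<^bsub>Q\<^esub> = \<zero>\<^bsub>W\<^esub>"
    and smult: "\<And>c v. v \<in> carrier Q \<Longrightarrow> c \<odot>\<^bsub>Q\<^esub> v \<in> carrier Q \<and> \<Phi> (c \<odot>\<^bsub>Q\<^esub> v) = c \<odot>\<^bsub>W\<^esub> \<Phi> v"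
    and ops: "\<And>v. v \<in> carrier Q \<Longrightarrow> opX Q v \<in> carrier Q \<and> \<Phi> (opX Q v) = opX W (\<Phi> v)"
      "\<And>v. v \<in> carrier Q \<Longrightarrow> opY Q v \<in> carrier Q \<and> \<Phi> (opY Q v) = opY W (\<Phi> v)"
      "\<And>v. v \<in> carrier Q \<Longrightarrow> opT Q v \<in> carrier Q \<and> \<Phi> (opT Q v) = opT W (\<Phi> v)"
  shows "daha_module q4 t2 Q" "daha_hom Q W \<Phi>"
proof -
  interpret W: daha_mod q4 t2 W by unfold_locales (rule W)
  define \<Psi> where "\<Psi> = inv_into (carrier Q) \<Phi>"
  have P [simp]: "\<Phi> v \<in> carrier W" if "v \<in> carrier Q" for v using bij that by (auto simp: bij_betw_def)
  have Q [simp]: "\<Psi> w \<in> carrier Q" "\<Phi> (\<Psi> w) = w" if "w \<in> carrier W" for w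
    using bij that unfolding \<Psi>_def by (auto simp: bij_betw_inv_into_right bij_betw_def inv_into_into)
  have QP: "\<Psi> (\<Phi> v) = v" if "v \<in> carrier Q" for v
    using bij that by (auto simp: \<Psi>_def bij_betw_inv_into_left)
  have eqI: "u = v" if "\<Phi> u = \<Phi> v" "u \<in> carrier Q" "v \<in> carrier Q" for u v
    using QP that by metis
  note simps = add zero smult ops W.smult_l_distr W.smult_r_distr W.smult_smult W.smult_minus_one
    W.op_add W.op_smult W.rel_TXT W.rel_TYT W.rel_YX
  show "daha_hom Q W \<Phi>"
    by (auto simp: daha_hom_def semilinear_map_def simps)
  show "daha_module q4 t2 Q"
  proof (rule daha_moduleI[where Xi = "\<lambda>v. \<Psi> (W.Xi (\<Phi> v))" and Yi = "\<lambda>v. \<Psi> (W.Yi (\<Phi> v))"])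
    show "semilinear_map id Q Q (opX Q)" "semilinear_map id Q Q (opY Q)" "semilinear_map id Q Q (opT Q)"
      by (auto simp: semilinear_map_def simps intro!: eqI)
    show "opT Q (opT Q v \<oplus>\<^bsub>Q\<^esub> inverse t2 \<odot>\<^bsub>Q\<^esub> v) = t2 \<odot>\<^bsub>Q\<^esub> (opT Q v \<oplus>\<^bsub>Q\<^esub> inverse t2 \<odot>\<^bsub>Q\<^esub> v)"
      if "v \<in> carrier Q" for v
      by (rule eqI) (use that W.Hecke[of "\<Phi> v"] in \<open>simp_all add: add smult ops\<close>)
    show "u \<oplus>\<^bsub>Q\<^esub> v = v \<oplus>\<^bsub>Q\<^esub> u" if "u \<in> carrier Q" "v \<in> carrier Q" for u v
      by (rule eqI) (use that in \<open>simp_all add: simps W.M.a_comm\<close>)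
    show "(u \<oplus>\<^bsub>Q\<^esub> v) \<oplus>\<^bsub>Q\<^esub> w = u \<oplus>\<^bsub>Q\<^esub> (v \<oplus>\<^bsub>Q\<^esub> w)" if "u \<in> carrier Q" "v \<in> carrier Q" "w \<in> carrier Q" for u v w
      by (rule eqI) (use that in \<open>simp_all add: simps W.M.a_assoc\<close>)
    show "\<zero>\<^bsub>Q\<^esub> \<oplus>\<^bsub>Q\<^esub> v = v" "(-1) \<odot>\<^bsub>Q\<^esub> v \<oplus>\<^bsub>Q\<^esub> v = \<zero>\<^bsub>Q\<^esub>" "1 \<odot>\<^bsub>Q\<^esub> v = v"
      "(b + c) \<odot>\<^bsub>Q\<^esub> v = b \<odot>\<^bsub>Q\<^esub> v \<oplus>\<^bsub>Q\<^esub> c \<odot>\<^bsub>Q\<^esub> v" "(b * c) \<odot>\<^bsub>Q\<^esub> v = b \<odot>\<^bsub>Q\<^esub> (c \<odot>\<^bsub>Q\<^esub> v)" if "v \<in> carrier Q" for b c v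
      by (rule eqI; use that in \<open>simp add: simps\<close>)+
    show "c \<odot>\<^bsub>Q\<^esub> (u \<oplus>\<^bsub>Q\<^esub> v) = c \<odot>\<^bsub>Q\<^esub> u \<oplus>\<^bsub>Q\<^esub> c \<odot>\<^bsub>Q\<^esub> v" if "u \<in> carrier Q" "v \<in> carrier Q" for c u v
      by (rule eqI) (use that in \<open>simp_all add: simps\<close>)
    show "\<Psi> (W.Xi (\<Phi> v)) \<in> carrier Q \<and> opX Q (\<Psi> (W.Xi (\<Phi> v))) = v \<and> \<Psi> (W.Xi (\<Phi> (opX Q v))) = v" 
      if "v \<in> carrier Q" for v
      by (intro conjI, simp add: that) (rule eqI; use that in \<open>simp add: simps\<close>)+
    show "\<Psi> (W.Yi (\<Phi> v)) \<in> carrier Q \<and> opY Q (\<Psi> (W.Yi (\<Phi> v))) = v \<and> \<Psi> (W.Yi (\<Phi> (opY Q v))) = v" 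
      if "v \<in> carrier Q" for v
      by (intro conjI, simp add: that) (rule eqI; use that in \<open>simp add: simps\<close>)+
    show "opT Q (opX Q (opT Q v)) = \<Psi> (W.Xi (\<Phi> v))" "opT Q (\<Psi> (W.Yi (\<Phi> (opT Q v)))) = opY Q v" 
      if "v \<in> carrier Q" for v
      by (rule eqI; use that in \<open>simp add: simps\<close>)+
    show "q4\<^sup>2 \<odot>\<^bsub>Q\<^esub> \<Psi> (W.Yi (\<Phi> (\<Psi> (W.Xi (\<Phi> (opY Q (opX Q (opT Q (opT Q v))))))))) = v" 
      if "v \<in> carrier Q" for v
      by (rule eqI; use that in \<open>simp add: simps\<close>)
  qed (use add(1) zero(1) smult(1) in simp_all)
qed

section \<open>Invariance of perfectness under isomorphism\<close>

locale daha_isom =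
  V: daha_mod q4 t2 V + W: daha_mod q4 t2 W for q4 t2 :: "'k::field_char_0"
    and V :: "('k, 'v) daha_rep" and W :: "('k, 'w) daha_rep" +
  fixes \<Phi> :: "'v \<Rightarrow> 'w"
  assumes hom: "daha_hom V W \<Phi>" and bij: "bij_betw \<Phi> (carrier V) (carrier W)"
begin

definition "\<Psi> = inv_into (carrier V) \<Phi>"

lemma \<Phi>_closed [simp]: "v \<in> carrier V \<Longrightarrow> \<Phi> v \<in> carrier W" using bij by (auto simp: bij_betw_def)
lemma \<Psi>_closed [simp]: "w \<in> carrier W \<Longrightarrow> \<Psi> w \<in> carrier V" using bij by (auto simp: \<Psi>_def bij_betw_def inv_into_into)
lemma \<Phi>_\<Psi> [simp]: "w \<in> carrier W \<Longrightarrow> \<Phi> (\<Psi> w) = w" using bij by (auto simp: \<Psi>_def bij_betw_inv_into_right)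
lemma \<Psi>_\<Phi> [simp]: "v \<in> carrier V \<Longrightarrow> \<Psi> (\<Phi> v) = v" using bij by (auto simp: \<Psi>_def bij_betw_inv_into_left)

lemma \<Phi>_hom: "u \<in> carrier V \<Longrightarrow> v \<in> carrier V \<Longrightarrow> \<Phi> (u \<oplus>\<^bsub>V\<^esub> v) = \<Phi> u \<oplus>\<^bsub>W\<^esub> \<Phi> v"
  "v \<in> carrier V \<Longrightarrow> \<Phi> (c \<odot>\<^bsub>V\<^esub> v) = c \<odot>\<^bsub>W\<^esub> \<Phi> v"
  "v \<in> carrier V \<Longrightarrow> \<Phi> (opX V v) = opX W (\<Phi> v)" "v \<in> carrier V \<Longrightarrow> \<Phi> (opY V v) = opY W (\<Phi> v)"
  "v \<in> carrier V \<Longrightarrow> \<Phi> (opT V v) = opT W (\<Phi> v)"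
  using hom by (auto simp: daha_hom_def semilinear_map_def)

lemma \<Psi>_hom: "u \<in> carrier W \<Longrightarrow> v \<in> carrier W \<Longrightarrow> \<Psi> (u \<oplus>\<^bsub>W\<^esub> v) = \<Psi> u \<oplus>\<^bsub>V\<^esub> \<Psi> v"
  "v \<in> carrier W \<Longrightarrow> \<Psi> (c \<odot>\<^bsub>W\<^esub> v) = c \<odot>\<^bsub>V\<^esub> \<Psi> v"
  "v \<in> carrier W \<Longrightarrow> \<Psi> (opX W v) = opX V (\<Psi> v)" "v \<in> carrier W \<Longrightarrow> \<Psi> (opY W v) = opY V (\<Psi> v)"
  "v \<in> carrier W \<Longrightarrow> \<Psi> (opT W v) = opT V (\<Psi> v)"
  by (metis \<Phi>_\<Psi> \<Phi>_hom \<Psi>_\<Phi> \<Psi>_closed V.M.a_closed V.smult_closed V.closed)+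

lemma \<Phi>_zero: "\<Phi> \<zero>\<^bsub>V\<^esub> = \<zero>\<^bsub>W\<^esub>"
  using \<Phi>_hom(2)[of "\<zero>\<^bsub>V\<^esub>" 0] by simp

lemma \<Psi>_zero: "\<Psi> \<zero>\<^bsub>W\<^esub> = \<zero>\<^bsub>V\<^esub>"
  using \<Phi>_zero \<Psi>_\<Phi> by (metis V.M.zero_closed)

lemma bij_\<Psi>: "bij_betw \<Psi> (carrier W) (carrier V)" unfolding \<Psi>_def by (rule bij_betw_inv_into[OF bij])

lemma \<Psi>_daha_hom: "daha_hom W V \<Psi>"
  by (auto simp: daha_hom_def semilinear_map_def \<Psi>_hom)

lemma isom_sym: "daha_iso W V"
  using bij_\<Psi> \<Psi>_daha_hom by (auto simp: daha_iso_def)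

lemma op_inv_transfer:
  assumes A: "bij_betw A (carrier V) (carrier V)" and B: "bij_betw B (carrier W) (carrier W)"
    and AB: "\<And>v. v \<in> carrier V \<Longrightarrow> \<Phi> (A v) = B (\<Phi> v)" and w: "w \<in> carrier W"
  shows "op_inv W B w = \<Phi> (op_inv V A (\<Psi> w))"
proof (rule op_inv_eqI[OF B])
  have c: "op_inv V A (\<Psi> w) \<in> carrier V" using op_inv_closed[OF A] w by simp
  then show "\<Phi> (op_inv V A (\<Psi> w)) \<in> carrier W" by simp
  show "B (\<Phi> (op_inv V A (\<Psi> w))) = w"
    using AB[OF c] op_inv_right[OF A, of "\<Psi> w"] w by simp
qed

lemma Xi_transfer: "w \<in> carrier W \<Longrightarrow> W.Xi w = \<Phi> (V.Xi (\<Psi> w))"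
  by (rule op_inv_transfer) (auto simp: V.bijX W.bijX \<Phi>_hom)

lemma Yi_transfer: "w \<in> carrier W \<Longrightarrow> W.Yi w = \<Phi> (V.Yi (\<Psi> w))"
  by (rule op_inv_transfer) (auto simp: V.bijY W.bijY \<Phi>_hom)

lemma Ti_transfer: "t2 \<noteq> 0 \<Longrightarrow> w \<in> carrier W \<Longrightarrow> op_inv W (opT W) w = \<Phi> (op_inv V (opT V) (\<Psi> w))"
  by (rule op_inv_transfer) (auto simp: V.bijT W.bijT \<Phi>_hom)

lemma finsum_transfer:
  assumes "finite S" "g \<in> S \<rightarrow> carrier V"
  shows "\<Phi> (finsum V g S) = finsum W (\<lambda>s. \<Phi> (g s)) S"
  using assms
proof (induction S)
  case empty then show ?case by (simp add: \<Phi>_zero)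
next
  case (insert s S)
  then have "g s \<in> carrier V" "g \<in> S \<rightarrow> carrier V" by auto
  then show ?case using insert by (simp add: V.M.finsum_insert W.M.finsum_insert \<Phi>_hom Pi_def)
qed

lemma finite_dim_transfer:
  assumes "finite_dim V"
  shows "finite_dim W"
proof -
  obtain S where S: "finite S" "S \<subseteq> carrier V"
    "\<And>v. v \<in> carrier V \<Longrightarrow> \<exists>c. v = finsum V (\<lambda>b. c b \<odot>\<^bsub>V\<^esub> b) S"
    using assms unfolding finite_dim_def by blast
  have "\<exists>c. w = finsum W (\<lambda>b. c b \<odot>\<^bsub>W\<^esub> b) (\<Phi> ` S)" if "w \<in> carrier W" for w
  proof -
    have pc: "\<Psi> w \<in> carrier V" using that by simp
    obtain c where c: "\<Psi> w = finsum V (\<lambda>b. c b \<odot>\<^bsub>V\<^esub> b) S" using S(3)[OF pc] by blast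
    have "w = \<Phi> (finsum V (\<lambda>b. c b \<odot>\<^bsub>V\<^esub> b) S)" using that by (simp flip: c)
    also have "\<dots> = finsum W (\<lambda>b. \<Phi> (c b \<odot>\<^bsub>V\<^esub> b)) S"
      by (rule finsum_transfer) (use S in auto)
    also have "\<dots> = finsum W (\<lambda>b. c (\<Psi> (\<Phi> b)) \<odot>\<^bsub>W\<^esub> \<Phi> b) S"
      by (rule W.M.finsum_cong') (use S(2) in \<open>auto simp: \<Phi>_hom subset_iff\<close>)
    also have "\<dots> = finsum W (\<lambda>b. c (\<Psi> b) \<odot>\<^bsub>W\<^esub> b) (\<Phi> ` S)"
      by (rule W.M.finsum_reindex[symmetric])
        (use S(2) bij in \<open>auto simp: bij_betw_def intro: inj_on_subset\<close>)
    finally show ?thesis by (rule exI[of _ "\<lambda>b. c (\<Psi> b)"])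
  qed
  then show ?thesis unfolding finite_dim_def
    using S by (intro exI[of _ "\<Phi> ` S"]) auto
qed

lemma submodule_transfer:
  assumes U: "daha_submodule W U"
  shows "daha_submodule V (\<Psi> ` U)"
proof -
  have Us: "submodule U ring_of_type_algebra W" using U by (simp add: daha_submodule_def)
  note Ue = W.M.submoduleE[OF Us]
  have Uz: "\<zero>\<^bsub>W\<^esub> \<in> U" using Ue(1,2) Ue(4)[of 0] W.smult_zero_left by fastforce
  have mem: "\<Psi> u \<in> \<Psi> ` U" if "u \<in> U" for u using that by simp
  have "submodule (\<Psi> ` U) ring_of_type_algebra V"
  proof (rule V.M.submoduleI)
    show "\<Psi> ` U \<subseteq> carrier V" using Ue(1) by auto
    show "\<zero>\<^bsub>V\<^esub> \<in> \<Psi> ` U" using mem[OF Uz] by (simp add: \<Psi>_zero)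
    show "a \<oplus>\<^bsub>V\<^esub> b \<in> \<Psi> ` U" if ab: "a \<in> \<Psi> ` U" "b \<in> \<Psi> ` U" for a b
    proof -
      obtain u v where uv: "u \<in> U" "v \<in> U" "a = \<Psi> u" "b = \<Psi> v" using ab by blast
      then have "u \<in> carrier W" "v \<in> carrier W" using Ue(1) by auto
      then show ?thesis using mem[OF Ue(5)[OF uv(1,2)]] uv(3,4) by (simp add: \<Psi>_hom)
    qed
    show sm: "c \<odot>\<^bsub>V\<^esub> a \<in> \<Psi> ` U" if a: "a \<in> \<Psi> ` U" for c a
    proof -
      obtain u where u: "u \<in> U" "a = \<Psi> u" using a by blast
      then have "u \<in> carrier W" using Ue(1) by auto
      then show ?thesis using mem[OF Ue(4)[of c u]] u by (simp add: \<Psi>_hom)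
    qed
    show "\<ominus>\<^bsub>V\<^esub> a \<in> \<Psi> ` U" if a: "a \<in> \<Psi> ` U" for a
    proof -
      have "a \<in> carrier V" using a Ue(1) by auto
      then show ?thesis using sm[OF a, of "-1"] by (simp add: V.a_inv_eq)
    qed
  qed
  moreover have "opX V a \<in> \<Psi> ` U \<and> V.Xi a \<in> \<Psi> ` U \<and> opY V a \<in> \<Psi> ` U \<and> V.Yi a \<in> \<Psi> ` U \<and> opT V a \<in> \<Psi> ` U"
    if a: "a \<in> \<Psi> ` U" for a
  proof -
    obtain u where u: "u \<in> U" "a = \<Psi> u" using a by blast
    have uc: "u \<in> carrier W" using u Ue(1) by auto
    have "opX W u \<in> U" "W.Xi u \<in> U" "opY W u \<in> U" "W.Yi u \<in> U" "opT W u \<in> U"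
      using U u(1) by (auto simp: daha_submodule_def)
    note m = this[THEN mem]
    show ?thesis using m uc unfolding u(2) by (simp add: \<Psi>_hom Xi_transfer Yi_transfer)
  qed
  ultimately show ?thesis by (simp add: daha_submodule_def)
qed

lemma irreducible_transfer:
  assumes "daha_irreducible V"
  shows "daha_irreducible W"
  unfolding daha_irreducible_def
proof (intro conjI allI impI)
  show "carrier W \<noteq> {\<zero>\<^bsub>W\<^esub>}"
  proof
    assume "carrier W = {\<zero>\<^bsub>W\<^esub>}"
    then have "carrier V = {\<zero>\<^bsub>V\<^esub>}" using bij_\<Psi> \<Psi>_zero by (auto simp: bij_betw_def)
    then show False using assms by (simp add: daha_irreducible_def)
  qed
next
  fix U assume U: "daha_submodule W U"
  have Us: "U \<subseteq> carrier W" using U W.M.submoduleE(1) by (auto simp: daha_submodule_def)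
  then have "U = \<Phi> ` \<Psi> ` U" by (force simp: image_iff)
  moreover have "\<Psi> ` U = {\<zero>\<^bsub>V\<^esub>} \<or> \<Psi> ` U = carrier V"
    using assms submodule_transfer[OF U] by (simp add: daha_irreducible_def)
  ultimately show "U = {\<zero>\<^bsub>W\<^esub>} \<or> U = carrier W"
    using bij \<Phi>_zero by (auto simp: bij_betw_def)
qed

lemma spherical_transfer:
  assumes "spherical q4 t2 V"
  shows "spherical q4 t2 W"
proof -
  obtain \<phi> where \<phi>: "daha_hom (pol_rep q4 t2) V \<phi>" "\<phi> ` carrier (pol_rep q4 t2) = carrier V"
    using assms by (auto simp: spherical_def)
  have "daha_hom (pol_rep q4 t2) W (\<Phi> \<circ> \<phi>)"
    using \<phi>(1) by (auto simp: daha_hom_def semilinear_map_def \<Phi>_hom Pi_iff)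
  moreover have "(\<Phi> \<circ> \<phi>) ` carrier (pol_rep q4 t2) = carrier W"
    using \<phi>(2) bij by (metis bij_betw_def image_comp)
  ultimately show ?thesis unfolding spherical_def by blast
qed

lemma semilinear_conj:
  assumes "semilinear_map \<sigma> V V A"
  shows "semilinear_map \<sigma> W W (\<lambda>w. \<Phi> (A (\<Psi> w)))"
proof -
  have "A v \<in> carrier V" if "v \<in> carrier V" for v using assms that by (auto simp: semilinear_map_def)
  then show ?thesis using assms by (auto simp: semilinear_map_def \<Psi>_hom \<Phi>_hom)
qed

lemma bij_conj:
  assumes "bij_betw A (carrier V) (carrier V)"
  shows "bij_betw (\<lambda>w. \<Phi> (A (\<Psi> w))) (carrier W) (carrier W)"
  using bij_betw_trans[OF bij_betw_trans[OF bij_\<Psi> assms] bij] by (simp add: o_def)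

lemma tau_epsilon_transfer:
  assumes t2: "t2 \<noteq> 0" and "tau_epsilon_invariant q4 bar V"
  shows "tau_epsilon_invariant q4 bar W"
proof -
  obtain P M E where PME: "semilinear_map id V V P" "bij_betw P (carrier V) (carrier V)" "induces_tau_plus q4 V P"
        "semilinear_map id V V M" "bij_betw M (carrier V) (carrier V)" "induces_tau_minus q4 V M"
        "semilinear_map bar V V E" "bij_betw E (carrier V) (carrier V)" "induces_epsilon V E"
     and rel: "\<And>v. v\<in>carrier V \<Longrightarrow>
           P (op_inv V M (P v)) = op_inv V M (P (op_inv V M v)) \<and>
           E (E v) = v \<and> E (P v) = M (E v)"
    using assms(2) unfolding tau_epsilon_invariant_def by blast
  have cl [simp]: "P v \<in> carrier V" "M v \<in> carrier V" "E v \<in> carrier V" "op_inv V M v \<in> carrier V"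
    if "v \<in> carrier V" for v
    using PME(1,4,7) that op_inv_closed[OF PME(5) that] by (auto simp: semilinear_map_def)
  have clT [simp]: "op_inv V (opT V) v \<in> carrier V" if "v \<in> carrier V" for v
    using op_inv_closed[OF V.bijT[OF t2] that] .
  let ?c = "\<lambda>A w. \<Phi> (A (\<Psi> w))"
  have oM: "op_inv W (?c M) w = \<Phi> (op_inv V M (\<Psi> w))" if "w \<in> carrier W" for w
    by (rule op_inv_transfer[OF PME(5) bij_conj[OF PME(5)] _ that]) simp
  have 1: "induces_tau_plus q4 W (?c P)" using PME(3) by (simp add: induces_tau_plus_def \<Psi>_hom \<Phi>_hom)
  have 2: "induces_tau_minus q4 W (?c M)" using PME(6) by (simp add: induces_tau_minus_def \<Psi>_hom \<Phi>_hom)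
  have 3: "induces_epsilon W (?c E)"
    using PME(9) t2 by (simp add: induces_epsilon_def \<Psi>_hom \<Phi>_hom Ti_transfer)
  show ?thesis
    unfolding tau_epsilon_invariant_def
    by (intro exI[of _ "?c P"] exI[of _ "?c M"] exI[of _ "?c E"] conjI semilinear_conj bij_conj PME 1 2 3)
      (use rel in \<open>simp add: oM\<close>)
qed

lemma pseudo_unitary_transfer:
  assumes t2: "t2 \<noteq> 0" and "X_pseudo_unitary_form bar V F"
  shows "X_pseudo_unitary_form bar W (\<lambda>f g. F (\<Psi> f) (\<Psi> g))"
proof -
  have F: "star_form bar V F" "nondegenerate_form V F"
    and e: "\<And>e c. e\<in>carrier V \<Longrightarrow> e \<noteq> \<zero>\<^bsub>V\<^esub> \<and> opX V e = c \<odot>\<^bsub>V\<^esub> e \<Longrightarrow> F e e \<noteq> 0"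
    using assms unfolding X_pseudo_unitary_form_def by blast+
  have clT [simp]: "op_inv V (opT V) v \<in> carrier V" if "v \<in> carrier V" for v
    using op_inv_closed[OF V.bijT[OF t2] that] .
  have z: "\<Psi> w = \<zero>\<^bsub>V\<^esub> \<Longrightarrow> w = \<zero>\<^bsub>W\<^esub>" if "w \<in> carrier W" for w
    using \<Phi>_\<Psi>[OF that] \<Phi>_zero by simp
  have s: "star_form bar W (\<lambda>f g. F (\<Psi> f) (\<Psi> g))"
    using F(1) t2 by (simp add: star_form_def \<Psi>_hom Xi_transfer Yi_transfer Ti_transfer)
  have n: "nondegenerate_form W (\<lambda>f g. F (\<Psi> f) (\<Psi> g))"
    unfolding nondegenerate_form_def
  proof (intro conjI ballI impI)
    fix f assume f: "f \<in> carrier W" "\<forall>g\<in>carrier W. F (\<Psi> f) (\<Psi> g) = 0"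
    have "F (\<Psi> f) v = 0" if "v \<in> carrier V" for v using f(2) that by (metis \<Phi>_closed \<Psi>_\<Phi>)
    then show "f = \<zero>\<^bsub>W\<^esub>" using F(2) f(1) z by (simp add: nondegenerate_form_def)
  next
    fix f assume f: "f \<in> carrier W" "\<forall>g\<in>carrier W. F (\<Psi> g) (\<Psi> f) = 0"
    have "F v (\<Psi> f) = 0" if "v \<in> carrier V" for v using f(2) that by (metis \<Phi>_closed \<Psi>_\<Phi>)
    then show "f = \<zero>\<^bsub>W\<^esub>" using F(2) f(1) z by (simp add: nondegenerate_form_def)
  qed
  show ?thesis unfolding X_pseudo_unitary_form_def
  proof (intro conjI s n ballI allI impI)
    fix w c assume w: "w \<in> carrier W" "w \<noteq> \<zero>\<^bsub>W\<^esub> \<and> opX W w = c \<odot>\<^bsub>W\<^esub> w"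
    then have "opX V (\<Psi> w) = c \<odot>\<^bsub>V\<^esub> \<Psi> w" by (metis \<Psi>_hom(2,3))
    then show "F (\<Psi> w) (\<Psi> w) \<noteq> 0" using e[of "\<Psi> w" c] z w by auto
  qed
qed

lemma perfect_transfer:
  assumes "t2 \<noteq> 0" "perfect q4 t2 bar V"
  shows "perfect q4 t2 bar W"
  using assms finite_dim_transfer irreducible_transfer spherical_transfer tau_epsilon_transfer[of bar]
    pseudo_unitary_transfer[of bar] W.daha
  unfolding perfect_def by blast

end

lemma perfect_iso:
  assumes "t2 \<noteq> 0" "perfect q4 t2 bar V" "daha_module q4 t2 W" "daha_iso V W"
  shows "perfect q4 t2 bar W"
proof -
  obtain \<Phi> where "daha_hom V W \<Phi>" "bij_betw \<Phi> (carrier V) (carrier W)" using assms(4) by (auto simp: daha_iso_def)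
  then interpret daha_isom q4 t2 V W \<Phi>
    using assms by unfold_locales (auto simp: perfect_def)
  show ?thesis using perfect_transfer assms by blast
qed

lemma daha_iso_sym:
  assumes "daha_module q4 t2 V" "daha_module q4 t2 W" "daha_iso V W"
  shows "daha_iso W V"
proof -
  obtain \<Phi> where "daha_hom V W \<Phi>" "bij_betw \<Phi> (carrier V) (carrier W)" using assms(3) by (auto simp: daha_iso_def)
  then interpret daha_isom q4 t2 V W \<Phi>
    using assms by unfold_locales auto
  show ?thesis by (rule isom_sym)
qed

section \<open>Quotients of the polynomial representation\<close>

lemma pol_rep_sel [simp]:
  "carrier (pol_rep q4 t2) = UNIV" "\<zero>\<^bsub>pol_rep q4 t2\<^esub> = 0" "f \<oplus>\<^bsub>pol_rep q4 t2\<^esub> g = f + g"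
  "c \<odot>\<^bsub>pol_rep q4 t2\<^esub> f = lC c * f" "opX (pol_rep q4 t2) f = lX 1 * f"
  "opY (pol_rep q4 t2) f = polY q4 t2 f" "opT (pol_rep q4 t2) f = polT t2 f"
  by (simp_all add: pol_rep_def)

locale spherical_hom = daha_param_nontriv q4 t2 + V: daha_mod q4 t2 V
  for q4 t2 :: "'k::field_char_0" and V :: "('k, 'v) daha_rep" +
  fixes \<phi> :: "'k laurent \<Rightarrow> 'v"
  assumes hom: "daha_hom (pol_rep q4 t2) V \<phi>" and surj: "range \<phi> = carrier V"
begin

lemma \<phi>_closed [simp]: "\<phi> f \<in> carrier V" using surj by auto
lemma \<phi>_add: "\<phi> (f + g) = \<phi> f \<oplus>\<^bsub>V\<^esub> \<phi> g" and \<phi>_smult: "\<phi> (lC c * f) = c \<odot>\<^bsub>V\<^esub> \<phi> f"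
  and \<phi>_X: "\<phi> (lX 1 * f) = opX V (\<phi> f)" and \<phi>_Y: "\<phi> (Y f) = opY V (\<phi> f)"
  and \<phi>_T: "\<phi> (T f) = opT V (\<phi> f)"
  using hom by (auto simp: daha_hom_def semilinear_map_def)
lemma \<phi>_zero: "\<phi> 0 = \<zero>\<^bsub>V\<^esub>" using \<phi>_smult[of 0 0] by simp
lemma \<phi>_Xi: "\<phi> (lX (-1) * f) = V.Xi (\<phi> f)"
  using op_inv_eqI[OF V.bijX \<phi>_closed, of "lX (-1) * f"] by (simp flip: \<phi>_X)
lemma \<phi>_Yi: "\<phi> (Yi f) = V.Yi (\<phi> f)"
  using op_inv_eqI[OF V.bijY \<phi>_closed, of "Yi f"] by (simp flip: \<phi>_Y)

lemma obtain_rep: "v \<in> carrier V \<Longrightarrow> (\<And>f. v = \<phi> f \<Longrightarrow> P) \<Longrightarrow> P"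
  using surj by blast

definition Ker :: "'k laurent set" where "Ker = {f. \<phi> f = \<zero>\<^bsub>V\<^esub>}"

lemma \<phi>_uminus: "\<phi> (- f) = \<ominus>\<^bsub>V\<^esub> \<phi> f"
  using \<phi>_smult[of "-1" f] by (simp add: V.a_inv_eq single_uminus)

lemma \<phi>_minus: "\<phi> (f - g) = \<phi> f \<ominus>\<^bsub>V\<^esub> \<phi> g"
  using \<phi>_add[of f "- g"] by (simp add: \<phi>_uminus a_minus_def)

lemma \<phi>_eq_iff: "\<phi> f = \<phi> g \<longleftrightarrow> f - g \<in> Ker"
  by (simp add: Ker_def \<phi>_minus V.M.minus_eq_zero_iff)

lemma opT_zero: "opT V \<zero>\<^bsub>V\<^esub> = \<zero>\<^bsub>V\<^esub>" and opX_zero: "opX V \<zero>\<^bsub>V\<^esub> = \<zero>\<^bsub>V\<^esub>"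
  and opY_zero: "opY V \<zero>\<^bsub>V\<^esub> = \<zero>\<^bsub>V\<^esub>" 
  using V.op_smult[of "\<zero>\<^bsub>V\<^esub>" 0] by simp_all

lemma polsub_Ker: "polsub Ker"
proof -
  have X: "V.Xi \<zero>\<^bsub>V\<^esub> = \<zero>\<^bsub>V\<^esub>" using V.XXi(2)[of "\<zero>\<^bsub>V\<^esub>"] opX_zero by simp
  have Ti: "\<phi> (Ti f) = \<zero>\<^bsub>V\<^esub>" if "\<phi> f = \<zero>\<^bsub>V\<^esub>" for f
    using that by (simp add: Ti_def \<phi>_minus \<phi>_T \<phi>_smult opT_zero V.M.minus_eq_zero_iff)
  \<comment> \<open>\<open>Pi\<close> is not a generator, so it is expressed as Y T^(-1).\<close>
  have Pi: "\<phi> (Pi f) = \<zero>\<^bsub>V\<^esub>" if "\<phi> f = \<zero>\<^bsub>V\<^esub>" for f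
    using \<phi>_Y[of "Ti f"] Ti[OF that] by (simp add: Y_eq opY_zero[unfolded Y_eq])
  show ?thesis
    by (auto simp: polsub_def Ker_def \<phi>_add \<phi>_smult \<phi>_X \<phi>_T \<phi>_zero \<phi>_Xi X opX_zero opT_zero Pi)
qed

lemma daha_submodule_image:
  assumes K: "polsub K"
  shows "daha_submodule V (\<phi> ` K)"
proof -
  have sm: "c \<odot>\<^bsub>V\<^esub> v \<in> \<phi> ` K" if "v \<in> \<phi> ` K" for c v
    using that polsubD(3)[OF K] by (auto simp flip: \<phi>_smult)
  have "submodule (\<phi> ` K) ring_of_type_algebra V"
  proof (rule V.M.submoduleI)
    show "\<zero>\<^bsub>V\<^esub> \<in> \<phi> ` K" using polsubD(1)[OF K] by (auto simp flip: \<phi>_zero)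
    show "\<ominus>\<^bsub>V\<^esub> v \<in> \<phi> ` K" if "v \<in> \<phi> ` K" for v
      using that sm[OF that, of "-1"] by (auto simp: V.a_inv_eq)
    show "u \<oplus>\<^bsub>V\<^esub> v \<in> \<phi> ` K" if "u \<in> \<phi> ` K" "v \<in> \<phi> ` K" for u v
      using that polsubD(2)[OF K] by (auto simp flip: \<phi>_add)
  qed (auto simp: sm)
  then show ?thesis
    using polsubD(4,5,6)[OF K] polsub_Y[OF K] polsub_Yi[OF K]
    by (auto simp: daha_submodule_def simp flip: \<phi>_X \<phi>_Xi \<phi>_Y \<phi>_Yi \<phi>_T)
qed

text \<open>Irreducibility of V, restated for sets of Laurent polynomials. It is needed there
  because the candidates for larger submodules, such as the radical, live in the polynomial
  representation.\<close>

lemma Ker_maximal: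
  assumes irr: "daha_irreducible V" and K: "polsub K" "Ker \<subseteq> K"
  shows "K = Ker \<or> K = UNIV"
proof -
  have "\<phi> ` K = {\<zero>\<^bsub>V\<^esub>} \<or> \<phi> ` K = carrier V"
    using irr daha_submodule_image[OF K(1)] by (simp add: daha_irreducible_def)
  moreover have "K = UNIV" if "\<phi> ` K = carrier V"
  proof -
    have "f \<in> K" for f
    proof -
      have "\<phi> f \<in> \<phi> ` K" using that by simp
      then obtain g where g: "g \<in> K" "\<phi> f = \<phi> g" by blast
      then have "f - g \<in> K" using K(2) by (auto simp: \<phi>_eq_iff)
      then show ?thesis using polsubD(2)[OF K(1) _ g(1)] by force
    qed
    then show ?thesis by blast
  qed
  ultimately show ?thesis using K(2) by (auto simp: Ker_def)
qed

text \<open>Used in both directions of the classification: for a perfect V the eigenvector comes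
  from \<epsilon>, for the model on functions it is the delta function at the starting point of the
  path.\<close>

lemma Ker_eq_Rad:
  assumes irr: "daha_irreducible V"
    and e: "e \<in> carrier V" "e \<noteq> \<zero>\<^bsub>V\<^esub>" "opX V e = inverse t2 \<odot>\<^bsub>V\<^esub> e"
  shows "Ker = Rad q4 t2"
proof -
  obtain g where g: "e = \<phi> g" using e(1) by (rule obtain_rep)
  show ?thesis
  proof (rule polsub_maximal_eq_Rad[OF polsub_Ker])
    show "K = Ker \<or> K = UNIV" if "polsub K" "Ker \<subseteq> K" for K using Ker_maximal[OF irr] that .
    show "g \<notin> Ker" using e(2) by (simp add: Ker_def g)
    show "(lX 1 - lC (inverse t2)) * g \<in> Ker"
      using e(3) unfolding g by (simp add: left_diff_distrib \<phi>_X \<phi>_smult flip: \<phi>_eq_iff)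
  qed
qed

text \<open>The cosets of the kernel as fibres of \<phi>. In this form the unions over
  representatives in the quotient operators collapse to a single fibre.\<close>

definition cls :: "'k laurent \<Rightarrow> 'k laurent set" where "cls a = {f. \<phi> f = \<phi> a}"

lemma coset_eq: "Ker +>\<^bsub>pol_rep q4 t2\<^esub> a = cls a"
proof -
  have "f \<in> cls a \<longleftrightarrow> (\<exists>u\<in>Ker. f = u + a)" for f
    by (auto simp: cls_def \<phi>_eq_iff intro!: bexI[of _ "f - a"])
  then show ?thesis by (auto simp: a_r_coset_def')
qed

lemma cls_eq: "cls a = cls b \<longleftrightarrow> \<phi> a = \<phi> b"
  by (auto simp: cls_def)

lemma lift_cls:
  assumes "\<And>f g. \<phi> f = \<phi> g \<Longrightarrow> \<phi> (A f) = \<phi> (A g)"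
  shows "(\<Union>v\<in>cls a. cls (A v)) = cls (A a)"
proof -
  have "cls (A v) = cls (A a)" if "v \<in> cls a" for v using assms[of v a] that by (simp only: cls_eq) (simp only: cls_def mem_Collect_eq)
  then have "(\<Union>v\<in>cls a. cls (A v)) = (\<Union>v\<in>cls a. cls (A a))" by (rule SUP_cong[OF refl])
  also have "\<dots> = cls (A a)" by (rule UN_constant_eq[of a]) (simp_all add: cls_def)
  finally show ?thesis .
qed

lemma set_add_cls: "cls a <+>\<^bsub>pol_rep q4 t2\<^esub> cls b = cls (a + b)"
proof -
  have "f \<in> cls (a + b) \<longleftrightarrow> (\<exists>u\<in>cls a. \<exists>v\<in>cls b. f = u + v)" for f
  proof
    assume "f \<in> cls (a + b)"
    then have "\<phi> (f - b) = \<phi> a" by (simp add: cls_def \<phi>_eq_iff algebra_simps)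
    then show "\<exists>u\<in>cls a. \<exists>v\<in>cls b. f = u + v"
      by (intro bexI[of _ "f - b"] bexI[of _ b]) (auto simp: cls_def)
  qed (auto simp: cls_def \<phi>_add)
  then show ?thesis by (auto simp: set_add_def')
qed

abbreviation "quot \<equiv> quot_rep (pol_rep q4 t2) Ker"

lemma quot_sel:
  "carrier quot = range cls" "\<zero>\<^bsub>quot\<^esub> = cls 0" "cls a \<oplus>\<^bsub>quot\<^esub> cls b = cls (a + b)"
  "c \<odot>\<^bsub>quot\<^esub> cls a = cls (lC c * a)" "opX quot (cls a) = cls (lX 1 * a)"
  "opY quot (cls a) = cls (Y a)" "opT quot (cls a) = cls (T a)"
proof -
  show "carrier quot = range cls" by (auto simp: quot_rep_def A_RCOSETS_def' coset_eq)
  show "\<zero>\<^bsub>quot\<^esub> = cls 0" by (simp add: quot_rep_def cls_def Ker_def \<phi>_zero)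
  show "cls a \<oplus>\<^bsub>quot\<^esub> cls b = cls (a + b)" by (simp add: quot_rep_def set_add_cls)
  have "(\<Union>v\<in>cls a. cls (lC c * v)) = cls (lC c * a)" by (rule lift_cls) (simp add: \<phi>_smult)
  then show "c \<odot>\<^bsub>quot\<^esub> cls a = cls (lC c * a)" by (simp add: quot_rep_def Let_def coset_eq)
  have "(\<Union>v\<in>cls a. cls (lX 1 * v)) = cls (lX 1 * a)" by (rule lift_cls) (simp add: \<phi>_X)
  then show "opX quot (cls a) = cls (lX 1 * a)" by (simp add: quot_rep_def Let_def coset_eq)
  have "(\<Union>v\<in>cls a. cls (Y v)) = cls (Y a)" by (rule lift_cls) (simp add: \<phi>_Y)
  then show "opY quot (cls a) = cls (Y a)" by (simp add: quot_rep_def Let_def coset_eq)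
  have "(\<Union>v\<in>cls a. cls (T v)) = cls (T a)" by (rule lift_cls) (simp add: \<phi>_T)
  then show "opT quot (cls a) = cls (T a)" by (simp add: quot_rep_def Let_def coset_eq)
qed

lemma quot_iso: "daha_module q4 t2 quot" "daha_iso quot V"
proof -
  define \<Phi> where "\<Phi> C = \<phi> (SOME f. f \<in> C)" for C
  have \<Phi>: "\<Phi> (cls a) = \<phi> a" for a
  proof -
    have "a \<in> cls a" by (simp add: cls_def)
    then have "(SOME f. f \<in> cls a) \<in> cls a" by (rule someI)
    then show ?thesis by (simp add: \<Phi>_def cls_def)
  qed
  have "\<Phi> ` carrier quot = carrier V"
    unfolding surj[symmetric] by (auto simp: quot_sel \<Phi> image_image)
  then have "bij_betw \<Phi> (carrier quot) (carrier V)"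
    by (auto simp: bij_betw_def inj_on_def quot_sel \<Phi> cls_eq)
  note t = daha_module_transfer[OF V.daha this]
  show "daha_module q4 t2 quot"
    by (rule t(1)) (auto simp: quot_sel \<Phi> \<phi>_add \<phi>_zero \<phi>_smult \<phi>_X \<phi>_Y \<phi>_T)
  have "daha_hom quot V \<Phi>"
    by (rule t(2)) (auto simp: quot_sel \<Phi> \<phi>_add \<phi>_zero \<phi>_smult \<phi>_X \<phi>_Y \<phi>_T)
  then show "daha_iso quot V"
    using \<open>bij_betw \<Phi> _ _\<close> by (auto simp: daha_iso_def)
qed

end

section \<open>Perfect representations only occur for the listed parameters\<close>

lemma homogeneous_system_nontrivial_solution:
  fixes c :: "'i \<Rightarrow> 'b \<Rightarrow> 'k::field"
  assumes "finite S" "finite I" "card S < card I"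
  shows "\<exists>a. (\<exists>i\<in>I. a i \<noteq> 0) \<and> (\<forall>b\<in>S. (\<Sum>i\<in>I. a i * c i b) = 0)"
  using assms
proof (induction S arbitrary: I c rule: finite_induct)
  case empty
  then have "I \<noteq> {}" by auto
  then show ?case by (intro exI[of _ "\<lambda>_. 1"]) auto
next
  case (insert b S)
  show ?case
  proof (cases "\<forall>i\<in>I. c i b = 0")
    case True
    moreover obtain a where "\<exists>i\<in>I. a i \<noteq> 0" "\<forall>b\<in>S. (\<Sum>i\<in>I. a i * c i b) = 0"
      using insert.IH[OF insert.prems(1), of c] insert.prems insert.hyps by (auto simp: card_insert_disjoint)
    ultimately show ?thesis by (intro exI[of _ a]) auto
  next
    case False
    then obtain p where p: "p \<in> I" "c p b \<noteq> 0" by blast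
    have "card S < card (I - {p})" using insert p by simp
    from insert.IH[OF _ this, of "\<lambda>i x. c i x - c i b / c p b * c p x"] insert.prems(1)
    obtain a where a: "\<exists>i\<in>I-{p}. a i \<noteq> 0"
      "\<forall>x\<in>S. (\<Sum>i\<in>I-{p}. a i * (c i x - c i b / c p b * c p x)) = 0" by auto
    \<comment> \<open>The equation at \<open>b\<close> has been used to eliminate the unknown
      \<open>p\<close>; its value is now solved from that equation.\<close>
    define a' where "a' = a(p := - (\<Sum>i\<in>I-{p}. a i * c i b) / c p b)"
    have s: "(\<Sum>i\<in>I. a' i * c i x) = (\<Sum>i\<in>I-{p}. a i * (c i x - c i b / c p b * c p x))" for x
    proof -
      have "(\<Sum>i\<in>I. a' i * c i x) = a' p * c p x + (\<Sum>i\<in>I-{p}. a' i * c i x)"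
        using p insert.prems(1) by (simp add: sum.remove)
      also have "(\<Sum>i\<in>I-{p}. a' i * c i x) = (\<Sum>i\<in>I-{p}. a i * c i x)"
        by (rule sum.cong) (auto simp: a'_def)
      also have "a' p * c p x = - (\<Sum>i\<in>I-{p}. a i * (c i b / c p b * c p x))"
        by (simp add: a'_def sum_divide_distrib sum_distrib_right mult.assoc)
      finally show ?thesis by (simp add: sum_subtractf algebra_simps)
    qed
    have "(\<Sum>i\<in>I. a' i * c i b) = 0" unfolding s using p(2) by simp
    moreover have "\<exists>i\<in>I. a' i \<noteq> 0" using a(1) by (auto simp: a'_def)
    ultimately show ?thesis using a(2) s by (intro exI[of _ a']) auto
  qed
qed

lemma prim_root_of_unity_powi:
  assumes "prim_root_of_unity m x"
  shows "x powi n = 1 \<longleftrightarrow> int m dvd n"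
proof -
  have m: "m > 0" "x ^ m = 1" "\<And>d. 0 < d \<Longrightarrow> d < m \<Longrightarrow> x ^ d \<noteq> 1"
    using assms by (auto simp: prim_root_of_unity_def)
  have x: "x \<noteq> 0" using m by (auto simp: power_0_left)
  define r where "r = nat (n mod int m)"
  have r: "int r = n mod int m" using m(1) by (simp add: r_def)
  have "x powi n = x powi (int m * (n div int m)) * x powi (n mod int m)"
    using x by (simp flip: power_int_add)
  also have "\<dots> = x ^ r" using m(2) by (simp add: power_int_mult flip: r)
  finally have e: "x powi n = x ^ r" .
  have "r < m" using r m(1) by (metis of_nat_0_less_iff of_nat_less_iff pos_mod_bound)
  then have "x ^ r = 1 \<longleftrightarrow> r = 0" using m(3)[of r] by auto
  also have "\<dots> \<longleftrightarrow> int m dvd n" using r by (auto simp: dvd_eq_mod_eq_0)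
  finally show ?thesis using e by simp
qed

text \<open>The m distinct powers of x already exhaust the at most m roots of X^m - 1.\<close>

lemma prim_root_of_unity_power_exhaust:
  assumes x: "prim_root_of_unity m x" and y: "y ^ m = 1"
  obtains j :: nat where "y = x ^ j"
proof -
  have m: "m > 0" "x ^ m = 1" using x by (auto simp: prim_root_of_unity_def)
  have x0: "x \<noteq> 0" using m by (auto simp: power_0_left)
  define p where "p = monom (1 :: 'a) m - 1"
  have rt: "poly p z = 0 \<longleftrightarrow> z ^ m = 1" for z by (simp add: p_def poly_monom)
  have p: "p \<noteq> 0" "degree p \<le> m"
  proof -
    have "coeff p m = 1" using m(1) by (simp add: p_def coeff_1)
    then show "p \<noteq> 0" by auto
    show "degree p \<le> m" unfolding p_def by (intro degree_diff_le) (auto simp: degree_monom_le)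
  qed
  have inj: "inj_on (\<lambda>j. x ^ j) {..<m}"
  proof (rule linorder_inj_onI)
    fix i j assume ij: "i < j" "i \<in> {..<m}" "j \<in> {..<m}"
    then have "x ^ (j - i) \<noteq> 1" using x by (auto simp: prim_root_of_unity_def)
    moreover have "x ^ j = x ^ i * x ^ (j - i)" using ij by (simp flip: power_add)
    ultimately show "x ^ i \<noteq> x ^ j" using x0 by auto
  qed auto
  have fin: "finite {z. poly p z = 0}" by (rule poly_roots_finite[OF p(1)])
  have "(\<lambda>j. x ^ j) ` {..<m} \<subseteq> {z. poly p z = 0}"
    using m(2) by (auto simp: rt) (metis power_commuting_commutes power_mult power_one mult.commute)
  moreover have "card {z. poly p z = 0} \<le> card ((\<lambda>j. x ^ j) ` {..<m})"
    using card_poly_roots_bound[OF p(1)] p(2) inj by (simp add: card_image)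
  ultimately have "(\<lambda>j. x ^ j) ` {..<m} = {z. poly p z = 0}" by (intro card_seteq fin)
  then show ?thesis using that y by (auto simp: rt[symmetric])
qed

section \<open>Common zeros of a submodule\<close>

context daha_param
begin

abbreviation zeros :: "'k laurent set \<Rightarrow> 'k set" where
  "zeros J \<equiv> {x. x \<noteq> 0 \<and> (\<forall>f\<in>J. laurent_eval f x = 0)}"

lemma zeros_Pi: "polsub J \<Longrightarrow> x \<in> zeros J \<Longrightarrow> q4\<^sup>2 / x \<in> zeros J"
  using q4_nz polsubD(7) by (fastforce simp flip: laurent_eval_Pi)

lemma \<alpha>_eq_0_iff: "x\<^sup>2 \<noteq> 1 \<Longrightarrow> \<alpha> x = 0 \<longleftrightarrow> (t2 * x)\<^sup>2 = 1"
  using t2_nz by (auto simp: \<alpha>_def field_simps power2_eq_square)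

lemma zeros_inverse:
  assumes J: "polsub J" and x: "x \<in> zeros J" "x\<^sup>2 \<noteq> 1" "(t2 * x)\<^sup>2 \<noteq> 1"
  shows "inverse x \<in> zeros J"
proof -
  have "laurent_eval f (inverse x) = 0" if "f \<in> J" for f
    using laurent_eval_T[of x f] polsubD(6)[OF J that] that x by (auto simp: \<alpha>_eq_0_iff)
  then show ?thesis using x by simp
qed

text \<open>Alternating the two symmetries multiplies the point by q^(1/2) in each round. Only
  inversion can be obstructed, by x^2 = 1 or by \<alpha>(x) = 0. The last move of a round is the
  unconditional reflection, so the point with exponent M is still reached although nothing is
  assumed about it.\<close>

lemma zeros_path:
  assumes J: "polsub J" and x0: "inverse t2 \<in> zeros J" and m: "m < M"
    and M: "\<And>m. 0 < m \<Longrightarrow> m < M \<Longrightarrow> (t2 * (q4\<^sup>2) ^ m)\<^sup>2 \<noteq> 1 \<and> (t2 * (t2 * (q4\<^sup>2) ^ m))\<^sup>2 \<noteq> 1"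
  shows "inverse (t2 * (q4\<^sup>2) ^ m) \<in> zeros J \<and> t2 * (q4\<^sup>2) ^ Suc m \<in> zeros J"
  using m
proof (induction m)
  case 0
  then show ?case using zeros_Pi[OF J x0] x0 by (simp add: divide_inverse mult.commute)
next
  case (Suc m)
  then have "t2 * (q4\<^sup>2) ^ Suc m \<in> zeros J" by simp
  from zeros_inverse[OF J this] have i: "inverse (t2 * (q4\<^sup>2) ^ Suc m) \<in> zeros J"
    using M[of "Suc m"] Suc.prems by blast
  show ?case using i zeros_Pi[OF J i] by (simp add: divide_inverse mult_ac)
qed

end

text \<open>The root 1 of the associated polynomial has finite multiplicity, whereas divisibility by
  every power of X - 1 would make it infinite.\<close>

lemma laurent_order_bound:
  assumes f: "f \<noteq> 0" and r: "\<And>i. \<exists>u. f = (lX 1 - 1) ^ i * (u :: 'k::field_char_0 laurent)"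
  shows False
proof -
  obtain m p where p: "\<And>x. x \<noteq> 0 \<Longrightarrow> x ^ m * laurent_eval f x = poly p x" "p = 0 \<Longrightarrow> f = 0"
    using laurent_times_X_power_is_poly by blast
  define i where "i = Suc (order 1 p)"
  obtain u where u: "f = (lX 1 - 1) ^ i * u" using r by blast
  obtain n q where q: "\<And>x. x \<noteq> 0 \<Longrightarrow> x ^ n * laurent_eval u x = poly q x"
    using laurent_times_X_power_is_poly by blast
  have pw: "laurent_eval ((lX 1 - 1) ^ j) x = (x - 1) ^ j" if "x \<noteq> 0" for x :: 'k and j
    using that by (induction j) (simp_all add: laurent_eval_simps)
  \<comment> \<open>The monomials clear the negative powers of f and u. They do not vanish at 1 and
    thus leave the multiplicity there unchanged.\<close>
  have "poly (monom 1 n * p - [:-1, 1:] ^ i * (monom 1 m * q)) x = 0" if x: "x \<noteq> 0" for x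
  proof -
    have "poly (monom 1 n * p) x = x ^ n * (x ^ m * ((x - 1) ^ i * laurent_eval u x))"
      using p(1)[OF x] by (simp add: poly_monom u laurent_eval_mult x pw)
    also have "\<dots> = (x - 1) ^ i * (x ^ m * poly q x)" by (simp add: q[OF x, symmetric] mult_ac)
    finally show ?thesis by (simp add: poly_monom poly_power)
  qed
  then have sub: "UNIV - {0} \<subseteq> {x. poly (monom 1 n * p - [:-1, 1:] ^ i * (monom 1 m * q)) x = 0}" by auto
  have "infinite (UNIV - {0 :: 'k})" using infinite_UNIV_char_0 by auto
  then have "monom 1 n * p - [:-1, 1:] ^ i * (monom 1 m * q) = 0"
    using sub poly_roots_finite finite_subset by blast
  then have "[:-1, 1:] ^ i dvd monom 1 n * p" by simp
  moreover have nz: "monom 1 n * p \<noteq> 0" using p(2) f by auto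
  ultimately have "i \<le> order 1 (monom 1 n * p)" by (simp add: order_divides)
  also have "\<dots> = order 1 p" using nz by (simp add: order_mult order_0I poly_monom)
  finally show False by (simp add: i_def)
qed

section \<open>Constraints on a perfect quotient\<close>

context spherical_hom
begin

lemma one_notin_Ker: "daha_irreducible V \<Longrightarrow> 1 \<notin> Ker"
proof
  assume irr: "daha_irreducible V" and 1: "1 \<in> Ker"
  have "\<phi> f = \<zero>\<^bsub>V\<^esub>" for f using polsub_mult[OF polsub_Ker 1, of f] by (simp add: Ker_def)
  then have "carrier V = {\<zero>\<^bsub>V\<^esub>}" using surj by auto
  then show False using irr by (simp add: daha_irreducible_def)
qed

lemma \<phi>_const: "\<phi> (lC c) = c \<odot>\<^bsub>V\<^esub> \<phi> 1"
  using \<phi>_smult[of c 1] by simp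

text \<open>One more power of X than there are spanning vectors: their images in V must be
  dependent.\<close>

lemma finite_dim_Ker_nonzero:
  assumes "finite_dim V"
  shows "\<exists>f\<in>Ker. f \<noteq> 0"
proof -
  obtain S where S: "finite S" "S \<subseteq> carrier V"
    "\<And>v. v \<in> carrier V \<Longrightarrow> \<exists>c. v = finsum V (\<lambda>b. c b \<odot>\<^bsub>V\<^esub> b) S"
    using assms unfolding finite_dim_def by blast
  have "\<forall>n :: nat. \<exists>c. \<phi> (lX (int n)) = finsum V (\<lambda>b. c b \<odot>\<^bsub>V\<^esub> b) S"
    using S(3)[OF \<phi>_closed] by blast
  from choice[OF this] obtain c where c: "\<And>n :: nat. \<phi> (lX (int n)) = finsum V (\<lambda>b. c n b \<odot>\<^bsub>V\<^esub> b) S"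
    by blast
  define I where "I = {..card S}"
  have "finite I" "card S < card I" by (auto simp: I_def)
  then obtain a where a: "\<exists>i\<in>I. a i \<noteq> 0" "\<forall>b\<in>S. (\<Sum>i\<in>I. a i * c i b) = 0"
    using homogeneous_system_nontrivial_solution[OF S(1)] by blast
  define f where "f = (\<Sum>i\<in>I. Poly_Mapping.single (int i) (a i))"
  have "\<phi> (\<Sum>i\<in>K. Poly_Mapping.single (int i) (a i)) = finsum V (\<lambda>b. (\<Sum>i\<in>K. a i * c i b) \<odot>\<^bsub>V\<^esub> b) S"
    if "finite K" for K
    using that
  proof (induction K)
    case empty
    have "finsum V (\<lambda>b. 0 \<odot>\<^bsub>V\<^esub> b) S = finsum V (\<lambda>b. \<zero>\<^bsub>V\<^esub>) S"
      by (rule V.M.finsum_cong') (use S(2) in auto)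
    then show ?case by (simp add: \<phi>_zero)
  next
    case (insert i K)
    have cl: "(\<lambda>b. d b \<odot>\<^bsub>V\<^esub> b) \<in> S \<rightarrow> carrier V" for d using S(2) by auto
    have "\<phi> (Poly_Mapping.single (int i) (a i)) = a i \<odot>\<^bsub>V\<^esub> \<phi> (lX (int i))"
      by (simp flip: \<phi>_smult add: mult_single)
    also have "\<dots> = finsum V (\<lambda>b. a i \<odot>\<^bsub>V\<^esub> (c i b \<odot>\<^bsub>V\<^esub> b)) S"
      unfolding c using S(1) cl by (simp add: V.M.finsum_smult_ldistr)
    finally have "\<phi> (\<Sum>i\<in>insert i K. Poly_Mapping.single (int i) (a i))
        = finsum V (\<lambda>b. a i \<odot>\<^bsub>V\<^esub> (c i b \<odot>\<^bsub>V\<^esub> b)) S \<oplus>\<^bsub>V\<^esub> finsum V (\<lambda>b. (\<Sum>i\<in>K. a i * c i b) \<odot>\<^bsub>V\<^esub> b) S"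
      using insert by (simp add: \<phi>_add)
    also have "\<dots> = finsum V (\<lambda>b. a i \<odot>\<^bsub>V\<^esub> (c i b \<odot>\<^bsub>V\<^esub> b) \<oplus>\<^bsub>V\<^esub> (\<Sum>i\<in>K. a i * c i b) \<odot>\<^bsub>V\<^esub> b) S"
      by (rule V.M.finsum_addf[symmetric]) (use S(2) in auto)
    also have "\<dots> = finsum V (\<lambda>b. (\<Sum>i\<in>insert i K. a i * c i b) \<odot>\<^bsub>V\<^esub> b) S"
      by (rule V.M.finsum_cong') (use S(2) insert in \<open>auto simp: V.smult_smult V.smult_l_distr subset_iff\<close>)
    finally show ?case .
  qed
  then have "\<phi> f = finsum V (\<lambda>b. (\<Sum>i\<in>I. a i * c i b) \<odot>\<^bsub>V\<^esub> b) S" by (simp add: f_def I_def)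
  also have "\<dots> = finsum V (\<lambda>b. \<zero>\<^bsub>V\<^esub>) S"
    by (rule V.M.finsum_cong') (use S(2) a(2) in auto)
  finally have "f \<in> Ker" by (simp add: Ker_def)
  moreover have "f \<noteq> 0"
  proof
    assume "f = 0"
    obtain i where i: "i \<in> I" "a i \<noteq> 0" using a(1) by blast
    have "Poly_Mapping.lookup f (int i) = (\<Sum>j\<in>I. if j = i then a j else 0)"
      unfolding f_def lookup_sum by (rule sum.cong) (auto simp: lookup_single when_def)
    also have "\<dots> = a i" using i by (simp add: I_def)
    finally show False using \<open>f = 0\<close> i by simp
  qed
  ultimately show ?thesis by blast
qed

text \<open>The inversion x -> 1/x has the fixed point 1, and there a common zero of a submodule is
  automatically double. An eigenvector of X for the eigenvalue 1 is then in the image of X - 1,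
  which is orthogonal to it.\<close>

lemma eigenvalue_one_not_pseudo_unitary:
  assumes one: "1 \<in> zeros Ker" and fd: "finite_dim V" and F: "X_pseudo_unitary_form bar V F"
    and bar: "bar (-1) = -1"
  shows False
proof -
  let ?L = "lX 1 - 1 :: 'k laurent"
  have div: "\<exists>u. f = ?L * u" if "laurent_eval f 1 = 0" for f :: "'k laurent"
    using laurent_divide_linear[of 1 f] that by simp
  have double: "\<exists>u. f = ?L\<^sup>2 * u" if f: "f \<in> Ker" for f
  proof -
    obtain g where g: "f = ?L * g" using one f div by blast
    \<comment> \<open>At x = 1 the value of T f is t^(1/2) f(1) + h D(1) with the divided difference
      D. Since f(1) = 0 and \<open>h\<close> is nonzero, D(1) = 0, and D(1) is minus the derivative
      of f at 1.\<close>
    have "laurent_eval (T f) 1 = 0" using one polsubD(6)[OF polsub_Ker f] by blast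
    then have D: "laurent_eval (divided_diff f) 1 = 0"
      using one f h_nz by (simp add: polT_def laurent_eval_simps laurent_eval_subst_inv h_def)
    have "(lX 1 + 1) * divided_diff f = - (lX (-1) * subst_inv 1 g + g)"
    proof (rule laurent_eqI[of "{1}"])
      fix x :: 'k assume x: "x \<noteq> 0" "x \<notin> {1}"
      have "(x\<^sup>2 - 1) * laurent_eval (divided_diff f) x = (inverse x - 1) * laurent_eval g (inverse x) - (x - 1) * laurent_eval g x"
        using laurent_eval_divided_diff[OF x(1), of f] x(1) by (simp add: g laurent_eval_simps)
      also have "\<dots> = (x - 1) * - (inverse x * laurent_eval g (inverse x) + laurent_eval g x)"
        using x by (simp add: field_simps)
      finally have "(x - 1) * ((x + 1) * laurent_eval (divided_diff f) x) = (x - 1) * - (inverse x * laurent_eval g (inverse x) + laurent_eval g x)"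
        by (simp add: power2_eq_square algebra_simps)
      then have "(x + 1) * laurent_eval (divided_diff f) x = - (inverse x * laurent_eval g (inverse x) + laurent_eval g x)"
        using x by simp
      then show "laurent_eval ((lX 1 + 1) * divided_diff f) x = laurent_eval (- (lX (-1) * subst_inv 1 g + g)) x"
        using x laurent_eval_minus[of 0 "lX (-1) * subst_inv 1 g + g" x]
        by (simp add: laurent_eval_simps laurent_eval_subst_inv power_int_minus inverse_eq_divide)
    qed simp
    from arg_cong[OF this, of "\<lambda>p. laurent_eval p 1"] have "laurent_eval g 1 = 0"
      using D laurent_eval_minus[of 0 "lX (-1) * subst_inv 1 g + g" 1]
      by (simp add: laurent_eval_simps laurent_eval_subst_inv)
    then show ?thesis using div[of g] g by (auto simp: power2_eq_square mult.assoc)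
  qed
  obtain f where f: "f \<in> Ker" "f \<noteq> 0" using finite_dim_Ker_nonzero[OF fd] by blast
  \<comment> \<open>Otherwise a nonzero element of the kernel could be divided by X - 1 forever
    without leaving the kernel.\<close>
  have "\<exists>g. g \<notin> Ker \<and> ?L * g \<in> Ker"
  proof (rule ccontr)
    assume n: "\<not> ?thesis"
    have "\<exists>u\<in>Ker. f = ?L ^ i * u" for i
    proof (induction i)
      case 0 then show ?case using f by simp
    next
      case (Suc i)
      then obtain u where u: "u \<in> Ker" "f = ?L ^ i * u" by blast
      obtain v where v: "u = ?L * v" using div one u(1) by blast
      then have "v \<in> Ker" using n u(1) by blast
      then show ?case using u(2) v by (auto simp: mult_ac intro!: bexI[of _ v])
    qed
    then show False using laurent_order_bound[OF f(2)] by blast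
  qed
  then obtain g where g: "g \<notin> Ker" "?L * g \<in> Ker" by blast
  obtain u where "?L * g = ?L\<^sup>2 * u" using double g(2) by blast
  moreover have "?L \<noteq> 0"
  proof
    assume "?L = 0"
    then have "laurent_eval ?L 2 = (0 :: 'k)" by simp
    then show False by (simp add: laurent_eval_simps)
  qed
  ultimately have gu: "g = ?L * u" by (simp add: power2_eq_square mult.assoc)
  have Xg: "opX V (\<phi> g) = \<phi> g"
    using g(2) by (simp add: left_diff_distrib flip: \<phi>_X \<phi>_eq_iff)
  then have Xig: "V.Xi (\<phi> g) = \<phi> g" using V.XXi(2)[of "\<phi> g"] by simp
  have star: "star_form bar V F" using F by (simp add: X_pseudo_unitary_form_def)
  have F_add: "F (a \<oplus>\<^bsub>V\<^esub> b) d = F a d + F b d" if "a \<in> carrier V" "b \<in> carrier V" "d \<in> carrier V" for a b d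
    using star that by (simp add: star_form_def)
  have F_sm: "F (c \<odot>\<^bsub>V\<^esub> a) d = c * F a d" if "a \<in> carrier V" "d \<in> carrier V" for a c d
    using star that by (simp add: star_form_def)
  have F_X: "F (opX V a) d = F a (V.Xi d)" if "a \<in> carrier V" "d \<in> carrier V" for a d
    using star that by (simp add: star_form_def)
  have "\<phi> g = opX V (\<phi> u) \<oplus>\<^bsub>V\<^esub> (-1) \<odot>\<^bsub>V\<^esub> \<phi> u"
    using \<phi>_add[of "lX 1 * u" "lC (-1) * u"] by (simp add: gu left_diff_distrib \<phi>_X \<phi>_uminus V.a_inv_eq single_uminus)
  \<comment> \<open>With e = (X - 1) u and X e = e, the value <e, e> is the difference of <X u, e> =
    <u, X^(-1) e> = <u, e> and <u, e>.\<close>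
  then have "F (\<phi> g) (\<phi> g) = F (opX V (\<phi> u)) (\<phi> g) + - F (\<phi> u) (\<phi> g)"
    using F_add[of "opX V (\<phi> u)" "(-1) \<odot>\<^bsub>V\<^esub> \<phi> u" "\<phi> g"] F_sm by simp
  also have "\<dots> = 0" by (simp add: F_X Xig)
  finally have "F (\<phi> g) (\<phi> g) = 0" .
  moreover have "F (\<phi> g) (\<phi> g) \<noteq> 0"
    using F g(1) Xg unfolding X_pseudo_unitary_form_def Ker_def by (metis V.smult_one \<phi>_closed mem_Collect_eq)
  ultimately show False by simp
qed

lemma \<phi>_one_T: "opT V (\<phi> 1) = t2 \<odot>\<^bsub>V\<^esub> \<phi> 1" and \<phi>_one_Y: "opY V (\<phi> 1) = t2 \<odot>\<^bsub>V\<^esub> \<phi> 1"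
  using T_const[of 1] Y_const[of 1] by (simp_all flip: \<phi>_T \<phi>_Y add: \<phi>_const)

lemma epsilon_eigenvector:
  assumes irr: "daha_irreducible V" and E: "semilinear_map bar V V E" "bij_betw E (carrier V) (carrier V)"
    "induces_epsilon V E" and bar: "bar t2 = inverse t2" "bar 0 = 0"
  shows "E (\<phi> 1) \<in> carrier V" "E (\<phi> 1) \<noteq> \<zero>\<^bsub>V\<^esub>" "opX V (E (\<phi> 1)) = inverse t2 \<odot>\<^bsub>V\<^esub> E (\<phi> 1)"
proof -
  show c: "E (\<phi> 1) \<in> carrier V" using E(1) by (auto simp: semilinear_map_def)
  have z: "E \<zero>\<^bsub>V\<^esub> = \<zero>\<^bsub>V\<^esub>"
  proof -
    have "E (0 \<odot>\<^bsub>V\<^esub> \<phi> 1) = bar 0 \<odot>\<^bsub>V\<^esub> E (\<phi> 1)"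
      using E(1) \<phi>_closed[of 1] unfolding semilinear_map_def by blast
    then show ?thesis using bar c by simp
  qed
  show "E (\<phi> 1) \<noteq> \<zero>\<^bsub>V\<^esub>"
  proof
    assume "E (\<phi> 1) = \<zero>\<^bsub>V\<^esub>"
    then have "\<phi> 1 = \<zero>\<^bsub>V\<^esub>" using E(2) z by (metis \<phi>_closed bij_betw_def inj_onD V.M.zero_closed)
    then show False using one_notin_Ker[OF irr] by (simp add: Ker_def)
  qed
  have "opX V (E (\<phi> 1)) = E (opY V (\<phi> 1))" using E(3) by (simp add: induces_epsilon_def)
  then show "opX V (E (\<phi> 1)) = inverse t2 \<odot>\<^bsub>V\<^esub> E (\<phi> 1)"
    using E(1) bar by (simp add: \<phi>_one_Y semilinear_map_def)
qed

text \<open>Since the automorphism fixes X, the operator is multiplication by the image \<gamma> of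
  1. Commutation with T makes \<gamma> even along the path, and the rule for Y gives \<gamma>(x) =
  q^(-1/4) x \<gamma>(q^(1/2)/x), the functional equation of the Gaussian q^(z^2). After n rounds
  the path is back at its start.\<close>

lemma tau_plus_gaussian:
  assumes irr: "daha_irreducible V"
    and P: "semilinear_map id V V P" "bij_betw P (carrier V) (carrier V)" "induces_tau_plus q4 V P"
    and x0: "inverse t2 \<in> zeros Ker"
    and path: "\<And>m. 0 < m \<Longrightarrow> (t2 * (q4\<^sup>2) ^ m)\<^sup>2 \<noteq> 1 \<and> (t2 * (t2 * (q4\<^sup>2) ^ m))\<^sup>2 \<noteq> 1"
    and n: "(q4\<^sup>2) ^ n = 1"
  shows "t2 ^ n * q4 ^ (n * n) = 1"
proof -
  let ?w = "q4\<^sup>2"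
  have Pcl [simp]: "P v \<in> carrier V" if "v \<in> carrier V" for v using P(1) that by (auto simp: semilinear_map_def)
  obtain \<gamma> where \<gamma>: "P (\<phi> 1) = \<phi> \<gamma>" using obtain_rep[OF Pcl[OF \<phi>_closed]] by blast
  have P_add: "P (u \<oplus>\<^bsub>V\<^esub> v) = P u \<oplus>\<^bsub>V\<^esub> P v" if "u \<in> carrier V" "v \<in> carrier V" for u v
    using P(1) that by (simp add: semilinear_map_def)
  have P_sm: "P (c \<odot>\<^bsub>V\<^esub> v) = c \<odot>\<^bsub>V\<^esub> P v" if "v \<in> carrier V" for c v
    using P(1) that by (simp add: semilinear_map_def)
  have PX: "P (opX V v) = opX V (P v)" "P (opT V v) = opT V (P v)"
    "P (opY V v) = inverse q4 \<odot>\<^bsub>V\<^esub> opX V (opY V (P v))" if "v \<in> carrier V" for v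
    using P(3) that by (auto simp: induces_tau_plus_def)
  have PXi: "P (V.Xi v) = V.Xi (P v)" if "v \<in> carrier V" for v
    using PX(1)[of "V.Xi v"] that V.XXi(2)[of "P (V.Xi v)"] by simp
  have P\<phi>: "P (\<phi> f) = \<phi> (f * \<gamma>)" for f
  proof (induction f rule: laurent_induct)
    case (const c)
    have "P (\<phi> (lC c)) = c \<odot>\<^bsub>V\<^esub> \<phi> \<gamma>" by (subst \<phi>_const) (simp add: P_sm \<gamma>)
    then show ?case by (simp add: \<phi>_smult)
  next
    case (mult_X f) then show ?case by (simp add: \<phi>_X PX mult.assoc)
  next
    case (mult_Xinv f) then show ?case by (simp add: \<phi>_Xi PXi mult.assoc)
  next
    case (add f g) then show ?case by (simp add: \<phi>_add P_add distrib_right)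
  qed
  \<comment> \<open>A preimage of 1 under the operator yields an inverse of \<gamma> modulo the
    kernel, and the kernel vanishes at t^(-1/2).\<close>
  have nz: "laurent_eval \<gamma> (inverse t2) \<noteq> 0"
  proof
    assume z: "laurent_eval \<gamma> (inverse t2) = 0"
    have "\<phi> 1 \<in> P ` carrier V" using P(2) by (simp add: bij_betw_def)
    then obtain v where v: "v \<in> carrier V" "\<phi> 1 = P v" by blast
    obtain \<eta> where "v = \<phi> \<eta>" using obtain_rep[OF v(1)] by blast
    then have "1 - \<eta> * \<gamma> \<in> Ker" using v(2) P\<phi> by (simp flip: \<phi>_eq_iff)
    then have "laurent_eval (1 - \<eta> * \<gamma>) (inverse t2) = 0" using x0 by blast
    then show False using z t2_nz by (simp add: laurent_eval_simps)
  qed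
  have T\<gamma>: "T \<gamma> - lC t2 * \<gamma> \<in> Ker"
    using PX(2)[of "\<phi> 1"] by (simp add: \<phi>_one_T P_sm \<gamma> \<phi>_T \<phi>_smult flip: \<phi>_eq_iff)
  have 1: "lC t2 * \<gamma> - lC (inverse q4) * (lX 1 * Y \<gamma>) \<in> Ker"
    using PX(3)[of "\<phi> 1"] by (simp add: \<phi>_one_Y P_sm \<gamma> \<phi>_X \<phi>_Y \<phi>_smult flip: \<phi>_eq_iff)
  have 2: "Y \<gamma> - lC t2 * Pi \<gamma> \<in> Ker"
    using polsubD(7)[OF polsub_Ker T\<gamma>] by (simp add: Pi_minus Pi_smult Y_eq)
  have pi: "laurent_eval \<gamma> x = inverse q4 * x * laurent_eval \<gamma> (?w / x)" if x: "x \<in> zeros Ker" for x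
  proof -
    have "t2 * laurent_eval \<gamma> x = inverse q4 * (x * laurent_eval (Y \<gamma>) x)"
      using x 1 by (auto simp: laurent_eval_simps laurent_eval_single_mult dest!: bspec[of _ _ "lC t2 * \<gamma> - lC (inverse q4) * (lX 1 * Y \<gamma>)"])
    moreover have "laurent_eval (Y \<gamma>) x = t2 * laurent_eval \<gamma> (?w / x)"
      using x 2 by (auto simp: laurent_eval_simps laurent_eval_Pi dest!: bspec[of _ _ "Y \<gamma> - lC t2 * Pi \<gamma>"])
    ultimately have "t2 * laurent_eval \<gamma> x = t2 * (inverse q4 * x * laurent_eval \<gamma> (?w / x))" by (simp add: mult_ac)
    then show ?thesis using t2_nz by simp
  qed
  have inv: "laurent_eval \<gamma> (inverse x) = laurent_eval \<gamma> x"
    if x: "x \<in> zeros Ker" "x\<^sup>2 \<noteq> 1" "(t2 * x)\<^sup>2 \<noteq> 1" for x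
  proof -
    have "laurent_eval (T \<gamma> - lC t2 * \<gamma>) x = 0" using x(1) T\<gamma> by blast
    then have "\<alpha> x * (laurent_eval \<gamma> (inverse x) - laurent_eval \<gamma> x) = 0"
      using x by (simp add: laurent_eval_simps laurent_eval_T \<alpha>_\<beta> algebra_simps)
    then show ?thesis using x by (simp add: \<alpha>_eq_0_iff)
  qed
  define g where "g m = laurent_eval \<gamma> (inverse (t2 * ?w ^ m))" for m
  \<comment> \<open>The m-th round contributes t^(1/2) and the power of q^(1/4) with exponent 2m +
    1; these odd numbers add up to a square.\<close>
  have g: "g m = g 0 * (t2 ^ m * q4 ^ (m * m))" for m
  proof (induction m)
    case (Suc m)
    let ?x = "inverse (t2 * ?w ^ m)"
    have z: "?x \<in> zeros Ker \<and> t2 * ?w ^ Suc m \<in> zeros Ker"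
      by (rule zeros_path[OF polsub_Ker x0, of m "Suc m"]) (use path in auto)
    have "g m = inverse q4 * ?x * laurent_eval \<gamma> (?w / ?x)" unfolding g_def using pi z by blast
    also have "?w / ?x = t2 * ?w ^ Suc m" by (simp add: divide_inverse mult_ac)
    also have "laurent_eval \<gamma> (t2 * ?w ^ Suc m) = g (Suc m)"
      unfolding g_def using inv[of "t2 * ?w ^ Suc m"] z path[of "Suc m"] by simp
    finally have "g (Suc m) = g m * (q4 * t2 * ?w ^ m)"
      using q4_nz t2_nz by (simp add: field_simps)
    then show ?case using Suc by (simp add: power_add power_mult[symmetric] mult_ac power2_eq_square
        power_mult_distrib)
  qed simp
  have "g n = g 0" using n by (simp add: g_def)
  moreover have "g 0 \<noteq> 0" using nz by (simp add: g_def)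
  ultimately show ?thesis using g[of n] by simp
qed

end

section \<open>Necessary conditions on the exponent of t\<close>

lemma prim_root_of_unity_sqrt:
  assumes "prim_root_of_unity (2 * N) (x\<^sup>2)"
  shows "prim_root_of_unity (4 * N) x"
proof -
  have N: "N > 0" and x: "(x\<^sup>2) ^ (2 * N) = 1" using assms by (auto simp: prim_root_of_unity_def)
  have "x ^ d \<noteq> 1" if d: "0 < d" "d < 4 * N" for d
  proof
    assume 1: "x ^ d = 1"
    have "(x\<^sup>2) powi int d = 1" using 1 by (simp add: power_mult[symmetric]) (simp add: power_mult mult.commute)
    then have "int (2 * N) dvd int d" using prim_root_of_unity_powi[OF assms, of "int d"] by blast
    then have "2 * N dvd d" by (simp only: int_dvd_int_iff)
    then have "d = 2 * N" using d by (auto elim!: dvdE)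
    then have "(x\<^sup>2) ^ N = 1" using 1 by (simp add: power_mult)
    then show False using assms N by (auto simp: prim_root_of_unity_def)
  qed
  moreover have "x ^ (4 * N) = 1" using x by (simp flip: power_mult)
  ultimately show ?thesis using N by (simp add: prim_root_of_unity_def)
qed

text \<open>Replaces the half-integer k by the integer j = 2k, the exponent of t^(1/2) as a power of
  q^(1/4).\<close>

lemma half_int_exponent_iff:
  "half_int_exponent q4 t2 k \<longleftrightarrow> (\<exists>j. 2 * k = of_int j \<and> t2 = q4 powi j)"
proof -
  have "4 * (k / 2) = 2 * k" by simp
  then show ?thesis by (auto simp: half_int_exponent_def qpow_def elim!: Ints_cases)
qed

locale daha_root = daha_param_nontriv q4 t2 for q4 t2 :: "'k::field_char_0" +
  fixes N :: nat
  assumes N: "N \<ge> 1" and prim: "prim_root_of_unity (2 * N) (q4\<^sup>2)"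
begin

lemma q4_powi_eq_1_iff: "q4 powi n = 1 \<longleftrightarrow> 4 * int N dvd n"
  using prim_root_of_unity_powi[OF prim_root_of_unity_sqrt[OF prim]] by simp

lemma root_of_unity_is_q4_powi:
  assumes "y ^ (4 * N) = 1"
  obtains j :: int where "y = q4 powi j"
  using prim_root_of_unity_power_exhaust[OF prim_root_of_unity_sqrt[OF prim] assms]
  by (metis power_int_of_nat)

lemma t2_is_q4_powi:
  assumes "(t2 * q4 powi b) ^ (4 * N) = 1"
  obtains j :: int where "t2 = q4 powi j"
proof -
  obtain j where "t2 * q4 powi b = q4 powi j" using root_of_unity_is_q4_powi[OF assms] by blast
  then have "t2 = q4 powi (j - b)" using q4_nz by (simp add: power_int_diff field_simps)
  then show ?thesis by (rule that)
qed

lemma perfect_necessary: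
  fixes V :: "('k, 'v) daha_rep"
  assumes perf: "perfect q4 t2 bar V" and bar: "bar_involution q4 t2 bar"
    and norm: "\<And>k. half_int_exponent q4 t2 k \<Longrightarrow>
           \<exists>k'. half_int_exponent q4 t2 k' \<and> - of_nat N / 2 \<le> k' \<and> k' < of_nat N / 2"
  shows "\<exists>k. half_int_exponent q4 t2 k \<and>
             (0 < k \<and> k < of_nat N / 2 \<or>
              (\<exists>n::nat. k = - 1/2 - of_nat n \<and> of_nat n < (of_nat N / 2 :: rat)))"
    and "daha_iso (quot_rep (pol_rep q4 t2) (Rad q4 t2)) V"
proof -
  have V: "daha_module q4 t2 V" and fd: "finite_dim V" and irr: "daha_irreducible V"
    using perf by (auto simp: perfect_def)
  obtain \<phi> where \<phi>: "daha_hom (pol_rep q4 t2) V \<phi>" "range \<phi> = carrier V"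
    using perf by (auto simp: perfect_def spherical_def)
  obtain P M E where PE: "semilinear_map id V V P" "bij_betw P (carrier V) (carrier V)" "induces_tau_plus q4 V P"
    "semilinear_map bar V V E" "bij_betw E (carrier V) (carrier V)" "induces_epsilon V E"
    using perf by (auto simp: perfect_def tau_epsilon_invariant_def)
  obtain F where F: "X_pseudo_unitary_form bar V F" using perf by (auto simp: perfect_def)
  interpret spherical_hom q4 t2 V \<phi> using V \<phi> by unfold_locales
  have b_add: "bar (a + b) = bar a + bar b" for a b using bar by (simp add: bar_involution_def)
  have bar0: "bar 0 = 0" using b_add[of 0 0] by simp
  have bar1: "bar (-1) = -1" using b_add[of "-1" 1] bar0 bar by (simp add: bar_involution_def eq_neg_iff_add_eq_0)
  have bart: "bar t2 = inverse t2" using bar by (simp add: bar_involution_def)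
  note \<delta> = epsilon_eigenvector[OF irr PE(4-6) bart bar0]
  have Ker: "Ker = Rad q4 t2" by (rule Ker_eq_Rad[OF irr \<delta>])
  show "daha_iso (quot_rep (pol_rep q4 t2) (Rad q4 t2)) V" using quot_iso(2) by (simp add: Ker)
  have x0: "inverse t2 \<in> zeros Ker"
  proof -
    obtain g where g: "E (\<phi> 1) = \<phi> g" using obtain_rep[OF \<delta>(1)] by blast
    have "g \<notin> Ker" using \<delta>(2) by (simp add: Ker_def g)
    moreover have "(lX 1 - lC (inverse t2)) * g \<in> Ker"
      using \<delta>(3) unfolding g by (simp add: left_diff_distrib \<phi>_X \<phi>_smult flip: \<phi>_eq_iff)
    ultimately show ?thesis using polsub_eigenvalue_zero[OF polsub_Ker] t2_nz by auto
  qed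
  have "\<exists>j. t2 = q4 powi j"
  proof (rule ccontr)
    assume no: "\<nexists>j. t2 = q4 powi j"
    \<comment> \<open>Both kinds of exceptional points would make some t^(1/2) q^(b/4) a 4N-th root
      of unity, and all of these are powers of q^(1/4).\<close>
    have nr: "(t2 * q4 powi b) ^ (4 * N) \<noteq> 1" for b using t2_is_q4_powi[of b] no by blast
    have w: "q4\<^sup>2 ^ m = q4 powi (2 * int m)" for m by (simp add: power_int_mult)
    have "(t2 * (q4\<^sup>2) ^ m)\<^sup>2 \<noteq> 1 \<and> (t2 * (t2 * (q4\<^sup>2) ^ m))\<^sup>2 \<noteq> 1" for m
    proof (intro conjI notI)
      assume "(t2 * (q4\<^sup>2) ^ m)\<^sup>2 = 1"
      then have "((t2 * q4 powi (2 * int m))\<^sup>2) ^ (2 * N) = 1" by (simp add: w)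
      then show False using nr[of "2 * int m"] by (simp flip: power_mult)
    next
      assume "(t2 * (t2 * (q4\<^sup>2) ^ m))\<^sup>2 = 1"
      moreover have "(t2 * (t2 * (q4\<^sup>2) ^ m))\<^sup>2 = (t2 * q4 ^ m) ^ 4"
        by (simp add: power_mult_distrib power_mult[symmetric] mult.commute power4_eq_xxxx power2_eq_square)
      ultimately have "((t2 * q4 ^ m) ^ 4) ^ N = 1" by simp
      then show False using nr[of "int m"] by (simp add: power_mult[symmetric])
    qed
    moreover have "(q4\<^sup>2) ^ (2 * N) = 1" using prim by (simp add: prim_root_of_unity_def)
    ultimately have "t2 ^ (2 * N) * q4 ^ (2 * N * (2 * N)) = 1"
      by (intro tau_plus_gaussian[OF irr PE(1-3) x0]) auto
    \<comment> \<open>The path has been followed for 2N rounds. As 4N divides (2N)^2, the Gaussian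
      factor disappears and t^N = 1 is left.\<close>
    moreover have "q4 powi int (2 * N * (2 * N)) = 1" by (subst q4_powi_eq_1_iff) simp
    ultimately have "t2 ^ (2 * N) = 1" by (simp only: power_int_of_nat mult_1_right)
    then have "(t2 ^ (2 * N)) ^ 2 = 1" by simp
    then show False using nr[of 0] by (simp flip: power_mult add: mult.commute)
  qed
  then obtain j where j: "t2 = q4 powi j" by blast
  then have "half_int_exponent q4 t2 (of_int j / 2)"
    unfolding half_int_exponent_iff by (intro exI[of _ j]) simp
  then obtain k where k: "half_int_exponent q4 t2 k" "- of_nat N / 2 \<le> k" "k < of_nat N / 2" using norm by blast
  obtain J where J: "2 * k = of_int J" "t2 = q4 powi J" using k(1) by (auto simp: half_int_exponent_iff)
  have JN: "- int N \<le> J"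
  proof -
    have "(of_int (- int N) :: rat) \<le> of_int J" using k(2) J(1) by simp
    then show ?thesis by (simp only: of_int_le_iff)
  qed
  have "J \<noteq> 0" using J t2_sq by auto
  consider "J > 0" | "J < 0" "odd J" | "J < 0" "even J" using \<open>J \<noteq> 0\<close> by linarith
  then show "\<exists>k. half_int_exponent q4 t2 k \<and>
             (0 < k \<and> k < of_nat N / 2 \<or>
              (\<exists>n::nat. k = - 1/2 - of_nat n \<and> of_nat n < (of_nat N / 2 :: rat)))"
  proof cases
    case 1
    then have "(0 :: rat) < 2 * k" unfolding J(1) by simp
    then show ?thesis using k by auto
  next
    case 2
    define n where "n = nat ((- J - 1) div 2)"
    have n: "J = - 1 - 2 * int n" using 2 by (auto simp: n_def elim!: oddE)
    have "2 * k = - 1 - 2 * of_nat n" using J(1) by (simp add: n)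
    then have kn: "k = - 1/2 - of_nat n" by simp
    \<comment> \<open>The bound -N <= J becomes strict for 2n because J = -1 - 2n.\<close>
    have "2 * int n < int N" using JN n by simp
    then have "(of_nat (2 * n) :: rat) < of_nat N" by (subst of_nat_less_iff) simp
    then have "(of_nat n :: rat) < of_nat N / 2" by simp
    then show ?thesis using k(1) kn by blast
  next
    case 3
    define n where "n = nat (- J div 2)"
    have n: "J = - 2 * int n" "n > 0" using 3 by (auto simp: n_def elim!: evenE)
    have w: "q4\<^sup>2 ^ m = q4 powi (2 * int m)" for m by (simp add: power_int_mult)
    have tw: "t2 * (q4\<^sup>2) ^ m = q4 powi (2 * (int m - int n))" for m
      using q4_nz by (simp add: J w n flip: power_int_add)
    have ndvd: "\<not> 4 * int N dvd 4 * a" if "0 < a" "a < int N" for a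
      using that by (auto dest!: zdvd_imp_le)
    \<comment> \<open>For 0 < m < n both squares have the exponent -4 r with 0 < r < N, by 2n <= N,
      so the path is not obstructed; its point with m = n is 1.\<close>
    have "(t2 * (q4\<^sup>2) ^ m)\<^sup>2 \<noteq> 1 \<and> (t2 * (t2 * (q4\<^sup>2) ^ m))\<^sup>2 \<noteq> 1" if m: "0 < m" "m < n" for m
    proof -
      have 1: "(t2 * (q4\<^sup>2) ^ m)\<^sup>2 = q4 powi (- (4 * (int n - int m)))"
        unfolding tw by (simp add: power_int_power' algebra_simps)
      have "t2 * (t2 * (q4\<^sup>2) ^ m) = q4 powi (- 2 * (2 * int n - int m))"
        unfolding tw using q4_nz by (simp add: J n flip: power_int_add)
      then have 2: "(t2 * (t2 * (q4\<^sup>2) ^ m))\<^sup>2 = q4 powi (- (4 * (2 * int n - int m)))"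
        by (simp add: power_int_power' algebra_simps)
      show ?thesis unfolding 1 2 q4_powi_eq_1_iff dvd_minus_iff
        using ndvd[of "int n - int m"] ndvd[of "2 * int n - int m"] m JN n by simp
    qed
    then have "t2 * (q4\<^sup>2) ^ Suc (n - 1) \<in> zeros Ker"
      using zeros_path[OF polsub_Ker x0, of "n - 1" n] n(2) by simp
    then have "1 \<in> zeros Ker" using n(2) tw[of n] by simp
    then show ?thesis using eigenvalue_one_not_pseudo_unitary[OF _ fd F bar1] by blast
  qed
qed

end

section \<open>Functions on the points of the set\<close>

locale field_involution =
  fixes q4 t2 :: "'k::field_char_0" and bar :: "'k \<Rightarrow> 'k"
  assumes bar: "bar_involution q4 t2 bar"
begin

lemma bar_add: "bar (a + b) = bar a + bar b" and bar_mult: "bar (a * b) = bar a * bar b"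
  and bar_1 [simp]: "bar 1 = 1" and bar_bar [simp]: "bar (bar a) = a"
  and bar_q4: "bar q4 = inverse q4" and bar_t2: "bar t2 = inverse t2"
  using bar by (auto simp: bar_involution_def)

lemma bar_0 [simp]: "bar 0 = 0" using bar_add[of 0 0] by simp
lemma bar_uminus: "bar (- a) = - bar a" using bar_add[of "- a" a] by (simp add: eq_neg_iff_add_eq_0)
lemma bar_minus: "bar (a - b) = bar a - bar b" using bar_add[of a "- b"] by (simp add: bar_uminus)
lemma bar_eq_iff: "bar a = bar b \<longleftrightarrow> a = b" by (metis bar_bar)
lemma bar_eq_0_iff [simp]: "bar a = 0 \<longleftrightarrow> a = 0" using bar_eq_iff[of a 0] by simp
lemma bar_inverse: "bar (inverse a) = inverse (bar a)"
proof (cases "a = 0")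
  case False
  then have "bar a * bar (inverse a) = 1" by (simp flip: bar_mult)
  then show ?thesis by (metis inverse_unique)
qed simp
lemma bar_divide: "bar (a / b) = bar a / bar b" by (simp add: divide_inverse bar_mult bar_inverse)
lemma bar_power: "bar (a ^ n) = bar a ^ n" by (induction n) (auto simp: bar_mult)
lemma bar_powi: "bar (a powi n) = bar a powi n"
  by (cases n rule: int_cases2) (auto simp: bar_power power_int_minus bar_inverse)

end

text \<open>All points are quarters of integers. With the numerator u as coordinate, q^z is the u-th
  power of q^(1/4), and questions about points become integer arithmetic.\<close>

definition pt :: "int \<Rightarrow> rat" where "pt u = of_int u / 4"

lemma uminus_pt: "- pt u = pt (- u)" and reflect_pt: "1/2 - pt u = pt (2 - u)"
  by (simp_all add: pt_def field_simps)

text \<open>Treats both cases at once, with J = 2k and a path of M rounds: M = N - 2k in case (a)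
  and M = -2k = 2n + 1 in case (b). \<open>boundary\<close> lets \<alpha> vanish at the far end,
  \<open>interior\<close> forbids this earlier, \<open>regular\<close> keeps x^2 away from 1, and
  \<open>distinct\<close> separates the values q^z. The two families of points are disjoint in case
  (a) and equal in case (b).\<close>

locale fun_ctx = daha_root q4 t2 N + field_involution q4 t2 bar
  for q4 t2 :: "'k::field_char_0" and N bar +
  fixes J M :: int and B :: "rat set"
  assumes t2: "t2 = q4 powi J" and M: "M \<ge> 1"
    and B: "B = pt ` ((\<lambda>m. J + 2 * m) ` {1..M} \<union> (\<lambda>m. - J - 2 * m) ` {0..<M})"
    and interior: "\<And>m. 1 \<le> m \<Longrightarrow> m < M \<Longrightarrow> \<not> int N dvd m \<and> \<not> int N dvd J + m"
    and boundary: "int N dvd J + M"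
    and regular: "\<And>m. 0 \<le> m \<Longrightarrow> m \<le> M \<Longrightarrow> \<not> 2 * int N dvd J + 2 * m"
    and distinct: "\<And>u v. pt u \<in> B \<Longrightarrow> pt v \<in> B \<Longrightarrow> 4 * int N dvd u - v \<Longrightarrow> u = v"
begin

lemma B_cases:
  assumes "z \<in> B"
  obtains m where "1 \<le> m" "m \<le> M" "z = pt (J + 2 * m)"
  | m where "0 \<le> m" "m < M" "z = pt (- J - 2 * m)"
  using assms unfolding B by force

lemma B_I1: "1 \<le> m \<Longrightarrow> m \<le> M \<Longrightarrow> pt (J + 2 * m) \<in> B"
  and B_I2: "0 \<le> m \<Longrightarrow> m < M \<Longrightarrow> pt (- J - 2 * m) \<in> B"
  unfolding B by force+

lemma B_int: "z \<in> B \<Longrightarrow> \<exists>u::int. z = pt u"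
  unfolding B by force

lemma finite_B [simp]: "finite B" unfolding B by simp

abbreviation e :: "rat \<Rightarrow> 'k" where "e z \<equiv> qpow q4 z"

lemma e_int: "e (pt u) = q4 powi u" by (simp add: qpow_def pt_def)

lemma e_nz [simp]: "e z \<noteq> 0" using q4_nz by (simp add: qpow_def)

lemma e_twice: "z \<in> B \<Longrightarrow> e (2 * z) = (e z)\<^sup>2"
proof -
  assume "z \<in> B"
  then obtain u where u: "z = pt u" using B_int by blast
  then have "2 * z = pt (2 * u)" by (simp add: pt_def)
  then show ?thesis unfolding u by (simp add: e_int power_int_power' mult.commute)
qed

lemma e_uminus: "z \<in> B \<Longrightarrow> e (- z) = inverse (e z)"
proof -
  assume "z \<in> B"
  then obtain u where u: "z = pt u" using B_int by blast
  then show ?thesis by (simp only: u uminus_pt e_int power_int_minus)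
qed

lemma e_reflect: "z \<in> B \<Longrightarrow> e (1/2 - z) = q4\<^sup>2 / e z"
proof -
  assume "z \<in> B"
  then obtain u where u: "z = pt u" using B_int by blast
  have "q4 powi (2 - u) = q4\<^sup>2 / q4 powi u" using q4_nz by (simp add: power_int_diff)
  then show ?thesis by (simp only: u reflect_pt e_int)
qed

lemma inj_e: "z \<in> B \<Longrightarrow> w \<in> B \<Longrightarrow> e z = e w \<Longrightarrow> z = w"
proof -
  assume zw: "z \<in> B" "w \<in> B" "e z = e w"
  then obtain u v where u: "z = pt u" "w = pt v" using B_int by blast
  then have "q4 powi u = q4 powi v" using zw(3) by (simp only: e_int)
  then have "q4 powi (u - v) = 1" using q4_nz by (simp add: power_int_diff)
  then show "z = w" using distinct zw(1,2) unfolding u q4_powi_eq_1_iff by blast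
qed

lemma e_regular: "z \<in> B \<Longrightarrow> (e z)\<^sup>2 \<noteq> 1"
proof -
  assume z: "z \<in> B"
  obtain m where m: "0 \<le> m" "m \<le> M" "z = pt (J + 2 * m) \<or> z = pt (- (J + 2 * m))"
    using z
  proof (cases rule: B_cases)
    case (1 m) then show ?thesis using that[of m] by simp
  next
    case (2 m) then show ?thesis using that[of m] by simp
  qed
  have "q4 powi (2 * (J + 2 * m)) \<noteq> 1"
    using regular[OF m(1,2)] dvd_mult_cancel_left[of 2 "2 * int N" "J + 2 * m"] by (simp only: q4_powi_eq_1_iff) simp
  then have "(q4 powi (J + 2 * m))\<^sup>2 \<noteq> 1" by (simp add: power_int_power' mult.commute)
  then have "(q4 powi (J + 2 * m))\<^sup>2 \<noteq> 1" "(q4 powi (- (J + 2 * m)))\<^sup>2 \<noteq> 1"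
    by (simp_all add: power_int_minus power_inverse del: minus_add_distrib)
  then show ?thesis using m(3) by (metis e_int)
qed

lemma reflect_B:
  assumes "z \<in> B"
  shows "1/2 - z \<in> B"
  using assms
proof (cases rule: B_cases)
  case (1 m)
  then have "1/2 - z = pt (- J - 2 * (m - 1))" by (simp add: reflect_pt algebra_simps)
  then show ?thesis using B_I2[of "m - 1"] 1 by simp
next
  case (2 m)
  then have "1/2 - z = pt (J + 2 * (m + 1))" by (simp add: reflect_pt algebra_simps)
  then show ?thesis using B_I1[of "m + 1"] 2 by simp
qed

abbreviation a :: "rat \<Rightarrow> 'k" where "a z \<equiv> \<alpha> (e z)"
abbreviation b :: "rat \<Rightarrow> 'k" where "b z \<equiv> \<beta> (e z)"

lemma a_eq_0_iff: "pt u \<in> B \<Longrightarrow> a (pt u) = 0 \<longleftrightarrow> 2 * int N dvd J + u"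
proof -
  assume z: "pt u \<in> B"
  have "a (pt u) = 0 \<longleftrightarrow> (t2 * q4 powi u)\<^sup>2 = 1"
    using \<alpha>_eq_0_iff[OF e_regular[OF z]] by (simp only: e_int)
  also have "(t2 * q4 powi u)\<^sup>2 = q4 powi (2 * (J + u))"
    using q4_nz by (simp add: t2 power_int_power' mult.commute flip: power_int_add)
  also have "\<dots> = 1 \<longleftrightarrow> 2 * int N dvd J + u"
    using dvd_mult_cancel_left[of 2 "2 * int N" "J + u"] by (simp only: q4_powi_eq_1_iff) simp
  finally show ?thesis .
qed

lemma interior_nonzero:
  assumes "1 \<le> m" "m < M"
  shows "a (pt (J + 2 * m)) \<noteq> 0" "a (pt (- J - 2 * m)) \<noteq> 0"
proof -
  have "J + (J + 2 * m) = 2 * (J + m)" "J + (- J - 2 * m) = 2 * (- m)" by simp_all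
  then show "a (pt (J + 2 * m)) \<noteq> 0" "a (pt (- J - 2 * m)) \<noteq> 0"
    using interior[OF assms] assms
    by (simp_all only: a_eq_0_iff[OF B_I1[of m]] a_eq_0_iff[OF B_I2[of m]] dvd_mult_cancel_left dvd_minus_iff) auto
qed

text \<open>\<alpha> vanishes at the two ends \<open>- J\<close> and \<open>J + 2 * M\<close> of the
  path (one point in case (b)) and nowhere else on the set. Everywhere else -z is a point of the
  set, so f(-z) is only used where it is meaningful.\<close>

lemma uminus_B:
  assumes "z \<in> B" "a z \<noteq> 0"
  shows "- z \<in> B" "a (- z) \<noteq> 0"
proof -
  have "- z \<in> B \<and> a (- z) \<noteq> 0" using assms(1)
  proof (cases rule: B_cases)
    case (1 m)
    have "m \<noteq> M"
    proof
      assume "m = M"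
      have "J + (J + 2 * M) = 2 * (J + M)" by simp
      then have "2 * int N dvd J + (J + 2 * M)" using boundary by (simp only: dvd_mult_cancel_left) simp
      then have "a z = 0" using 1 \<open>m = M\<close> a_eq_0_iff[OF B_I1[of M]] M by simp
      then show False using assms(2) by simp
    qed
    then have m: "1 \<le> m" "m < M" using 1 by auto
    have "- z = pt (- J - 2 * m)" by (simp add: 1 uminus_pt algebra_simps)
    then show ?thesis using B_I2[of m] m interior_nonzero[OF m] by simp
  next
    case (2 m)
    have "m \<noteq> 0"
    proof
      assume "m = 0"
      then have "a z = 0" using 2 a_eq_0_iff[OF B_I2[of 0]] M by simp
      then show False using assms(2) by simp
    qed
    then have m: "1 \<le> m" "m < M" using 2 by auto
    have "- z = pt (J + 2 * m)" by (simp add: 2 uminus_pt algebra_simps)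
    then show ?thesis using B_I1[of m] m interior_nonzero[OF m] by simp
  qed
  then show "- z \<in> B" "a (- z) \<noteq> 0" by auto
qed

definition z0 :: rat where "z0 = pt (- J)"

lemma z0_B: "z0 \<in> B" using B_I2[of 0] M by (simp add: z0_def)
lemma e_z0: "e z0 = inverse t2" by (simp only: z0_def e_int t2 power_int_minus)

text \<open>Starting from -k/2, the reflection z -> 1/2 - z and the permitted sign changes visit the
  whole set. This one principle yields irreducibility, uniqueness of the form and uniqueness of the
  spherical vector.\<close>

lemma path_induct:
  assumes z: "z \<in> B" and base: "P z0"
    and refl: "\<And>z. z \<in> B \<Longrightarrow> P z \<Longrightarrow> P (1/2 - z)"
    and neg: "\<And>z. z \<in> B \<Longrightarrow> a z \<noteq> 0 \<Longrightarrow> P z \<Longrightarrow> P (- z)"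
  shows "P z"
proof -
  have *: "int m < M \<Longrightarrow> P (pt (- J - 2 * int m)) \<and> P (pt (J + 2 * (int m + 1)))" for m
  proof (induction m)
    case 0
    have "1/2 - z0 = pt (J + 2 * (int 0 + 1))" by (simp add: z0_def reflect_pt add.commute)
    then show ?case using base refl[OF z0_B base] by (simp add: z0_def)
  next
    case (Suc m)
    let ?z = "pt (J + 2 * (int m + 1))"
    have "P ?z" using Suc by simp
    moreover have "?z \<in> B" using B_I1[of "int m + 1"] Suc.prems by simp
    moreover have "a ?z \<noteq> 0" using interior_nonzero(1)[of "int m + 1"] Suc.prems by simp
    ultimately have "P (- ?z)" using neg by blast
    moreover have "- ?z = pt (- J - 2 * int (Suc m))" by (simp add: uminus_pt algebra_simps)
    ultimately have 1: "P (pt (- J - 2 * int (Suc m)))" by simp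
    have "pt (- J - 2 * int (Suc m)) \<in> B" using B_I2[of "int (Suc m)"] Suc.prems by simp
    from refl[OF this 1] have "P (1/2 - pt (- J - 2 * int (Suc m)))" .
    moreover have "1/2 - pt (- J - 2 * int (Suc m)) = pt (J + 2 * (int (Suc m) + 1))"
      by (simp add: reflect_pt algebra_simps)
    ultimately show ?case using 1 by simp
  qed
  show ?thesis using z
  proof (cases rule: B_cases)
    case (1 m) then show ?thesis using *[of "nat (m - 1)"] by simp
  next
    case (2 m) then show ?thesis using *[of "nat m"] by simp
  qed
qed

section \<open>The irreducible module of functions\<close>

abbreviation "W \<equiv> fun_rep q4 t2 B"
abbreviation "WT \<equiv> funT q4 t2 B"
abbreviation WP :: "(rat \<Rightarrow> 'k) \<Rightarrow> rat \<Rightarrow> 'k" where "WP \<equiv> funPi B"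

lemma W_sel [simp]:
  "carrier W = B \<rightarrow>\<^sub>E UNIV" "\<zero>\<^bsub>W\<^esub> = (\<lambda>z\<in>B. 0)" "f \<oplus>\<^bsub>W\<^esub> g = (\<lambda>z\<in>B. f z + g z)"
  "c \<odot>\<^bsub>W\<^esub> f = (\<lambda>z\<in>B. c * f z)" "opX W f = (\<lambda>z\<in>B. e z * f z)" "opY W f = WP (WT f)" "opT W f = WT f"
  by (simp_all add: fun_rep_def)

lemma WT: "z \<in> B \<Longrightarrow> WT f z = (if a z = 0 then 0 else a z * f (- z)) - b z * f z"
  by (simp add: funT_def e_twice \<alpha>_def \<beta>_def h_def Let_def)

lemma WP: "z \<in> B \<Longrightarrow> WP f z = f (1/2 - z)" by (simp add: funPi_def)

lemma WT_cl [simp]: "WT f \<in> B \<rightarrow>\<^sub>E UNIV" and WP_cl [simp]: "WP f \<in> B \<rightarrow>\<^sub>E UNIV"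
  by (auto simp: funT_def funPi_def)

lemma W_eqI: "f \<in> B \<rightarrow>\<^sub>E UNIV \<Longrightarrow> g \<in> B \<rightarrow>\<^sub>E UNIV \<Longrightarrow> (\<And>z. z \<in> B \<Longrightarrow> f z = g z) \<Longrightarrow> f = g"
  by (rule PiE_ext)

definition \<psi> :: "'k laurent \<Rightarrow> rat \<Rightarrow> 'k" where "\<psi> f = (\<lambda>z\<in>B. laurent_eval f (e z))"

lemma \<psi>_cl [simp]: "\<psi> f \<in> B \<rightarrow>\<^sub>E UNIV" by (simp add: \<psi>_def)
lemma \<psi>: "z \<in> B \<Longrightarrow> \<psi> f z = laurent_eval f (e z)" by (simp add: \<psi>_def)

lemma \<psi>_T: "\<psi> (T f) = WT (\<psi> f)"
proof (rule W_eqI)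
  fix z assume z: "z \<in> B"
  show "\<psi> (T f) z = WT (\<psi> f) z"
    using z uminus_B(1)[OF z] by (auto simp: \<psi> WT laurent_eval_T e_regular e_uminus)
qed auto

lemma \<psi>_Pi: "\<psi> (Pi f) = WP (\<psi> f)"
  by (rule W_eqI) (simp_all add: \<psi> WP laurent_eval_Pi e_reflect reflect_B)

lemma \<psi>_add: "\<psi> (f + g) = \<psi> f \<oplus>\<^bsub>W\<^esub> \<psi> g" and \<psi>_smult: "\<psi> (lC c * f) = c \<odot>\<^bsub>W\<^esub> \<psi> f"
  and \<psi>_X: "\<psi> (lX 1 * f) = opX W (\<psi> f)" and \<psi>_Xi: "\<psi> (lX (-1) * f) = (\<lambda>z\<in>B. inverse (e z) * \<psi> f z)"
  by (rule W_eqI; simp add: \<psi> laurent_eval_simps power_int_minus)+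

lemma \<psi>_Y: "\<psi> (Y f) = WP (WT (\<psi> f))" by (simp add: Y_eq \<psi>_T \<psi>_Pi)

definition lagrange :: "rat \<Rightarrow> 'k laurent" where
  "lagrange z = (\<Prod>w\<in>B-{z}. lC (inverse (e z - e w)) * (lX 1 - lC (e w)))"

lemma lagrange: "z \<in> B \<Longrightarrow> w \<in> B \<Longrightarrow> laurent_eval (lagrange z) (e w) = (if z = w then 1 else 0)"
proof -
  assume zw: "z \<in> B" "w \<in> B"
  have "laurent_eval (lagrange z) (e w) = (\<Prod>y\<in>B-{z}. inverse (e z - e y) * (e w - e y))"
    by (simp add: lagrange_def laurent_eval_prod laurent_eval_simps)
  also have "\<dots> = (if z = w then 1 else 0)"
  proof (cases "z = w")
    case True
    have "inverse (e w - e y) * (e w - e y) = 1" if "y \<in> B - {w}" for y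
      using inj_e[of w y] zw that by (intro left_inverse) auto
    then show ?thesis using True by (simp add: prod.neutral)
  next
    case False
    then show ?thesis using zw by (auto simp: prod_zero_iff intro!: bexI[of _ w])
  qed
  finally show ?thesis .
qed

lemma range_\<psi>: "range \<psi> = B \<rightarrow>\<^sub>E UNIV"
proof -
  have "f \<in> range \<psi>" if f: "f \<in> B \<rightarrow>\<^sub>E UNIV" for f
  proof -
    have "f = \<psi> (\<Sum>z\<in>B. lC (f z) * lagrange z)"
    proof (rule W_eqI[OF f])
      fix w assume w: "w \<in> B"
      have "\<psi> (\<Sum>z\<in>B. lC (f z) * lagrange z) w = (\<Sum>z\<in>B. f z * (if z = w then 1 else 0))"
        using w by (simp add: \<psi> laurent_eval_sum laurent_eval_simps lagrange)
      also have "\<dots> = f w" using w by (simp add: if_distrib cong: if_cong)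
      finally show "f w = \<psi> (\<Sum>z\<in>B. lC (f z) * lagrange z) w" by simp
    qed simp
    then show ?thesis by blast
  qed
  moreover have "range \<psi> \<subseteq> B \<rightarrow>\<^sub>E UNIV" using \<psi>_cl by blast
  ultimately show ?thesis by blast
qed

lemma obtain_\<psi>: "f \<in> B \<rightarrow>\<^sub>E UNIV \<Longrightarrow> (\<And>p. f = \<psi> p \<Longrightarrow> P) \<Longrightarrow> P"
  using range_\<psi> by blast

text \<open>By interpolation every function is the restriction of a Laurent polynomial, and
  restriction commutes with the operators. All relations are therefore images of relations in the
  polynomial representation.\<close>

lemma daha_module_W: "daha_module q4 t2 W"
proof -
  have TT: "\<psi> (Ti p) = (\<lambda>z\<in>B. WT (\<psi> p) z - h * \<psi> p z)" for p
    by (rule W_eqI) (simp_all add: \<psi> Ti_def laurent_eval_simps flip: \<psi>_T)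
  define Xi where "Xi f = (\<lambda>z\<in>B. inverse (e z) * f z)" for f :: "rat \<Rightarrow> 'k"
  define Ti' where "Ti' f = (\<lambda>z\<in>B. WT f z - h * f z)" for f :: "rat \<Rightarrow> 'k"
  define Yi' where "Yi' f = Ti' (WP f)" for f :: "rat \<Rightarrow> 'k"
  have Xi: "Xi (\<psi> p) = \<psi> (lX (-1) * p)" for p by (simp add: Xi_def \<psi>_Xi)
  have Yi: "Yi' (\<psi> p) = \<psi> (Yi p)" for p by (simp add: Yi'_def Ti'_def Yi_def TT flip: \<psi>_Pi)
  note tr = \<psi>_X[symmetric] \<psi>_T[symmetric] \<psi>_Y[symmetric] Xi Yi
  have lin: "semilinear_map id W W (opX W)" "semilinear_map id W W (opT W)" "semilinear_map id W W (opY W)"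
  proof -
    show "semilinear_map id W W (opX W)"
      by (auto simp: semilinear_map_def algebra_simps intro!: W_eqI)
    have T: "WT (\<lambda>z\<in>B. f z + g z) = (\<lambda>z\<in>B. WT f z + WT g z)" "WT (\<lambda>z\<in>B. c * f z) = (\<lambda>z\<in>B. c * WT f z)" for f g c
      by (rule W_eqI; use uminus_B(1) in \<open>simp add: WT algebra_simps\<close>)+
    then show "semilinear_map id W W (opT W)" by (simp add: semilinear_map_def)
    have "WP (\<lambda>z\<in>B. f z + g z) = (\<lambda>z\<in>B. WP f z + WP g z)" "WP (\<lambda>z\<in>B. c * f z) = (\<lambda>z\<in>B. c * WP f z)" for f g c
      by (rule W_eqI; simp add: WP reflect_B)+
    then show "semilinear_map id W W (opY W)" by (simp add: semilinear_map_def T)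
  qed
  show ?thesis
  proof (rule daha_moduleI[OF _ _ _ _ _ _ _ _ _ _ _ lin(1,3,2), where Xi = Xi and Yi = Yi'])
    fix v assume "v \<in> carrier W"
    then obtain p where p: "v = \<psi> p" using obtain_\<psi> by auto
    show "Xi v \<in> carrier W \<and> opX W (Xi v) = v \<and> Xi (opX W v) = v"
      by (simp only: tr p X_Xi W_sel(1) \<psi>_cl simp_thms)
    show "Yi' v \<in> carrier W \<and> opY W (Yi' v) = v \<and> Yi' (opY W v) = v"
      by (simp only: \<psi>_Y[symmetric] Yi p Yi_Y Y_Yi W_sel(1,6) \<psi>_cl simp_thms)
    show "opT W (opX W (opT W v)) = Xi v"
      by (simp only: W_sel(7) tr p T_X_T)
    show "opT W (Yi' (opT W v)) = opY W v"
      by (simp only: W_sel(6,7) \<psi>_T[symmetric] \<psi>_Pi[symmetric] Yi p T_Yi Ti_T Y_eq)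
    \<comment> \<open>Cancelling T X T = X^(-1) inside Y X T^2 leaves Pi X^(-1) T, and moving
      \<open>Pi\<close> past X^(-1) produces the factor q^(-1/2).\<close>
    have "lC (q4\<^sup>2) * Yi (lX (-1) * Y (lX 1 * T (T p))) = p"
    proof -
      have "Y (lX 1 * T (T p)) = Pi (lX (-1) * T p)" by (simp add: Y_eq T_X_T)
      also have "\<dots> = lC (inverse (q4\<^sup>2)) * (lX 1 * Y p)" by (simp add: Pi_Xi Y_eq)
      finally show ?thesis using q4_nz
        by (simp add: mult.left_commute[of "lX (-1)"] Yi_smult lC_lC)
    qed
    then show "(q4 ^ 2) \<odot>\<^bsub>W\<^esub> Yi' (Xi (opY W (opX W (opT W (opT W v))))) = v"
      by (simp only: W_sel(6,7) \<psi>_X[symmetric] p \<psi>_Pi[symmetric] Xi Yi \<psi>_smult[symmetric] \<psi>_T[symmetric] Y_eq)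
    have "T (T p + lC (inverse t2) * p) = lC t2 * (T p + lC (inverse t2) * p)"
    proof -
      have "lC h * T p + lC (inverse t2) * T p = lC t2 * T p"
        by (simp add: h_def flip: distrib_right single_add)
      then show ?thesis using t2_nz
        by (simp add: T_add T_T T_smult distrib_left lC_lC add_ac)
    qed
    then show "opT W (opT W v \<oplus>\<^bsub>W\<^esub> inverse t2 \<odot>\<^bsub>W\<^esub> v) = t2 \<odot>\<^bsub>W\<^esub> (opT W v \<oplus>\<^bsub>W\<^esub> inverse t2 \<odot>\<^bsub>W\<^esub> v)"
      by (simp only: W_sel(7) tr p \<psi>_smult[symmetric] \<psi>_add[symmetric])
  qed (auto simp: algebra_simps intro!: W_eqI)
qed

sublocale W: spherical_hom q4 t2 W \<psi>
proof unfold_locales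
  show "daha_module q4 t2 W" by (rule daha_module_W)
  show "range \<psi> = carrier W" by (simp add: range_\<psi>)
  show "daha_hom (pol_rep q4 t2) W \<psi>"
    by (auto simp: daha_hom_def semilinear_map_def \<psi>_T \<psi>_Y \<psi>_X[simplified] \<psi>_add[simplified] \<psi>_smult[simplified])
qed

definition \<delta> :: "rat \<Rightarrow> rat \<Rightarrow> 'k" where "\<delta> z = (\<lambda>w\<in>B. if w = z then 1 else 0)"

lemma \<delta>_cl [simp]: "\<delta> z \<in> B \<rightarrow>\<^sub>E UNIV" by (simp add: \<delta>_def)
lemma \<delta>: "w \<in> B \<Longrightarrow> \<delta> z w = (if w = z then 1 else 0)" by (simp add: \<delta>_def)

lemma finsum_W: "finite S \<Longrightarrow> (\<And>s. s \<in> S \<Longrightarrow> g s \<in> B \<rightarrow>\<^sub>E UNIV) \<Longrightarrow> z \<in> B \<Longrightarrow> finsum W g S z = (\<Sum>s\<in>S. g s z)"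
proof (induction S rule: finite_induct)
  case (insert s S)
  then have "finsum W g (insert s S) = g s \<oplus>\<^bsub>W\<^esub> finsum W g S"
    by (intro W.V.M.finsum_insert) auto
  then show ?case using insert by simp
qed simp

lemma finsum_W_cl: "(\<And>s. s \<in> S \<Longrightarrow> g s \<in> B \<rightarrow>\<^sub>E UNIV) \<Longrightarrow> finsum W g S \<in> B \<rightarrow>\<^sub>E UNIV"
  using W.V.M.finsum_closed[of g S] by auto

lemma finite_dim_W: "finite_dim W"
  unfolding finite_dim_def
proof (intro exI[of _ "\<delta> ` B"] conjI ballI)
  fix v assume v: "v \<in> carrier W"
  have inj: "inj_on \<delta> B" by (rule inj_onI) (metis \<delta> zero_neq_one)
  \<comment> \<open>Coefficients are indexed by the basis vectors themselves; the sum over z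
    recovers v at y from the vector \<open>\<delta> y\<close>.\<close>
  have "v = finsum W (\<lambda>d. (\<Sum>z\<in>B. v z * d z) \<odot>\<^bsub>W\<^esub> d) (\<delta> ` B)"
  proof (rule W_eqI)
    fix w assume w: "w \<in> B"
    have s: "(\<Sum>z\<in>B. v z * \<delta> y z) = v y" if "y \<in> B" for y
      using that by (simp add: \<delta> if_distrib cong: if_cong)
    have "finsum W (\<lambda>d. (\<Sum>z\<in>B. v z * d z) \<odot>\<^bsub>W\<^esub> d) (\<delta> ` B) w = (\<Sum>d\<in>\<delta> ` B. (\<Sum>z\<in>B. v z * d z) * d w)"
      using w by (subst finsum_W) auto
    also have "\<dots> = (\<Sum>y\<in>B. v y * \<delta> y w)" by (simp add: sum.reindex[OF inj] s)
    also have "\<dots> = v w" using w by (simp add: \<delta> if_distrib cong: if_cong)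
    finally show "v w = finsum W (\<lambda>d. (\<Sum>z\<in>B. v z * d z) \<odot>\<^bsub>W\<^esub> d) (\<delta> ` B) w" by simp
  next
    show "v \<in> B \<rightarrow>\<^sub>E UNIV" using v by simp
    show "finsum W (\<lambda>d. (\<Sum>z\<in>B. v z * d z) \<odot>\<^bsub>W\<^esub> d) (\<delta> ` B) \<in> B \<rightarrow>\<^sub>E UNIV"
      by (rule finsum_W_cl) simp
  qed
  then show "\<exists>c. v = finsum W (\<lambda>d. c d \<odot>\<^bsub>W\<^esub> d) (\<delta> ` B)" by (rule exI[of _ "\<lambda>d. \<Sum>z\<in>B. v z * d z"])
next
  show "\<delta> ` B \<subseteq> carrier W" using \<delta>_cl unfolding W_sel(1) by blast
qed simp

text \<open>X has simple spectrum, so interpolation cuts a delta function out of any nonzero element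
  of U. The operators \<pi> and T then carry it along the path, to the start and from there to every
  point.\<close>

lemma irreducible_W: "daha_irreducible W"
  unfolding daha_irreducible_def
proof (intro conjI allI impI)
  show "carrier W \<noteq> {\<zero>\<^bsub>W\<^esub>}"
  proof
    assume "carrier W = {\<zero>\<^bsub>W\<^esub>}"
    then have "\<delta> z0 \<in> {\<zero>\<^bsub>W\<^esub>}" using \<delta>_cl by (simp del: \<delta>_cl)
    then have "\<delta> z0 z0 = 0" using z0_B by simp
    then show False using z0_B by (simp add: \<delta>)
  qed
next
  fix U assume U: "daha_submodule W U"
  have Us: "submodule U ring_of_type_algebra W" using U by (simp add: daha_submodule_def)
  note Ue = W.V.M.submoduleE[OF Us]
  have Uc: "U \<subseteq> B \<rightarrow>\<^sub>E UNIV" using Ue(1) by simp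
  have add_U: "(\<lambda>z\<in>B. f z + g z) \<in> U" if "f \<in> U" "g \<in> U" for f g using Ue(5)[OF that] by simp
  have sm: "(\<lambda>z\<in>B. c * f z) \<in> U" if "f \<in> U" for f c using Ue(4)[of c f] that by simp
  have ops: "opX W f \<in> U" "op_inv W (opX W) f \<in> U" "WT f \<in> U" "WP (WT f) \<in> U" if "f \<in> U" for f
    using U that by (auto simp: daha_submodule_def)
  have Xi: "(\<lambda>z\<in>B. inverse (e z) * f z) \<in> U" if "f \<in> U" for f
  proof -
    have "f \<in> range \<psi>" using that Uc range_\<psi> by blast
    then obtain p where "f = \<psi> p" by blast
    then show ?thesis using ops(2)[OF that] by (simp add: \<psi>_Xi flip: W.\<phi>_Xi)
  qed
  have mult: "(\<lambda>z\<in>B. laurent_eval p (e z) * f z) \<in> U" if f: "f \<in> U" for f p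
  proof (induction p rule: laurent_induct)
    case (const c)
    have "(\<lambda>z\<in>B. laurent_eval (lC c) (e z) * f z) = (\<lambda>z\<in>B. c * f z)" by (auto simp: laurent_eval_single)
    then show ?case using sm[OF f, of c] by (simp only:)
  next
    case (mult_X p)
    have "(\<lambda>z\<in>B. laurent_eval (lX 1 * p) (e z) * f z) = opX W (\<lambda>z\<in>B. laurent_eval p (e z) * f z)"
      by (auto simp: laurent_eval_simps)
    then show ?case using ops(1)[OF mult_X] by (simp only:)
  next
    case (mult_Xinv p)
    have "(\<lambda>z\<in>B. laurent_eval (lX (-1) * p) (e z) * f z) = (\<lambda>z\<in>B. inverse (e z) * (\<lambda>z\<in>B. laurent_eval p (e z) * f z) z)"
      by (auto simp: laurent_eval_simps power_int_minus)
    then show ?case using Xi[OF mult_Xinv] by (simp only:)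
  next
    case (add p q)
    have "(\<lambda>z\<in>B. laurent_eval (p + q) (e z) * f z) = (\<lambda>z\<in>B. (\<lambda>z\<in>B. laurent_eval p (e z) * f z) z + (\<lambda>z\<in>B. laurent_eval q (e z) * f z) z)"
      by (auto simp: laurent_eval_simps distrib_right)
    then show ?case using add_U[OF add] by (simp only:)
  qed
  have \<delta>U: "\<delta> z \<in> U" if "f \<in> U" "z \<in> B" "f z \<noteq> 0" for f z
  proof -
    have "(\<lambda>w\<in>B. inverse (f z) * (\<lambda>w\<in>B. laurent_eval (lagrange z) (e w) * f w) w) \<in> U"
      by (intro sm mult that)
    moreover have "(\<lambda>w\<in>B. inverse (f z) * (\<lambda>w\<in>B. laurent_eval (lagrange z) (e w) * f w) w) = \<delta> z"
      using that by (auto simp: lagrange \<delta>_def)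
    ultimately show ?thesis by simp
  qed
  \<comment> \<open>Submodules are closed under Y and T; to reach \<pi> = Y T^(-1), the inverse of T
    is written as T - h.\<close>
  have WPU: "WP f \<in> U" if "f \<in> U" for f
  proof -
    have "f \<in> range \<psi>" using that Uc range_\<psi> by blast
    then obtain p where p: "f = \<psi> p" by blast
    have "WT f \<in> U" by (rule ops(3)[OF that])
    then have "(\<lambda>z\<in>B. WT f z + (\<lambda>z\<in>B. (- h) * f z) z) \<in> U" by (intro add_U sm that)
    moreover have "(\<lambda>z\<in>B. WT f z + (\<lambda>z\<in>B. (- h) * f z) z) = \<psi> (Ti p)"
      by (rule W_eqI) (simp_all add: p \<psi> Ti_def laurent_eval_simps flip: \<psi>_T)
    ultimately have "\<psi> (Ti p) \<in> U" by simp
    from ops(4)[OF this] show ?thesis by (simp add: p flip: \<psi>_T \<psi>_Pi)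
  qed
  have refl: "\<delta> (1/2 - z) \<in> U" if "z \<in> B" "\<delta> z \<in> U" for z
    by (rule \<delta>U[OF WPU[OF that(2)]]) (use that(1) reflect_B[OF that(1)] in \<open>simp_all add: WP \<delta>\<close>)
  have neg: "\<delta> (- z) \<in> U" if "z \<in> B" "a z \<noteq> 0" "\<delta> z \<in> U" for z
  proof (rule \<delta>U[OF ops(3)[OF that(3)] uminus_B(1)[OF that(1,2)]])
    have "z \<noteq> - z"
    proof
      assume "z = - z"
      then have "e z = inverse (e z)" using e_uminus[OF that(1)] by simp
      then have "(e z)\<^sup>2 = 1" by (metis e_nz power2_eq_square right_inverse)
      then show False using e_regular[OF that(1)] by simp
    qed
    then show "WT (\<delta> z) (- z) \<noteq> 0" using uminus_B[OF that(1,2)] that(1) by (simp add: WT \<delta>)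
  qed
  show "U = {\<zero>\<^bsub>W\<^esub>} \<or> U = carrier W"
  proof (cases "\<exists>f\<in>U. \<exists>z\<in>B. f z \<noteq> 0")
    case False
    have "f = \<zero>\<^bsub>W\<^esub>" if "f \<in> U" for f
      by (rule W_eqI) (use that False Uc in auto)
    then show ?thesis using Ue(2) by blast
  next
    case True
    then obtain z where z: "z \<in> B" "\<delta> z \<in> U" using \<delta>U by blast
    \<comment> \<open>The path is followed backwards: both moves are involutions, so it is the
      implication that propagates from \<open>z0\<close>.\<close>
    have 0: "\<delta> z \<in> U \<longrightarrow> \<delta> z0 \<in> U"
    proof (rule path_induct[OF z(1)])
      show "\<delta> (1/2 - z) \<in> U \<longrightarrow> \<delta> z0 \<in> U" if "z \<in> B" "\<delta> z \<in> U \<longrightarrow> \<delta> z0 \<in> U" for z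
        using refl[OF reflect_B[OF that(1)]] that(2) by simp
      show "\<delta> (- z) \<in> U \<longrightarrow> \<delta> z0 \<in> U" if "z \<in> B" "a z \<noteq> 0" "\<delta> z \<in> U \<longrightarrow> \<delta> z0 \<in> U" for z
        using neg[OF uminus_B[OF that(1,2)]] that(3) by simp
    qed simp
    have all: "\<delta> w \<in> U" if "w \<in> B" for w
      by (rule path_induct[OF that]) (use 0 z refl neg in blast)+
    have "f \<in> U" if f: "f \<in> B \<rightarrow>\<^sub>E UNIV" for f
    proof -
      have z: "(\<lambda>w\<in>B. 0) \<in> U" using sm[OF z(2), of 0] by simp
      have "(\<lambda>w\<in>B. \<Sum>z\<in>S. f z * \<delta> z w) \<in> U" if "S \<subseteq> B" for S
        using finite_subset[OF that finite_B] that
      proof (induction S rule: finite_induct)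
        case empty then show ?case using z by (simp only: sum.empty)
      next
        case (insert s S)
        have "(\<lambda>w\<in>B. (\<lambda>w\<in>B. f s * \<delta> s w) w + (\<lambda>w\<in>B. \<Sum>z\<in>S. f z * \<delta> z w) w) \<in> U"
          by (intro add_U sm all) (use insert in auto)
        moreover have "(\<lambda>w\<in>B. (\<lambda>w\<in>B. f s * \<delta> s w) w + (\<lambda>w\<in>B. \<Sum>z\<in>S. f z * \<delta> z w) w) = (\<lambda>w\<in>B. \<Sum>z\<in>insert s S. f z * \<delta> z w)"
          using insert by auto
        ultimately show ?case by (simp only:)
      qed
      from this[of B] have "(\<lambda>w\<in>B. \<Sum>z\<in>B. f z * \<delta> z w) \<in> U" by simp
      moreover have "(\<lambda>w\<in>B. \<Sum>z\<in>B. f z * \<delta> z w) = f"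
        by (rule W_eqI[OF _ f]) (simp_all add: \<delta> if_distrib cong: if_cong)
      ultimately show ?thesis by simp
    qed
    then show ?thesis using Uc by auto
  qed
qed

end

section \<open>The invariant form\<close>

context fun_ctx
begin

definition WTi :: "(rat \<Rightarrow> 'k) \<Rightarrow> rat \<Rightarrow> 'k" where "WTi f = (\<lambda>z\<in>B. WT f z - h * f z)"

lemma WTi_cl [simp]: "WTi f \<in> B \<rightarrow>\<^sub>E UNIV" by (simp add: WTi_def)

lemma \<psi>_Ti: "\<psi> (Ti p) = WTi (\<psi> p)"
  by (rule W_eqI) (simp_all add: \<psi> WTi_def Ti_def laurent_eval_simps flip: \<psi>_T)

lemma WT_WTi: assumes "f \<in> B \<rightarrow>\<^sub>E UNIV" shows "WT (WTi f) = f" "WTi (WT f) = f"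
  using assms by (rule obtain_\<psi>, simp flip: \<psi>_Ti \<psi>_T)+

lemma op_inv_W:
  assumes "f \<in> B \<rightarrow>\<^sub>E UNIV"
  shows "op_inv W (opX W) f = (\<lambda>z\<in>B. inverse (e z) * f z)" "op_inv W (opY W) f = WTi (WP f)"
    "op_inv W WT f = WTi f"
proof -
  obtain p where p: "f = \<psi> p" using assms by (rule obtain_\<psi>)
  show "op_inv W (opX W) f = (\<lambda>z\<in>B. inverse (e z) * f z)" by (simp only: p W.\<phi>_Xi[symmetric] \<psi>_Xi)
  show "op_inv W (opY W) f = WTi (WP f)"
    by (simp only: p W.\<phi>_Yi[symmetric] Yi_def \<psi>_Ti \<psi>_Pi)
  have "opT W = WT" by (rule ext) simp
  then have "bij_betw WT (carrier W) (carrier W)" using W.V.bijT[OF t2_nz] by simp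
  from op_inv_eqI[OF this, of "WTi f" f] show "op_inv W WT f = WTi f" using WT_WTi(1)[OF assms] by simp
qed

lemma WTi: "z \<in> B \<Longrightarrow> WTi f z = (if a z = 0 then 0 else a z * f (- z)) - (b z + h) * f z"
  by (simp add: WTi_def WT algebra_simps)

lemma bar_e: "bar (e z) = inverse (e z)"
  by (simp add: qpow_def bar_powi bar_q4 power_int_inverse)

lemma bar_h: "bar h = - h" by (simp add: h_def bar_minus bar_inverse bar_t2)

text \<open>\<alpha> is unchanged if x and t^(1/2) are both inverted, while \<beta> turns into
  \<beta> + h. This is the pointwise reason why the star of T is its inverse.\<close>

lemma bar_ab: assumes "z \<in> B" shows bar_a: "bar (a z) = a z" and bar_b: "bar (b z) = b z + h"
proof -
  have x: "(e z)\<^sup>2 \<noteq> 1" using e_regular assms by blast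
  then have y: "inverse ((e z)\<^sup>2) - 1 \<noteq> 0" by auto
  have "bar (b z) = - h / (inverse ((e z)\<^sup>2) - 1)"
    by (simp add: \<beta>_def bar_divide bar_h bar_minus bar_power bar_e power_inverse)
  also have "\<dots> = b z + h" using x y by (simp add: \<beta>_def divide_simps) (simp add: algebra_simps)
  finally show b: "bar (b z) = b z + h" .
  show "bar (a z) = a z" using b by (simp add: \<alpha>_\<beta>[OF x] bar_add bar_t2 h_def)
qed

lemma sum_interior_reindex: "(\<Sum>z\<in>{z\<in>B. a z \<noteq> 0}. g (- z)) = (\<Sum>z\<in>{z\<in>B. a z \<noteq> 0}. g z)"
  by (rule sum.reindex_bij_witness[of _ uminus uminus]) (use uminus_B in auto)

lemma sum_reflect: "(\<Sum>z\<in>B. g (1/2 - z)) = (\<Sum>z\<in>B. g z)"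
  by (rule sum.reindex_bij_witness[of _ "\<lambda>z. 1/2 - z" "\<lambda>z. 1/2 - z"]) (use reflect_B in auto)

text \<open>The two symmetry conditions on \<mu> are adjointness of \<pi> and of T. Since the values
  q^z are distinct, an eigenvector of X is supported at a single point, and <e, e> is a nonzero
  multiple of the weight there.\<close>

lemma pseudo_unitary:
  assumes nz: "\<And>z. z \<in> B \<Longrightarrow> \<mu> z \<noteq> 0" and rf: "\<And>z. z \<in> B \<Longrightarrow> \<mu> (1/2 - z) = \<mu> z"
    and neg: "\<And>z. z \<in> B \<Longrightarrow> a z \<noteq> 0 \<Longrightarrow> a z * \<mu> z = a (- z) * \<mu> (- z)"
  shows "X_pseudo_unitary_form bar W (fun_form bar B \<mu>)"
proof -
  let ?F = "fun_form bar B \<mu>" and ?I = "{z\<in>B. a z \<noteq> 0}"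
  \<comment> \<open>The sign change is an involution only on the points with nonzero \<alpha>, so
    the sums are restricted to them before reindexing.\<close>
  have I: "(\<Sum>z\<in>B. (if a z = 0 then 0 else g z)) = (\<Sum>z\<in>?I. g z)" for g :: "rat \<Rightarrow> 'k"
    by (rule sum.mono_neutral_cong_right) auto
  have FT: "?F (WT f) g = ?F f (WTi g)" for f g
  proof -
    have "?F (WT f) g = (\<Sum>z\<in>B. (if a z = 0 then 0 else a z * f (- z) * bar (g z) * \<mu> z) - b z * f z * bar (g z) * \<mu> z)"
      unfolding fun_form_def by (rule sum.cong) (auto simp: WT algebra_simps)
    also have "\<dots> = (\<Sum>z\<in>?I. a z * f (- z) * bar (g z) * \<mu> z) - (\<Sum>z\<in>B. b z * f z * bar (g z) * \<mu> z)"
      by (simp only: sum_subtractf I)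
    also have "(\<Sum>z\<in>?I. a z * f (- z) * bar (g z) * \<mu> z) = (\<Sum>z\<in>?I. a (- z) * f z * bar (g (- z)) * \<mu> (- z))"
      by (subst sum_interior_reindex[symmetric]) simp
    also have "\<dots> = (\<Sum>z\<in>?I. f z * bar (a z * g (- z)) * \<mu> z)"
      by (rule sum.cong) (use neg in \<open>simp_all add: bar_mult bar_a mult_ac\<close>)
    also have "\<dots> - (\<Sum>z\<in>B. b z * f z * bar (g z) * \<mu> z)
        = (\<Sum>z\<in>B. (if a z = 0 then 0 else f z * bar (a z * g (- z)) * \<mu> z) - b z * f z * bar (g z) * \<mu> z)"
      by (simp only: sum_subtractf I)
    also have "\<dots> = ?F f (WTi g)"
      unfolding fun_form_def
      by (rule sum.cong) (auto simp: WTi bar_minus bar_mult bar_add bar_b bar_h algebra_simps)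
    finally show ?thesis .
  qed
  have FP: "?F (WP f) g = ?F f (WP g)" for f g
  proof -
    have "?F (WP f) g = (\<Sum>z\<in>B. f (1/2 - z) * bar (g z) * \<mu> z)"
      by (simp add: fun_form_def WP)
    also have "\<dots> = (\<Sum>z\<in>B. f z * bar (g (1/2 - z)) * \<mu> (1/2 - z))"
      by (subst sum_reflect[symmetric]) simp
    also have "\<dots> = ?F f (WP g)" by (simp add: fun_form_def WP rf)
    finally show ?thesis .
  qed
  have star: "star_form bar W ?F"
    unfolding star_form_def
  proof (intro conjI ballI allI)
    fix f g h' :: "rat \<Rightarrow> 'k" and c
    show "?F (f \<oplus>\<^bsub>W\<^esub> g) h' = ?F f h' + ?F g h'" "?F h' (f \<oplus>\<^bsub>W\<^esub> g) = ?F h' f + ?F h' g"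
      by (simp_all add: fun_form_def bar_add algebra_simps sum.distrib)
    show "?F (c \<odot>\<^bsub>W\<^esub> f) g = c * ?F f g" "?F f (c \<odot>\<^bsub>W\<^esub> g) = bar c * ?F f g"
      by (simp_all add: fun_form_def bar_mult sum_distrib_left mult_ac)
  next
    fix A and f g :: "rat \<Rightarrow> 'k"
    assume A: "A \<in> {opX W, opY W, opT W}" and fg: "f \<in> carrier W" "g \<in> carrier W"
    then have g: "g \<in> B \<rightarrow>\<^sub>E UNIV" by simp
    have T: "opT W = WT" by (rule ext) simp
    consider "A = opX W" | "A = opY W" | "A = WT" using A unfolding T by blast
    then show "?F (A f) g = ?F f (op_inv W A g)"
    proof cases
      case 1
      then show ?thesis
        unfolding 1 op_inv_W(1)[OF g]
        by (auto simp: fun_form_def bar_mult bar_inverse bar_e mult_ac intro!: sum.cong)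
    next
      case 2
      then show ?thesis unfolding 2 op_inv_W(2)[OF g] by (simp add: FT FP)
    next
      case 3
      then show ?thesis unfolding 3 op_inv_W(3)[OF g] by (simp add: FT)
    qed
  qed
  have Fd: "?F f (\<delta> z) = f z * \<mu> z" "?F (\<delta> z) f = bar (f z) * \<mu> z" if "z \<in> B" for f z
  proof -
    have "?F f (\<delta> z) = (\<Sum>w\<in>B. if w = z then f z * \<mu> z else 0)"
      unfolding fun_form_def by (rule sum.cong) (auto simp: \<delta>)
    then show "?F f (\<delta> z) = f z * \<mu> z" using that by simp
    have "?F (\<delta> z) f = (\<Sum>w\<in>B. if w = z then bar (f z) * \<mu> z else 0)"
      unfolding fun_form_def by (rule sum.cong) (auto simp: \<delta>)
    then show "?F (\<delta> z) f = bar (f z) * \<mu> z" using that by simp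
  qed
  have nondeg: "nondegenerate_form W ?F"
    unfolding nondegenerate_form_def
  proof (intro conjI ballI impI)
    fix f assume f: "f \<in> carrier W" "\<forall>g\<in>carrier W. ?F f g = 0"
    have "f z = 0" if "z \<in> B" for z using f(2) Fd(1)[OF that, of f] nz[OF that] \<delta>_cl[of z] by simp
    then show "f = \<zero>\<^bsub>W\<^esub>" using f(1) by (intro W_eqI) auto
  next
    fix f assume f: "f \<in> carrier W" "\<forall>g\<in>carrier W. ?F g f = 0"
    have "f z = 0" if "z \<in> B" for z using f(2) Fd(2)[OF that, of f] nz[OF that] \<delta>_cl[of z] by simp
    then show "f = \<zero>\<^bsub>W\<^esub>" using f(1) by (intro W_eqI) auto
  qed
  show ?thesis
    unfolding X_pseudo_unitary_form_def
  proof (intro conjI star nondeg ballI allI impI)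
    fix f c assume f: "f \<in> carrier W" "f \<noteq> \<zero>\<^bsub>W\<^esub> \<and> opX W f = c \<odot>\<^bsub>W\<^esub> f"
    have "\<exists>z\<in>B. f z \<noteq> 0"
    proof (rule ccontr)
      assume "\<not> ?thesis"
      then have "f = \<zero>\<^bsub>W\<^esub>" using f(1) by (intro W_eqI) auto
      then show False using f(2) by blast
    qed
    then obtain z where z: "z \<in> B" "f z \<noteq> 0" by blast
    have ec: "e w = c" if "w \<in> B" "f w \<noteq> 0" for w
    proof -
      have "opX W f w = (c \<odot>\<^bsub>W\<^esub> f) w" using f(2) by simp
      then show ?thesis using that by simp
    qed
    have "?F f f = (\<Sum>w\<in>B. if w = z then f z * bar (f z) * \<mu> z else 0)"
      unfolding fun_form_def
    proof (rule sum.cong[OF refl])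
      fix w assume w: "w \<in> B"
      show "f w * bar (f w) * \<mu> w = (if w = z then f z * bar (f z) * \<mu> z else 0)"
      proof (cases "f w = 0")
        case True then show ?thesis using z by auto
      next
        case False
        then have "e w = e z" using ec[OF w] ec[OF z] by simp
        then have "w = z" by (rule inj_e[OF w z(1)])
        then show ?thesis by simp
      qed
    qed
    then show "?F f f \<noteq> 0" using z nz[OF z(1)] by simp
  qed
qed

text \<open>Adjointness of X makes delta functions at different points orthogonal, because bar
  inverts q^z. The remaining diagonal values satisfy the same two rules as \<mu>, which determine
  them along the path up to the value at the start.\<close>

lemma star_form_unique:
  assumes nz: "\<And>z. z \<in> B \<Longrightarrow> \<mu> z \<noteq> 0" and rf: "\<And>z. z \<in> B \<Longrightarrow> \<mu> (1/2 - z) = \<mu> z"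
    and neg: "\<And>z. z \<in> B \<Longrightarrow> a z \<noteq> 0 \<Longrightarrow> a z * \<mu> z = a (- z) * \<mu> (- z)"
    and F: "star_form bar W F"
  shows "\<exists>c. \<forall>f\<in>carrier W. \<forall>g\<in>carrier W. F f g = c * fun_form bar B \<mu> f g"
proof -
  have F_add: "F (f \<oplus>\<^bsub>W\<^esub> g) h' = F f h' + F g h'" "F h' (f \<oplus>\<^bsub>W\<^esub> g) = F h' f + F h' g"
    if "f \<in> B \<rightarrow>\<^sub>E UNIV" "g \<in> B \<rightarrow>\<^sub>E UNIV" "h' \<in> B \<rightarrow>\<^sub>E UNIV" for f g h'
    using F that unfolding star_form_def W_sel(1) by blast+
  have F_sm: "F (c \<odot>\<^bsub>W\<^esub> f) g = c * F f g" "F f (c \<odot>\<^bsub>W\<^esub> g) = bar c * F f g"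
    if "f \<in> B \<rightarrow>\<^sub>E UNIV" "g \<in> B \<rightarrow>\<^sub>E UNIV" for c f g
    using F that unfolding star_form_def W_sel(1) by blast+
  have T: "opT W = WT" by (rule ext) simp
  have F_op: "F (A f) g = F f (op_inv W A g)"
    if "A \<in> {opX W, opY W, WT}" "f \<in> B \<rightarrow>\<^sub>E UNIV" "g \<in> B \<rightarrow>\<^sub>E UNIV" for A f g
    using F that unfolding star_form_def T W_sel(1) by blast
  have F_X: "F (opX W f) g = F f (\<lambda>z\<in>B. inverse (e z) * g z)" if "f \<in> B \<rightarrow>\<^sub>E UNIV" "g \<in> B \<rightarrow>\<^sub>E UNIV" for f g
    using F_op[of "opX W", OF _ that] op_inv_W(1)[OF that(2)] by (simp del: W_sel)
  have F_Y: "F (WP (WT f)) g = F f (WTi (WP g))" if "f \<in> B \<rightarrow>\<^sub>E UNIV" "g \<in> B \<rightarrow>\<^sub>E UNIV" for f g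
    using F_op[of "opY W", OF _ that] op_inv_W(2)[OF that(2)] by (simp del: W_sel(1-5,7))
  have F_T: "F (WT f) g = F f (WTi g)" if "f \<in> B \<rightarrow>\<^sub>E UNIV" "g \<in> B \<rightarrow>\<^sub>E UNIV" for f g
    using F_op[of WT, OF _ that] op_inv_W(3)[OF that(2)] by simp
  \<comment> \<open>The form is only assumed to be compatible with the generators, so \<pi> is
    obtained from Y and T.\<close>
  have F_P: "F (WP f) g = F f (WP g)" if fg: "f \<in> B \<rightarrow>\<^sub>E UNIV" "g \<in> B \<rightarrow>\<^sub>E UNIV" for f g
  proof -
    have "F (WP (WT (WTi f))) g = F (WTi f) (WTi (WP g))" using F_Y[of "WTi f" g] fg by simp
    also have "\<dots> = F (WT (WTi f)) (WP g)" by (rule F_T[symmetric]) simp_all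
    finally show ?thesis using WT_WTi[OF fg(1)] by simp
  qed
  have zero: "F (\<lambda>z\<in>B. 0) g = 0" "F g (\<lambda>z\<in>B. 0) = 0" if "g \<in> B \<rightarrow>\<^sub>E UNIV" for g
    using F_sm[of "\<lambda>z\<in>B. 0" g 0] F_sm[of g "\<lambda>z\<in>B. 0" 0] that by simp_all
  define \<nu> where "\<nu> z = F (\<delta> z) (\<delta> z)" for z
  have left: "F f g = (\<Sum>z\<in>B. f z * F (\<delta> z) g)" if f: "f \<in> B \<rightarrow>\<^sub>E UNIV" and g: "g \<in> B \<rightarrow>\<^sub>E UNIV" for f g
  proof -
    have "F (\<lambda>w\<in>B. \<Sum>z\<in>S. f z * \<delta> z w) g = (\<Sum>z\<in>S. f z * F (\<delta> z) g)" if "finite S" for S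
      using that
    proof (induction S)
      case empty then show ?case using zero(1)[OF g] by (simp only: sum.empty)
    next
      case (insert s S)
      have "(\<lambda>w\<in>B. \<Sum>z\<in>insert s S. f z * \<delta> z w) = (f s \<odot>\<^bsub>W\<^esub> \<delta> s) \<oplus>\<^bsub>W\<^esub> (\<lambda>w\<in>B. \<Sum>z\<in>S. f z * \<delta> z w)"
        using insert by auto
      then have "F (\<lambda>w\<in>B. \<Sum>z\<in>insert s S. f z * \<delta> z w) g = F (f s \<odot>\<^bsub>W\<^esub> \<delta> s) g + F (\<lambda>w\<in>B. \<Sum>z\<in>S. f z * \<delta> z w) g"
        by (simp only:) (rule F_add; simp add: g)
      also have "F (f s \<odot>\<^bsub>W\<^esub> \<delta> s) g = f s * F (\<delta> s) g" by (rule F_sm) (simp_all add: g)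
      finally show ?case by (simp only: sum.insert[OF insert.hyps(1,2)] insert.IH)
    qed
    from this[OF finite_B] have "F (\<lambda>w\<in>B. \<Sum>z\<in>B. f z * \<delta> z w) g = (\<Sum>z\<in>B. f z * F (\<delta> z) g)" .
    moreover have "(\<lambda>w\<in>B. \<Sum>z\<in>B. f z * \<delta> z w) = f"
      by (rule W_eqI[OF _ f]) (simp_all add: \<delta> if_distrib cong: if_cong)
    ultimately show ?thesis by simp
  qed
  have right: "F f g = (\<Sum>z\<in>B. bar (g z) * F f (\<delta> z))" if f: "f \<in> B \<rightarrow>\<^sub>E UNIV" and g: "g \<in> B \<rightarrow>\<^sub>E UNIV" for f g
  proof -
    have "F f (\<lambda>w\<in>B. \<Sum>z\<in>S. g z * \<delta> z w) = (\<Sum>z\<in>S. bar (g z) * F f (\<delta> z))" if "finite S" for S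
      using that
    proof (induction S)
      case empty then show ?case using zero(2)[OF f] by (simp only: sum.empty)
    next
      case (insert s S)
      have "(\<lambda>w\<in>B. \<Sum>z\<in>insert s S. g z * \<delta> z w) = (g s \<odot>\<^bsub>W\<^esub> \<delta> s) \<oplus>\<^bsub>W\<^esub> (\<lambda>w\<in>B. \<Sum>z\<in>S. g z * \<delta> z w)"
        using insert by auto
      then have "F f (\<lambda>w\<in>B. \<Sum>z\<in>insert s S. g z * \<delta> z w) = F f (g s \<odot>\<^bsub>W\<^esub> \<delta> s) + F f (\<lambda>w\<in>B. \<Sum>z\<in>S. g z * \<delta> z w)"
        by (simp only:) (rule F_add; simp add: f)
      also have "F f (g s \<odot>\<^bsub>W\<^esub> \<delta> s) = bar (g s) * F f (\<delta> s)" by (rule F_sm) (simp_all add: f)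
      finally show ?case by (simp only: sum.insert[OF insert.hyps(1,2)] insert.IH)
    qed
    from this[OF finite_B] have "F f (\<lambda>w\<in>B. \<Sum>z\<in>B. g z * \<delta> z w) = (\<Sum>z\<in>B. bar (g z) * F f (\<delta> z))" .
    moreover have "(\<lambda>w\<in>B. \<Sum>z\<in>B. g z * \<delta> z w) = g"
      by (rule W_eqI[OF _ g]) (simp_all add: \<delta> if_distrib cong: if_cong)
    ultimately show ?thesis by simp
  qed
  have orth: "F (\<delta> z) (\<delta> w) = 0" if zw: "z \<in> B" "w \<in> B" "z \<noteq> w" for z w
  proof -
    have 1: "opX W (\<delta> z) = e z \<odot>\<^bsub>W\<^esub> \<delta> z" "(\<lambda>y\<in>B. inverse (e y) * \<delta> w y) = inverse (e w) \<odot>\<^bsub>W\<^esub> \<delta> w"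
      by (rule W_eqI; simp add: \<delta>)+
    have "e z * F (\<delta> z) (\<delta> w) = bar (inverse (e w)) * F (\<delta> z) (\<delta> w)"
      using F_X[of "\<delta> z" "\<delta> w"] unfolding 1 by (simp only: F_sm \<delta>_cl)
    then have "e z * F (\<delta> z) (\<delta> w) = e w * F (\<delta> z) (\<delta> w)" by (simp add: bar_inverse bar_e)
    then show ?thesis using inj_e zw by auto
  qed
  have diag: "F f (\<delta> z) = f z * \<nu> z" if "f \<in> B \<rightarrow>\<^sub>E UNIV" "z \<in> B" for f z
  proof -
    have "F f (\<delta> z) = (\<Sum>w\<in>B. if w = z then f z * \<nu> z else 0)"
      unfolding left[OF that(1) \<delta>_cl] by (rule sum.cong) (use orth that in \<open>auto simp: \<nu>_def\<close>)
    then show ?thesis using that by simp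
  qed
  have diag': "F (\<delta> z) g = bar (g z) * \<nu> z" if "g \<in> B \<rightarrow>\<^sub>E UNIV" "z \<in> B" for g z
  proof -
    have "F (\<delta> z) g = (\<Sum>w\<in>B. if w = z then bar (g z) * \<nu> z else 0)"
      unfolding right[OF \<delta>_cl that(1)] by (rule sum.cong) (use orth that in \<open>auto simp: \<nu>_def\<close>)
    then show ?thesis using that by simp
  qed
  have \<nu>_refl: "\<nu> (1/2 - z) = \<nu> z" if z: "z \<in> B" for z
  proof -
    have "F (WP (\<delta> z)) (\<delta> (1/2 - z)) = F (\<delta> z) (WP (\<delta> (1/2 - z)))" by (rule F_P) simp_all
    then show ?thesis using z reflect_B[OF z] by (simp add: diag diag' WP \<delta>)
  qed
  have \<nu>_neg: "a z * \<nu> z = a (- z) * \<nu> (- z)" if z: "z \<in> B" "a z \<noteq> 0" for z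
  proof -
    note mz = uminus_B[OF z]
    have "z \<noteq> - z"
    proof
      assume "z = - z"
      then have "e z = inverse (e z)" using e_uminus[OF z(1)] by simp
      then have "(e z)\<^sup>2 = 1" by (metis e_nz power2_eq_square right_inverse)
      then show False using e_regular[OF z(1)] by simp
    qed
    moreover have "F (WT (\<delta> z)) (\<delta> (- z)) = F (\<delta> z) (WTi (\<delta> (- z)))" by (rule F_T) simp_all
    ultimately show ?thesis using z mz by (simp add: diag diag' WT WTi \<delta> bar_a)
  qed
  define c where "c = \<nu> z0 / \<mu> z0"
  have \<nu>: "\<nu> z = c * \<mu> z" if "z \<in> B" for z
    using that
  proof (rule path_induct)
    show "\<nu> z0 = c * \<mu> z0" using nz[OF z0_B] by (simp add: c_def)
    show "\<nu> (1/2 - z) = c * \<mu> (1/2 - z)" if "z \<in> B" "\<nu> z = c * \<mu> z" for z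
      using that \<nu>_refl rf by simp
    show "\<nu> (- z) = c * \<mu> (- z)" if z: "z \<in> B" "a z \<noteq> 0" "\<nu> z = c * \<mu> z" for z
    proof -
      have "a (- z) * \<nu> (- z) = a z * \<nu> z" using \<nu>_neg[OF z(1,2)] by simp
      also have "\<dots> = c * (a z * \<mu> z)" by (simp add: z(3))
      also have "\<dots> = a (- z) * (c * \<mu> (- z))" by (simp only: neg[OF z(1,2)] mult.left_commute)
      finally have "a (- z) * \<nu> (- z) = a (- z) * (c * \<mu> (- z))" .
      then show ?thesis using uminus_B(2)[OF z(1,2)] by auto
    qed
  qed
  have "F f g = c * fun_form bar B \<mu> f g" if fg: "f \<in> B \<rightarrow>\<^sub>E UNIV" "g \<in> B \<rightarrow>\<^sub>E UNIV" for f g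
    using left[OF fg] fg by (simp add: diag' fun_form_def \<nu> sum_distrib_left mult_ac)
  then show ?thesis by auto
qed

end

section \<open>The projective action of the modular group\<close>

context daha_mod
begin

lemma smult_eq_zero: "v \<in> carrier V \<Longrightarrow> c \<odot> v = \<zero> \<Longrightarrow> v \<noteq> \<zero> \<Longrightarrow> c = 0"
proof (rule ccontr)
  assume v: "v \<in> carrier V" "c \<odot> v = \<zero>" "v \<noteq> \<zero>" "c \<noteq> 0"
  have "v = (inverse c * c) \<odot> v" using v by simp
  also have "\<dots> = inverse c \<odot> (c \<odot> v)" by (rule smult_smult[OF v(1), symmetric])
  finally have "v = inverse c \<odot> (c \<odot> v)" .
  then show False using v by simp
qed

lemma smult_cancel: "v \<in> carrier V \<Longrightarrow> c \<odot> v = c' \<odot> v \<Longrightarrow> v \<noteq> \<zero> \<Longrightarrow> c = c'"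
proof -
  assume v: "v \<in> carrier V" "c \<odot> v = c' \<odot> v" "v \<noteq> \<zero>"
  have "(c - c') \<odot> v = c \<odot> v \<oplus> (- c') \<odot> v" using smult_l_distr[OF v(1), of c "- c'"] by simp
  also have "\<dots> = (c' + - c') \<odot> v" unfolding v(2) by (rule smult_l_distr[OF v(1), symmetric])
  finally have "c - c' = 0" using smult_eq_zero[OF v(1) _ v(3), of "c - c'"] v(1) by simp
  then show ?thesis by simp
qed

text \<open>Here u is the spherical vector and d the eigenvector of X for t^(-1/2). The relations
  hold up to scalars by the Schur hypothesis, and the scalars are read off from d and u. The
  condition P d = d fixes the scale of P, and only E has to be rescaled.\<close>

lemma tau_epsilon_invariantI:
  assumes nz: "q4 \<noteq> 0" "t2 \<noteq> 0" and bar: "bar_involution q4 t2 bar"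
    and schur: "\<And>S. semilinear_map id V V S \<Longrightarrow>
        (\<And>v. v \<in> carrier V \<Longrightarrow> S (opX V v) = opX V (S v) \<and> S (opY V v) = opY V (S v) \<and> S (opT V v) = opT V (S v)) \<Longrightarrow>
        \<exists>c. \<forall>v\<in>carrier V. S v = c \<odot> v"
    and sph: "\<And>v. v \<in> carrier V \<Longrightarrow> opT V v = t2 \<odot> v \<Longrightarrow> opY V v = t2 \<odot> v \<Longrightarrow> \<exists>c. v = c \<odot> u"
    and u: "u \<in> carrier V" "u \<noteq> \<zero>" and d: "d \<in> carrier V" "d \<noteq> \<zero>" "opX V d = inverse t2 \<odot> d" "opT V d = t2 \<odot> d"
    and P: "semilinear_map id V V P" "bij_betw P (carrier V) (carrier V)" "induces_tau_plus q4 V P" "P d = d"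
    and E: "semilinear_map bar V V E" "bij_betw E (carrier V) (carrier V)" "induces_epsilon V E" "E u = d"
  shows "tau_epsilon_invariant q4 bar V"
proof -
  interpret field_involution q4 t2 bar by unfold_locales (rule bar)
  let ?C = "carrier V"
  note bT = bijT[OF nz(2)]
  define Pi where "Pi = op_inv V P"
  define Ei where "Ei = op_inv V E"
  have cl [simp]: "P v \<in> ?C" "E v \<in> ?C" "Pi v \<in> ?C" "Ei v \<in> ?C" "op_inv V (opT V) v \<in> ?C" if "v \<in> ?C" for v
    using P(1) E(1) op_inv_closed[OF P(2) that] op_inv_closed[OF E(2) that] op_inv_closed[OF bT that] that
    by (auto simp: semilinear_map_def Pi_def Ei_def)
  have inv [simp]: "P (Pi v) = v" "Pi (P v) = v" "E (Ei v) = v" "Ei (E v) = v"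
    "opT V (op_inv V (opT V) v) = v" "op_inv V (opT V) (opT V v) = v" if "v \<in> ?C" for v
    using op_inv_right[OF P(2) that] op_inv_left[OF P(2) that] op_inv_right[OF E(2) that] op_inv_left[OF E(2) that]
      op_inv_right[OF bT that] op_inv_left[OF bT that] by (auto simp: Pi_def Ei_def)
  have Pl: "P (v \<oplus> w) = P v \<oplus> P w" "P (c \<odot> v) = c \<odot> P v" if "v \<in> ?C" "w \<in> ?C" for v w c
    using P(1) that by (auto simp: semilinear_map_def)
  have El: "E (v \<oplus> w) = E v \<oplus> E w" "E (c \<odot> v) = bar c \<odot> E v" if "v \<in> ?C" "w \<in> ?C" for v w c
    using E(1) that by (auto simp: semilinear_map_def)
  have Pil: "Pi (v \<oplus> w) = Pi v \<oplus> Pi w" "Pi (c \<odot> v) = c \<odot> Pi v" if "v \<in> ?C" "w \<in> ?C" for v w c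
    using Pl[of "Pi v" "Pi w"] inv(2)[of "Pi v \<oplus> Pi w"] inv(2)[of "c \<odot> Pi v"] that by simp_all
  have Eil: "Ei (v \<oplus> w) = Ei v \<oplus> Ei w" "Ei (c \<odot> v) = bar c \<odot> Ei v" if "v \<in> ?C" "w \<in> ?C" for v w c
    using El(1)[of "Ei v" "Ei w"] El(2)[of "Ei v" "Ei w" "bar c"] inv(4)[of "Ei v \<oplus> Ei w"] inv(4)[of "bar c \<odot> Ei v"] that
    by simp_all
  have Til: "op_inv V (opT V) (c \<odot> v) = c \<odot> op_inv V (opT V) v" if "v \<in> ?C" for v c
    using op_smult(3)[of "op_inv V (opT V) v" c] inv(6)[of "c \<odot> op_inv V (opT V) v"] that by simp
  have Xil: "Xi (c \<odot> v) = c \<odot> Xi v" "Yi (c \<odot> v) = c \<odot> Yi v" if "v \<in> ?C" for v c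
    using op_smult(1)[of "Xi v" c] XXi(2)[of "c \<odot> Xi v"] op_smult(2)[of "Yi v" c] YYi(2)[of "c \<odot> Yi v"] that by simp_all
  have PX: "P (opX V v) = opX V (P v)" "P (opT V v) = opT V (P v)"
    "P (opY V v) = inverse q4 \<odot> opX V (opY V (P v))" if "v \<in> ?C" for v
    using P(3) that by (auto simp: induces_tau_plus_def)
  have PYi: "P (Yi v) = q4 \<odot> Yi (Xi (P v))" if "v \<in> ?C" for v
  proof -
    have "P v = inverse q4 \<odot> opX V (opY V (P (Yi v)))" using PX(3)[of "Yi v"] that by simp
    then have "Yi (Xi (P v)) = inverse q4 \<odot> P (Yi v)" using that by (simp add: Xil)
    then show ?thesis using that nz by (simp add: smult_smult)
  qed
  have EX: "E (opX V v) = opY V (E v)" "E (opY V v) = opX V (E v)" "E (opT V v) = op_inv V (opT V) (E v)" if "v \<in> ?C" for v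
    using E(3) that by (auto simp: induces_epsilon_def)
  have ETi: "E (op_inv V (opT V) v) = opT V (E v)" if "v \<in> ?C" for v
    using EX(3)[of "op_inv V (opT V) v"] that inv(5)[of "E (op_inv V (opT V) v)"] by simp
  have EiX: "Ei (opX V v) = opY V (Ei v)" "Ei (opY V v) = opX V (Ei v)" "Ei (opT V v) = op_inv V (opT V) (Ei v)" if "v \<in> ?C" for v
    using EX(1,2)[of "Ei v"] ETi[of "Ei v"] that inv(4)[of "opY V (Ei v)"] inv(4)[of "opX V (Ei v)"]
      inv(4)[of "op_inv V (opT V) (Ei v)"] by simp_all
  have PTi: "P (op_inv V (opT V) v) = op_inv V (opT V) (P v)" if "v \<in> ?C" for v
    using PX(2)[of "op_inv V (opT V) v"] that inv(6)[of "P (op_inv V (opT V) v)"] by simp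
  \<comment> \<open>Forced by the relation between \<epsilon> and the two \<tau>; rescaling E does
    not change it.\<close>
  define M where "M v = E (P (Ei v))" for v
  define Mi where "Mi v = E (Pi (Ei v))" for v
  have Mcl [simp]: "M v \<in> ?C" "Mi v \<in> ?C" if "v \<in> ?C" for v using that by (simp_all add: M_def Mi_def)
  have Minv [simp]: "M (Mi v) = v" "Mi (M v) = v" if "v \<in> ?C" for v using that by (simp_all add: M_def Mi_def)
  have Ml: "M (v \<oplus> w) = M v \<oplus> M w" "M (c \<odot> v) = c \<odot> M v" if "v \<in> ?C" "w \<in> ?C" for v w c
    using that by (simp_all add: M_def Eil Pl El)
  have Mil: "Mi (v \<oplus> w) = Mi v \<oplus> Mi w" "Mi (c \<odot> v) = c \<odot> Mi v" if "v \<in> ?C" "w \<in> ?C" for v w c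
    using that by (simp_all add: Mi_def Eil Pil El)
  have Mlin: "semilinear_map id V V M" using Ml by (auto simp: semilinear_map_def)
  have Mbij: "bij_betw M ?C ?C" by (rule bij_betw_byWitness[where f' = Mi]) auto
  have Mi: "op_inv V M v = Mi v" if "v \<in> ?C" for v by (rule op_inv_eqI[OF Mbij]) (use that in auto)
  have MX: "M (opY V v) = opY V (M v)" "M (opT V v) = opT V (M v)" "M (opX V v) = q4 \<odot> opY V (opX V (M v))"
    if "v \<in> ?C" for v
    using that by (simp_all add: M_def EiX EX PX PTi ETi El bar_inverse bar_q4)
  have MiX: "Mi (opY V v) = opY V (Mi v)" "Mi (opT V v) = opT V (Mi v)" "Mi (opX V v) = inverse q4 \<odot> Yi (opX V (Mi v))"
    if "v \<in> ?C" for v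
  proof -
    show "Mi (opY V v) = opY V (Mi v)" "Mi (opT V v) = opT V (Mi v)"
      using MX(1,2)[of "Mi v"] Minv(2)[of "opY V (Mi v)"] Minv(2)[of "opT V (Mi v)"] that by simp_all
    have "M (Yi w) = Yi (M w)" if "w \<in> ?C" for w using MX(1)[of "Yi w"] that YYi(2)[of "M (Yi w)"] by simp
    then have "M (inverse q4 \<odot> Yi (opX V (Mi v))) = opX V v"
      using that nz MX(3)[of "Mi v"] by (simp add: Ml Xil smult_smult)
    then show "Mi (opX V v) = inverse q4 \<odot> Yi (opX V (Mi v))"
      using Minv(2)[of "inverse q4 \<odot> Yi (opX V (Mi v))"] that by simp
  qed
  have "\<exists>c. \<forall>v\<in>?C. E (E v) = c \<odot> v"
    by (rule schur) (auto simp: semilinear_map_def El EX ETi)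
  then obtain c where c: "\<And>v. v \<in> ?C \<Longrightarrow> E (E v) = c \<odot> v" by blast
  have Ed: "E d = c \<odot> u" using c[OF u(1)] E(4) by simp
  have c0: "c \<noteq> 0"
  proof
    assume "c = 0"
    then have "E (E u) = \<zero>" "E (0 \<odot> u) = \<zero>" using c u El(2)[of u u 0] by simp_all
    then have "E u = 0 \<odot> u" using u inv(4) by (metis cl(2) smult_closed)
    then show False using d E(4) u by simp
  qed
  have EM: "E (M v) = P (E v)" if "v \<in> ?C" for v
  proof -
    have "E (M v) = P (c \<odot> Ei v)" using that by (simp add: M_def c Pl)
    also have "c \<odot> Ei v = E v" using c[of "Ei v"] that by simp
    finally show ?thesis .
  qed
  have EP: "E (P v) = M (E v)" if "v \<in> ?C" for v using that by (simp add: M_def)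
  have EMi: "E (Mi v) = Pi (E v)" if "v \<in> ?C" for v
    using EM[of "Mi v"] that inv(2)[of "E (Mi v)"] by simp
  \<comment> \<open>E maps a multiple of d to u, and P fixes d.\<close>
  have Mu: "M u = u"
  proof -
    have "u = E (bar (inverse c) \<odot> d)" using u d c0 by (simp add: El Ed smult_smult)
    then have e: "Ei u = bar (inverse c) \<odot> d" using inv(4)[of "bar (inverse c) \<odot> d"] d by simp
    then have "P (Ei u) = Ei u" using d P(4) by (simp add: Pl)
    then show ?thesis using u by (simp add: M_def)
  qed
  \<comment> \<open>Both sides of the braid relation send X to Y^(-1) and act alike on the other
    generators, so they differ by a scalar.\<close>
  define A where "A v = P (Mi (P v))" for v
  define A' where "A' v = Mi (P (Mi v))" for v
  define Ai where "Ai v = Pi (M (Pi v))" for v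
  have Acl [simp]: "A v \<in> ?C" "A' v \<in> ?C" "Ai v \<in> ?C" "A (Ai v) = v" "Ai (A v) = v" if "v \<in> ?C" for v
    using that by (simp_all add: A_def A'_def Ai_def)
  have A: "A (opX V v) = Yi (A v)" "A (opY V v) = inverse (q4\<^sup>2) \<odot> Yi (opX V (opY V (A v)))" "A (opT V v) = opT V (A v)"
    if "v \<in> ?C" for v
    using that nz by (simp_all add: A_def PX MiX Pl PYi Mil op_smult Xil smult_smult power2_eq_square)
  have A': "A' (opX V v) = Yi (A' v)" "A' (opY V v) = inverse (q4\<^sup>2) \<odot> Yi (opX V (opY V (A' v)))" "A' (opT V v) = opT V (A' v)"
    if "v \<in> ?C" for v
  proof -
    have MiYi: "Mi (Yi w) = Yi (Mi w)" if "w \<in> ?C" for w using MiX(1)[of "Yi w"] that YYi(2)[of "Mi (Yi w)"] by simp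
    show "A' (opX V v) = Yi (A' v)" "A' (opY V v) = inverse (q4\<^sup>2) \<odot> Yi (opX V (opY V (A' v)))" "A' (opT V v) = opT V (A' v)"
      using that nz by (simp_all add: A'_def PX MiX Pl PYi Mil op_smult Xil smult_smult power2_eq_square MiYi)
  qed
  have Al: "A (v \<oplus> w) = A v \<oplus> A w" "A (c \<odot> v) = c \<odot> A v" if "v \<in> ?C" "w \<in> ?C" for v w c
    using that by (simp_all add: A_def Pl Mil)
  have A'l: "A' (v \<oplus> w) = A' v \<oplus> A' w" "A' (c \<odot> v) = c \<odot> A' v" if "v \<in> ?C" "w \<in> ?C" for v w c
    using that by (simp_all add: A'_def Pl Mil)
  have Ail: "Ai (v \<oplus> w) = Ai v \<oplus> Ai w" "Ai (c \<odot> v) = c \<odot> Ai v" if "v \<in> ?C" "w \<in> ?C" for v w c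
    using that by (simp_all add: Ai_def Pil Ml)
  have Ai: "Ai (Yi v) = opX V (Ai v)" "Ai (inverse (q4\<^sup>2) \<odot> Yi (opX V (opY V v))) = opY V (Ai v)" "Ai (opT V v) = opT V (Ai v)"
    if "v \<in> ?C" for v
    using A[of "Ai v"] Acl(5)[of "opX V (Ai v)"] Acl(5)[of "opY V (Ai v)"] Acl(5)[of "opT V (Ai v)"] that by simp_all
  have AiY: "inverse (q4\<^sup>2) \<odot> opX V (Ai (opX V (opY V v))) = opY V (Ai v)" if "v \<in> ?C" for v
    using Ai(2)[OF that] that by (simp add: Ail Ai(1))
  \<comment> \<open>The eigenvalue t^(-1/2) of X on d becomes the eigenvalue of Y^(-1) on A d, which
    is therefore spherical.\<close>
  have "\<exists>s. A d = s \<odot> u"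
  proof (rule sph)
    have "Yi (A d) = inverse t2 \<odot> A d" using A(1)[OF d(1)] d by (simp add: Al)
    then have "opY V (inverse t2 \<odot> A d) = A d" using d YYi(1)[of "A d"] by simp
    then have "t2 \<odot> (inverse t2 \<odot> opY V (A d)) = t2 \<odot> A d" using d by (simp add: op_smult)
    then show "opY V (A d) = t2 \<odot> A d" using d nz by (simp add: smult_smult)
    show "opT V (A d) = t2 \<odot> A d" using A(3)[OF d(1)] d by (simp add: Al)
  qed (use d in simp)
  then obtain s where s: "A d = s \<odot> u" by blast
  have s0: "s \<noteq> 0"
  proof
    assume "s = 0"
    then have "A d = A (0 \<odot> d)" using s u d Al(2)[OF d(1) d(1), of 0] by simp
    then have "d = 0 \<odot> d" using Acl(5) d by (metis smult_closed)
    then show False using d by simp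
  qed
  have Miu: "Mi u = u" using Mu Minv(2)[OF u(1)] by simp
  have A'd: "A' d = s \<odot> u"
  proof -
    have "P (Mi d) = s \<odot> u" using s P(4) by (simp add: A_def)
    then show ?thesis using u by (simp add: A'_def Mil Miu)
  qed
  have "\<exists>r. \<forall>v\<in>?C. Ai (A' v) = r \<odot> v"
    by (rule schur) (auto simp: semilinear_map_def A'l Ail A' Ai(1,3) AiY)
  then obtain r where r: "\<And>v. v \<in> ?C \<Longrightarrow> Ai (A' v) = r \<odot> v" by blast
  have "r \<odot> d = 1 \<odot> d" using r[OF d(1)] A'd s Acl(5)[OF d(1)] d by simp
  then have r1: "r = 1" using smult_cancel d by blast
  have AA': "A' v = A v" if "v \<in> ?C" for v
    using r[OF that] that r1 Acl(4)[of "A' v"] by simp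
  \<comment> \<open>Pushing E through by E P = M E and E M^(-1) = P^(-1) E cancels all other
    factors. Evaluating at d then compares \<open>c\<close> with \<open>s\<close>.\<close>
  have "A' (E (A v)) = E v" if "v \<in> ?C" for v
    using that by (simp add: A_def A'_def EP EMi)
  from this[OF d(1)] have "bar s * s = c"
    using d u E(4) by (intro smult_cancel[OF u(1) _ u(2)]) (simp add: s El A'l A'd Ed smult_smult)
  from this[symmetric] have cs: "inverse s * (inverse (bar s) * c) = 1" using s0 by (simp add: field_simps)
  \<comment> \<open>As E is antilinear, the square of F is c divided by s (bar s), which is
    1.\<close>
  define F where "F v = inverse s \<odot> E v" for v
  have Fcl [simp]: "F v \<in> ?C" if "v \<in> ?C" for v using that by (simp add: F_def)
  have FF: "F (F v) = v" if "v \<in> ?C" for v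
    using that cs by (simp add: F_def El c smult_smult bar_inverse mult.assoc)
  have Fbij: "bij_betw F ?C ?C" by (rule bij_betw_byWitness[where f' = F]) (auto simp: FF)
  have Flin: "semilinear_map bar V V F"
    by (auto simp: semilinear_map_def F_def El smult_r_distr smult_smult mult.commute)
  have Feps: "induces_epsilon V F"
    by (auto simp: induces_epsilon_def F_def EX op_smult Til)
  show ?thesis
    unfolding tau_epsilon_invariant_def
  proof (rule exI[of _ P], rule exI[of _ M], rule exI[of _ F], intro conjI ballI P Mlin Mbij Flin Fbij Feps)
    show "induces_tau_minus q4 V M" using MX by (simp add: induces_tau_minus_def)
    fix v assume v: "v \<in> ?C"
    show "P (op_inv V M (P v)) = op_inv V M (P (op_inv V M v))"
      using AA'[OF v] v by (simp add: Mi A_def A'_def)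
    show "F (F v) = v" by (rule FF[OF v])
    show "F (P v) = M (F v)" using v by (simp add: F_def EP Ml)
  qed
qed

end

section \<open>The Gaussian, spherical vectors and Schur's lemma\<close>

context fun_ctx
begin

text \<open>This is q^(z^2 - (k/2)^2). Subtracting the square at the starting point normalizes the
  value there to 1 and makes the exponent of q^(1/4) an integer, since u and J have the same parity
  on the set.\<close>

definition gauss :: "rat \<Rightarrow> 'k" where "gauss z = q4 powi ((\<lfloor>4 * z\<rfloor>\<^sup>2 - J\<^sup>2) div 4)"

lemma gauss_pt: "gauss (pt u) = q4 powi ((u\<^sup>2 - J\<^sup>2) div 4)"
  by (simp add: gauss_def pt_def)

lemma gauss_nz [simp]: "gauss z \<noteq> 0" using q4_nz by (simp add: gauss_def)

lemma gauss_z0: "gauss z0 = 1" by (simp add: z0_def gauss_pt)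

lemma gauss_uminus: "z \<in> B \<Longrightarrow> gauss (- z) = gauss z"
  by (drule B_int) (auto simp: uminus_pt gauss_pt)

lemma B_parity:
  assumes "z \<in> B"
  obtains u where "z = pt u" "even (u - J)"
  using assms by (cases rule: B_cases) auto

text \<open>From (1/2 - z)^2 = z^2 - z + 1/4.\<close>

lemma gauss_reflect:
  assumes "z \<in> B"
  shows "gauss z = inverse q4 * e z * gauss (1/2 - z)"
proof -
  obtain u where u: "z = pt u" "even (u - J)" using assms by (rule B_parity)
  then obtain k where k: "u = J + 2 * k" by (metis add.commute diff_add_cancel evenE)
  have 1: "(u\<^sup>2 - J\<^sup>2) div 4 = J * k + k * k" 
  proof -
    have "u\<^sup>2 - J\<^sup>2 = 4 * (J * k + k * k)" by (simp add: k power2_eq_square algebra_simps)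
    then show ?thesis by simp
  qed
  have 2: "((2 - u)\<^sup>2 - J\<^sup>2) div 4 = J * k + k * k + (1 - u)" 
  proof -
    have "(2 - u)\<^sup>2 - J\<^sup>2 = 4 * (J * k + k * k + (1 - u))" by (simp add: k power2_eq_square algebra_simps)
    then show ?thesis by simp
  qed
  have "inverse q4 * q4 powi u * q4 powi (J * k + k * k + (1 - u)) = q4 powi (J * k + k * k)"
    using q4_nz by (simp add: power_int_add power_int_diff field_simps)
  then show ?thesis by (simp only: u(1) reflect_pt e_int gauss_pt 1 2)
qed

definition WG :: "(rat \<Rightarrow> 'k) \<Rightarrow> rat \<Rightarrow> 'k" where "WG f = (\<lambda>z\<in>B. gauss z * f z)"

lemma WG_tau_plus: "semilinear_map id W W WG" "bij_betw WG (carrier W) (carrier W)"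
  "induces_tau_plus q4 W WG" "WG (\<delta> z0) = \<delta> z0"
proof -
  show "semilinear_map id W W WG"
    by (auto simp: semilinear_map_def WG_def algebra_simps intro!: W_eqI)
  show "bij_betw WG (carrier W) (carrier W)"
  proof (rule bij_betw_byWitness[where f' = "\<lambda>f. \<lambda>z\<in>B. inverse (gauss z) * f z"])
    show "\<forall>f\<in>carrier W. (\<lambda>z\<in>B. inverse (gauss z) * WG f z) = f"
      "\<forall>f\<in>carrier W. WG (\<lambda>z\<in>B. inverse (gauss z) * f z) = f"
      unfolding W_sel(1) by (intro ballI, rule W_eqI, simp_all add: WG_def)+
  qed (simp_all add: WG_def image_subset_iff)
  show "WG (\<delta> z0) = \<delta> z0" by (rule W_eqI) (auto simp: WG_def \<delta> gauss_z0)
  have T: "WG (WT f) = WT (WG f)" for f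
    by (rule W_eqI) (use uminus_B in \<open>auto simp: WG_def WT gauss_uminus algebra_simps\<close>)
  have P: "WG (WP f) = (\<lambda>z\<in>B. inverse q4 * (e z * WP (WG f) z))" for f
  proof (rule W_eqI)
    fix z assume z: "z \<in> B"
    have "gauss z * f (1/2 - z) = inverse q4 * (e z * (gauss (1/2 - z) * f (1/2 - z)))"
      by (subst gauss_reflect[OF z]) (simp only: mult.assoc)
    then show "WG (WP f) z = (\<lambda>z\<in>B. inverse q4 * (e z * WP (WG f) z)) z"
      using z reflect_B[OF z] by (simp add: WG_def WP)
  qed (simp_all add: WG_def)
  show "induces_tau_plus q4 W WG"
    unfolding induces_tau_plus_def
  proof (intro ballI conjI)
    fix f assume "f \<in> carrier W"
    show "WG (opX W f) = opX W (WG f)" by (auto simp: WG_def)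
    show "WG (opT W f) = opT W (WG f)" by (simp add: T)
    show "WG (opY W f) = inverse q4 \<odot>\<^bsub>W\<^esub> opX W (opY W (WG f))"
      by (rule W_eqI) (simp_all add: P T)
  qed
qed

definition u1 :: "rat \<Rightarrow> 'k" where "u1 = (\<lambda>z\<in>B. 1)"

lemma u1_eq: "u1 = \<psi> 1" by (auto simp: u1_def \<psi>_def)

text \<open>The two eigenvalue equations make v invariant under the reflection and, where \<alpha>
  is nonzero, under the sign change; so v is constant along the path.\<close>

lemma spherical_vector_unique:
  assumes v: "v \<in> carrier W" "opT W v = t2 \<odot>\<^bsub>W\<^esub> v" "opY W v = t2 \<odot>\<^bsub>W\<^esub> v"
  shows "\<exists>c. v = c \<odot>\<^bsub>W\<^esub> u1"
proof -
  have T: "WT v z = t2 * v z" if "z \<in> B" for z using v(2) that by (metis W_sel(4,7) restrict_apply')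
  have Y: "WP (WT v) z = t2 * v z" if "z \<in> B" for z using v(3) that by (metis W_sel(4,6) restrict_apply')
  have refl: "v (1/2 - z) = v z" if "z \<in> B" for z
    using Y[OF that] T[OF reflect_B[OF that]] t2_nz by (simp add: WP that)
  have neg: "v (- z) = v z" if "z \<in> B" "a z \<noteq> 0" for z
  proof -
    have "a z * v (- z) - b z * v z = t2 * v z" using T[OF that(1)] that by (simp add: WT)
    then have "a z * v (- z) = a z * v z" using \<alpha>_\<beta>[OF e_regular[OF that(1)]] by (simp add: algebra_simps)
    then show ?thesis using that by simp
  qed
  have "v z = v z0" if "z \<in> B" for z
    using that by (rule path_induct) (use refl neg in auto)
  then have "v = v z0 \<odot>\<^bsub>W\<^esub> u1" using v(1) by (intro W_eqI) (auto simp: u1_def)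
  then show ?thesis by blast
qed

text \<open>No eigenvalue has to be found: an intertwiner maps the spherical vector to a spherical
  vector, hence to a multiple of it, and this vector generates the module under X.\<close>

lemma schur_W:
  assumes S: "semilinear_map id W W S"
    and comm: "\<And>v. v \<in> carrier W \<Longrightarrow> S (opX W v) = opX W (S v) \<and> S (opY W v) = opY W (S v) \<and> S (opT W v) = opT W (S v)"
  shows "\<exists>c. \<forall>v\<in>carrier W. S v = c \<odot>\<^bsub>W\<^esub> v"
proof -
  have Scl: "S v \<in> carrier W" if "v \<in> carrier W" for v using S that by (auto simp only: semilinear_map_def)
  have S_sm: "S (c \<odot>\<^bsub>W\<^esub> v) = c \<odot>\<^bsub>W\<^esub> S v" if "v \<in> carrier W" for c v
    using S that by (simp only: semilinear_map_def id_apply)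
  have S_add: "S (v \<oplus>\<^bsub>W\<^esub> w) = S v \<oplus>\<^bsub>W\<^esub> S w" if "v \<in> carrier W" "w \<in> carrier W" for v w
    using S that by (simp only: semilinear_map_def)
  have "\<exists>c. S u1 = c \<odot>\<^bsub>W\<^esub> u1"
  proof (rule spherical_vector_unique)
    show "S u1 \<in> carrier W" unfolding u1_eq by (rule Scl[OF W.\<phi>_closed])
    show "opT W (S u1) = t2 \<odot>\<^bsub>W\<^esub> S u1" "opY W (S u1) = t2 \<odot>\<^bsub>W\<^esub> S u1"
      using comm[OF W.\<phi>_closed[of 1]] S_sm[OF W.\<phi>_closed[of 1], of t2]
      unfolding u1_eq W.\<phi>_one_T W.\<phi>_one_Y by metis+
  qed
  then obtain c where c: "S (\<psi> 1) = c \<odot>\<^bsub>W\<^esub> \<psi> 1" unfolding u1_eq by blast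
  have Xi: "S (W.V.Xi v) = W.V.Xi (S v)" if "v \<in> carrier W" for v
  proof -
    have m: "W.V.Xi v \<in> carrier W" using that by (rule W.V.closed(4))
    have "S v = opX W (S (W.V.Xi v))" using comm[OF m] W.V.XXi(1)[OF that] by (simp only:)
    then show ?thesis using W.V.XXi(2)[OF Scl[OF m]] by (simp only:)
  qed
  have Xil: "W.V.Xi (c \<odot>\<^bsub>W\<^esub> v) = c \<odot>\<^bsub>W\<^esub> W.V.Xi v" if "v \<in> carrier W" for v
  proof -
    have m: "W.V.Xi v \<in> carrier W" using that by (rule W.V.closed(4))
    have "c \<odot>\<^bsub>W\<^esub> v = opX W (c \<odot>\<^bsub>W\<^esub> W.V.Xi v)" using W.V.op_smult(1)[OF m, of c] W.V.XXi(1)[OF that] by (simp only:)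
    then show ?thesis using W.V.XXi(2)[OF W.V.smult_closed[OF m, of c]] by (simp only:)
  qed
  have "S (\<psi> f) = c \<odot>\<^bsub>W\<^esub> \<psi> f" for f
  proof (induction f rule: laurent_induct)
    case (const x)
    show ?case
      using W.V.smult_smult[OF W.\<phi>_closed[of 1], of x c] W.V.smult_smult[OF W.\<phi>_closed[of 1], of c x]
      by (simp only: W.\<phi>_const S_sm[OF W.\<phi>_closed] c mult.commute[of x c])
  next
    case (mult_X f)
    then show ?case using comm[OF W.\<phi>_closed[of f]] W.V.op_smult(1)[OF W.\<phi>_closed[of f], of c]
      by (simp only: W.\<phi>_X)
  next
    case (mult_Xinv f)
    then show ?case using Xi[OF W.\<phi>_closed[of f]] Xil[OF W.\<phi>_closed[of f]]
      by (simp only: W.\<phi>_Xi)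
  next
    case (add f g)
    then show ?case
      by (simp only: W.\<phi>_add S_add[OF W.\<phi>_closed W.\<phi>_closed] W.V.smult_r_distr[OF W.\<phi>_closed W.\<phi>_closed])
  qed
  then show ?thesis using W.surj by (metis rangeE)
qed

section \<open>The operator inducing epsilon\<close>

sublocale Ybar: laurent_action bar Y Yi
  by unfold_locales (auto simp: Y_add Y_smult bar_add bar_mult)

abbreviation "Ker \<equiv> W.Ker"

lemma \<delta>_z0: "\<delta> z0 \<in> carrier W" "\<delta> z0 \<noteq> \<zero>\<^bsub>W\<^esub>" "opX W (\<delta> z0) = inverse t2 \<odot>\<^bsub>W\<^esub> \<delta> z0" "opT W (\<delta> z0) = t2 \<odot>\<^bsub>W\<^esub> \<delta> z0"
proof -
  show "\<delta> z0 \<in> carrier W" by simp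
  have "\<delta> z0 z0 \<noteq> \<zero>\<^bsub>W\<^esub> z0" using z0_B by (simp add: \<delta>)
  then show "\<delta> z0 \<noteq> \<zero>\<^bsub>W\<^esub>" by metis
  show "opX W (\<delta> z0) = inverse t2 \<odot>\<^bsub>W\<^esub> \<delta> z0" by (rule W_eqI) (auto simp: \<delta> e_z0)
  show "opT W (\<delta> z0) = t2 \<odot>\<^bsub>W\<^esub> \<delta> z0"
  proof (rule W_eqI)
    fix z assume z: "z \<in> B"
    have a0: "a z0 = 0" by (simp only: e_z0 \<alpha>_x0)
    then have "b z0 = - t2" using \<alpha>_\<beta>[OF e_regular[OF z0_B]] by (simp add: eq_neg_iff_add_eq_0 add.commute)
    moreover have "- z \<noteq> z0" if "a z \<noteq> 0" using uminus_B[OF z that] a0 by auto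
    ultimately show "opT W (\<delta> z0) z = (t2 \<odot>\<^bsub>W\<^esub> \<delta> z0) z"
      using z uminus_B[OF z] by (auto simp: WT \<delta>)
  qed simp_all
qed

lemma Ker_W: "Ker = Rad q4 t2"
  by (rule W.Ker_eq_Rad[OF irreducible_W \<delta>_z0(1-3)])

definition g0 :: "'k laurent" where "g0 = lagrange z0"

lemma \<psi>_g0: "\<psi> g0 = \<delta> z0"
  by (rule W_eqI) (auto simp: \<psi> g0_def lagrange z0_B \<delta>)

lemma g0_Ti: "Ti g0 - lC (inverse t2) * g0 \<in> Ker"
proof -
  have "T g0 - lC t2 * g0 \<in> Ker"
    using \<delta>_z0(4) unfolding W.\<phi>_eq_iff[symmetric] W.\<phi>_T W.\<phi>_smult \<psi>_g0 .
  then show ?thesis by (simp add: Ti_def h_def single_diff algebra_simps)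
qed

lemma g0_XT: "g0 - lX 1 * T g0 \<in> Ker"
proof -
  have "\<psi> (lX 1 * T g0) = t2 \<odot>\<^bsub>W\<^esub> (inverse t2 \<odot>\<^bsub>W\<^esub> \<psi> g0)"
    unfolding W.\<phi>_X W.\<phi>_T \<psi>_g0 \<delta>_z0(4) W.V.op_smult(1)[OF \<delta>_z0(1)] \<delta>_z0(3) ..
  also have "\<dots> = \<psi> g0" using t2_nz by (simp only: W.V.smult_smult[OF W.\<phi>_closed] right_inverse[OF t2_nz] W.V.smult_one[OF W.\<phi>_closed])
  finally show ?thesis unfolding W.\<phi>_eq_iff[symmetric] by simp
qed

text \<open>A lift to Laurent polynomials, because the map on functions is well defined only once
  the lift is known to preserve the kernel. The rules for X are exact; those for the other operators
  hold modulo the kernel, where \<open>g0\<close> becomes the delta function.\<close>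

definition \<Theta> :: "'k laurent \<Rightarrow> 'k laurent" where "\<Theta> f = Ybar.act f g0"

lemma \<Theta>_simps: "\<Theta> (f + g) = \<Theta> f + \<Theta> g" "\<Theta> (lC c * f) = lC (bar c) * \<Theta> f" "\<Theta> (lX 1 * f) = Y (\<Theta> f)"
  "\<Theta> (lX (-1) * f) = Yi (\<Theta> f)" "\<Theta> (lC c) = lC (bar c) * g0" "\<Theta> (f - g) = \<Theta> f - \<Theta> g"
  by (simp_all add: \<Theta>_def Ybar.act_add_left Ybar.act_smult_left Ybar.act_X Ybar.act_Xi Ybar.act_const Ybar.act_minus_left)

lemma \<Theta>_0: "\<Theta> 0 = 0" using \<Theta>_simps(6)[of 0 0] by simp

lemma Y_minus: "Y (f - g) = Y f - Y g" using Y_add[of "f - g" g] by simp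
lemma Yi_minus: "Yi (f - g) = Yi f - Yi g" using Yi_add[of "f - g" g] by simp

lemmas pK = W.polsub_Ker

text \<open>The base case is the eigenvalue of T on the delta function. In the inductive steps bar h
  = - h turns the exchange rules of T with X into those of T^(-1) with Y.\<close>

lemma \<Theta>_T: "\<Theta> (T f) - Ti (\<Theta> f) \<in> Ker"
proof (induction f rule: laurent_induct)
  case (const c)
  have "\<Theta> (T (lC c)) - Ti (\<Theta> (lC c)) = - (lC (bar c) * (Ti g0 - lC (inverse t2) * g0))"
    by (simp add: T_const \<Theta>_simps bar_mult bar_t2 Ti_smult right_diff_distrib lC_lC mult.commute[of "inverse t2" "bar c"])
  then show ?case using polsub_uminus[OF pK polsubD(3)[OF pK g0_Ti]] by simp
next
  case (mult_X f)
  have "T (\<Theta> f) = Ti (\<Theta> f) + lC h * \<Theta> f" by (simp add: Ti_def)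
  then have "Ti (Y (\<Theta> f)) = Yi (Ti (\<Theta> f)) + lC h * Yi (\<Theta> f)" by (simp add: Ti_Y Yi_add Yi_smult)
  then have "\<Theta> (T (lX 1 * f)) - Ti (\<Theta> (lX 1 * f)) = Yi (\<Theta> (T f) - Ti (\<Theta> f))"
    by (simp add: T_X \<Theta>_simps bar_h Yi_minus single_uminus)
  then show ?case using polsub_Yi[OF pK mult_X] by simp
next
  case (mult_Xinv f)
  have "Ti (Yi (\<Theta> f)) = Y (Ti (\<Theta> f)) - lC h * Yi (\<Theta> f)" by (simp add: Ti_def[of "Yi (\<Theta> f)"] T_Yi)
  then have "\<Theta> (T (lX (-1) * f)) - Ti (\<Theta> (lX (-1) * f)) = Y (\<Theta> (T f) - Ti (\<Theta> f))"
    by (simp add: T_Xi \<Theta>_simps bar_h Y_minus single_uminus)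
  then show ?case using polsub_Y[OF pK mult_Xinv] by simp
next
  case (add f g)
  have "\<Theta> (T (f + g)) - Ti (\<Theta> (f + g)) = (\<Theta> (T f) - Ti (\<Theta> f)) + (\<Theta> (T g) - Ti (\<Theta> g))"
    by (simp add: T_add \<Theta>_simps Ti_add)
  then show ?case using polsubD(2)[OF pK add] by simp
qed

text \<open>\<epsilon> sends \<pi> = Y T^(-1) to X T, and the base case says that X T fixes the
  delta function.\<close>

lemma \<Theta>_Pi: "\<Theta> (Pi f) - lX 1 * T (\<Theta> f) \<in> Ker"
proof (induction f rule: laurent_induct)
  case (const c)
  have "\<Theta> (Pi (lC c)) - lX 1 * T (\<Theta> (lC c)) = lC (bar c) * (g0 - lX 1 * T g0)"
    by (simp add: Pi_const \<Theta>_simps T_smult right_diff_distrib mult.left_commute)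
  then show ?case using polsubD(3)[OF pK g0_XT] by simp
next
  case (mult_X f)
  have "\<Theta> (Pi (lX 1 * f)) - lX 1 * T (\<Theta> (lX 1 * f)) = lC (inverse (q4\<^sup>2)) * Yi (\<Theta> (Pi f) - lX 1 * T (\<Theta> f))"
    by (simp add: Pi_X \<Theta>_simps XT_Y Yi_minus right_diff_distrib bar_power bar_q4 power_inverse)
  then show ?case using polsubD(3)[OF pK polsub_Yi[OF pK mult_X]] by simp
next
  case (mult_Xinv f)
  have "\<Theta> (Pi (lX (-1) * f)) - lX 1 * T (\<Theta> (lX (-1) * f)) = lC (q4\<^sup>2) * Y (\<Theta> (Pi f) - lX 1 * T (\<Theta> f))"
    by (simp add: Pi_Xi \<Theta>_simps XT_Yi Y_minus right_diff_distrib bar_power bar_inverse bar_q4 power_inverse)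
  then show ?case using polsubD(3)[OF pK polsub_Y[OF pK mult_Xinv]] by simp
next
  case (add f g)
  have "\<Theta> (Pi (f + g)) - lX 1 * T (\<Theta> (f + g)) = (\<Theta> (Pi f) - lX 1 * T (\<Theta> f)) + (\<Theta> (Pi g) - lX 1 * T (\<Theta> g))"
    by (simp add: Pi_add \<Theta>_simps T_add distrib_left)
  then show ?case using polsubD(2)[OF pK add] by simp
qed

lemma Ker_trans: "f - g \<in> Ker \<Longrightarrow> g - k \<in> Ker \<Longrightarrow> f - k \<in> Ker"
  using polsubD(2)[OF pK, of "f - g" "g - k"] by simp

lemma \<Theta>_Ti: "\<Theta> (Ti f) - T (\<Theta> f) \<in> Ker"
proof -
  have "T (\<Theta> (T (Ti f)) - Ti (\<Theta> (Ti f))) \<in> Ker" by (rule polsubD(6)[OF pK \<Theta>_T])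
  from polsub_uminus[OF pK this] show ?thesis by (simp add: T_minus)
qed

lemma \<Theta>_Y: "\<Theta> (Y f) - lX 1 * \<Theta> f \<in> Ker"
proof -
  have "lX 1 * T (\<Theta> (T f) - Ti (\<Theta> f)) \<in> Ker" by (intro polsubD(4,6)[OF pK] \<Theta>_T)
  then have "lX 1 * T (\<Theta> (T f)) - lX 1 * \<Theta> f \<in> Ker" by (simp add: T_minus right_diff_distrib)
  with \<Theta>_Pi[of "T f"] show ?thesis unfolding Y_eq by (rule Ker_trans)
qed

lemma \<Theta>_Yi: "\<Theta> (Yi f) - lX (-1) * \<Theta> f \<in> Ker"
proof -
  have "lX (-1) * (\<Theta> (Y (Yi f)) - lX 1 * \<Theta> (Yi f)) \<in> Ker" by (intro polsubD(5)[OF pK] \<Theta>_Y)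
  from polsub_uminus[OF pK this] show ?thesis by (simp add: right_diff_distrib)
qed

lemma \<Theta>_XT: "\<Theta> (lX 1 * T f) - Pi (\<Theta> f) \<in> Ker"
  using polsub_Y[OF pK \<Theta>_T[of f]] by (simp add: \<Theta>_simps Y_minus Y_eq[of "Ti (\<Theta> f)"])

definition K0 :: "'k laurent set" where "K0 = {f. \<Theta> f \<in> Ker}"

lemma Ker_cong: "f - g \<in> Ker \<Longrightarrow> f \<in> Ker \<longleftrightarrow> g \<in> Ker"
  using polsub_minus[OF pK, of f "f - g"] polsubD(2)[OF pK, of "f - g" g] by auto

lemma polsub_K0: "polsub K0"
  unfolding polsub_def
proof (intro conjI ballI allI)
  show "0 \<in> K0" using polsubD(1)[OF pK] by (simp add: K0_def \<Theta>_0)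
  fix f c assume f: "f \<in> K0"
  then have t: "\<Theta> f \<in> Ker" by (simp add: K0_def)
  show "f + g \<in> K0" if "g \<in> K0" for g using polsubD(2)[OF pK t] that by (simp add: K0_def \<Theta>_simps)
  show "lC c * f \<in> K0" using polsubD(3)[OF pK t] by (simp add: K0_def \<Theta>_simps)
  show "lX 1 * f \<in> K0" using polsub_Y[OF pK t] by (simp add: K0_def \<Theta>_simps)
  show "lX (-1) * f \<in> K0" using polsub_Yi[OF pK t] by (simp add: K0_def \<Theta>_simps)
  show "T f \<in> K0" using Ker_cong[OF \<Theta>_T[of f]] polsub_Ti[OF pK t] by (simp add: K0_def)
  show "Pi f \<in> K0" using Ker_cong[OF \<Theta>_Pi[of f]] polsubD(4)[OF pK polsubD(6)[OF pK t]] by (simp add: K0_def)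
qed

lemma one_notin_K0: "1 \<notin> K0"
proof
  assume "1 \<in> K0"
  then have "g0 \<in> Ker" using \<Theta>_simps(5)[of 1] by (simp add: K0_def)
  then show False using \<delta>_z0(2) unfolding W.Ker_def mem_Collect_eq \<psi>_g0 by blast
qed

text \<open>Each generator applied to an image is again an image, of the element obtained by
  applying the partner under \<epsilon>: Y for X, T^(-1) for T and X T for \<pi>. Irreducibility
  then leaves two possibilities.\<close>

lemma \<Theta>_image_polsub:
  assumes K: "polsub K"
  defines "L \<equiv> {u. \<exists>f\<in>K. u - \<Theta> f \<in> Ker}"
  shows "L = Ker \<or> L = UNIV"
proof (rule W.Ker_maximal[OF irreducible_W])
  show "Ker \<subseteq> L"
  proof
    fix f assume "f \<in> Ker"
    then show "f \<in> L" using polsubD(1)[OF K] by (auto simp: L_def \<Theta>_0 intro!: bexI[of _ 0])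
  qed
  have LI: "u \<in> L" if "f \<in> K" "u - v \<in> Ker" "\<Theta> f - v \<in> Ker" for u v f
  proof -
    have "v - \<Theta> f \<in> Ker" using polsub_uminus[OF pK that(3)] by simp
    then show ?thesis using Ker_trans[OF that(2)] that(1) by (auto simp: L_def)
  qed
  show "polsub L"
    unfolding polsub_def
  proof (intro conjI ballI allI)
    show "0 \<in> L" using \<open>Ker \<subseteq> L\<close> polsubD(1)[OF pK] by blast
    fix u c assume "u \<in> L"
    then obtain f where f: "f \<in> K" "u - \<Theta> f \<in> Ker" by (auto simp: L_def)
    show "u + v \<in> L" if v: "v \<in> L" for v
    proof -
      obtain g where g: "g \<in> K" "v - \<Theta> g \<in> Ker" using v by (auto simp: L_def)
      have "(u - \<Theta> f) + (v - \<Theta> g) \<in> Ker" by (rule polsubD(2)[OF pK f(2) g(2)])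
      then show ?thesis using polsubD(2)[OF K f(1) g(1)] by (auto simp: L_def \<Theta>_simps algebra_simps intro!: bexI[of _ "f + g"])
    qed
    show "lC c * u \<in> L"
      using polsubD(3)[OF K f(1), of "bar c"] polsubD(3)[OF pK f(2), of c]
      by (auto simp: L_def \<Theta>_simps right_diff_distrib intro!: bexI[of _ "lC (bar c) * f"])
    show "lX 1 * u \<in> L"
      by (rule LI[OF polsub_Y[OF K f(1)] _ \<Theta>_Y]) (use polsubD(4)[OF pK f(2)] in \<open>simp add: right_diff_distrib\<close>)
    show "lX (-1) * u \<in> L"
      by (rule LI[OF polsub_Yi[OF K f(1)] _ \<Theta>_Yi]) (use polsubD(5)[OF pK f(2)] in \<open>simp add: right_diff_distrib\<close>)
    show "T u \<in> L"
      by (rule LI[OF polsub_Ti[OF K f(1)] _ \<Theta>_Ti]) (use polsubD(6)[OF pK f(2)] in \<open>simp add: T_minus\<close>)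
    show "Pi u \<in> L"
      by (rule LI[OF polsubD(4)[OF K polsubD(6)[OF K f(1)]] _ \<Theta>_XT]) (use polsubD(7)[OF pK f(2)] in \<open>simp add: Pi_minus\<close>)
  qed
qed

lemma \<Theta>_surj: "\<exists>f. u - \<Theta> f \<in> Ker"
proof -
  have U: "polsub UNIV" by (simp add: polsub_def)
  have "{u. \<exists>f\<in>UNIV. u - \<Theta> f \<in> Ker} \<noteq> Ker"
  proof
    assume e: "{u. \<exists>f\<in>UNIV. u - \<Theta> f \<in> Ker} = Ker"
    have "\<Theta> 1 \<in> {u. \<exists>f\<in>UNIV. u - \<Theta> f \<in> Ker}" using polsubD(1)[OF pK] by (auto intro!: exI[of _ 1])
    then have "\<Theta> 1 \<in> Ker" unfolding e .
    then show False using one_notin_K0 by (simp add: K0_def)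
  qed
  then have "{u. \<exists>f\<in>UNIV. u - \<Theta> f \<in> Ker} = UNIV" using \<Theta>_image_polsub[OF U] by blast
  then show ?thesis by blast
qed

text \<open>The lift is bijective from the quotient by \<open>K0\<close> to the quotient by the
  kernel, which makes \<open>K0\<close> maximal. A preimage of 1 is an eigenvector of X for
  t^(-1/2), as Y 1 = t^(1/2) and bar inverts t. So \<open>K0\<close> satisfies the criterion that
  characterizes the radical.\<close>

lemma K0_eq: "K0 = Ker"
proof -
  obtain g where g: "1 - \<Theta> g \<in> Ker" using \<Theta>_surj by blast
  have "K0 = Rad q4 t2"
  proof (rule polsub_maximal_eq_Rad[OF polsub_K0])
    fix K assume K: "polsub K" "K0 \<subseteq> K"
    show "K = K0 \<or> K = UNIV"
      using \<Theta>_image_polsub[OF K(1)]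
    proof
      assume e: "{u. \<exists>f\<in>K. u - \<Theta> f \<in> Ker} = Ker"
      have "f \<in> K0" if "f \<in> K" for f
      proof -
        have "\<Theta> f \<in> {u. \<exists>f\<in>K. u - \<Theta> f \<in> Ker}" using that polsubD(1)[OF pK] by (auto intro!: bexI[of _ f])
        then show ?thesis unfolding e by (simp add: K0_def)
      qed
      then show ?thesis using K(2) by blast
    next
      assume "{u. \<exists>f\<in>K. u - \<Theta> f \<in> Ker} = UNIV"
      then obtain f where f: "f \<in> K" "\<Theta> 1 - \<Theta> f \<in> Ker" by blast
      then have "1 - f \<in> K" using K(2) by (auto simp: K0_def \<Theta>_simps)
      then have "1 \<in> K" using polsubD(2)[OF K(1) _ f(1), of "1 - f"] by simp
      then have "f \<in> K" for f using polsub_mult[OF K(1), of 1 f] by simp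
      then show ?thesis by blast
    qed
  next
    show "g \<notin> K0"
    proof
      assume "g \<in> K0"
      then have "1 \<in> Ker" using Ker_cong[OF g] by (simp add: K0_def)
      then show False using W.one_notin_Ker[OF irreducible_W] by blast
    qed
    have "lC (inverse (inverse t2)) * (1 - \<Theta> g) - Y (1 - \<Theta> g) \<in> Ker"
      by (intro polsub_minus[OF pK] polsubD(3)[OF pK] polsub_Y[OF pK] g)
    moreover have "\<Theta> ((lX 1 - lC (inverse t2)) * g) = lC (inverse (inverse t2)) * (1 - \<Theta> g) - Y (1 - \<Theta> g)"
      using Y_const[of 1] by (simp add: left_diff_distrib right_diff_distrib \<Theta>_simps bar_inverse bar_t2 Y_minus)
    ultimately show "(lX 1 - lC (inverse t2)) * g \<in> K0" by (simp add: K0_def)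
  qed
  then show ?thesis using Ker_W by simp
qed

definition WE :: "(rat \<Rightarrow> 'k) \<Rightarrow> rat \<Rightarrow> 'k" where "WE v = \<psi> (\<Theta> (SOME f. \<psi> f = v))"

lemma WE_\<psi>: "WE (\<psi> f) = \<psi> (\<Theta> f)"
proof -
  have "\<psi> (SOME g. \<psi> g = \<psi> f) = \<psi> f" by (rule someI[of _ f]) simp
  then have "(SOME g. \<psi> g = \<psi> f) - f \<in> K0" by (simp only: W.\<phi>_eq_iff K0_eq)
  then show ?thesis by (simp only: WE_def W.\<phi>_eq_iff K0_def mem_Collect_eq \<Theta>_simps)
qed

lemma WE_epsilon: "semilinear_map bar W W WE" "bij_betw WE (carrier W) (carrier W)"
  "induces_epsilon W WE" "WE u1 = \<delta> z0"
proof -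
  show "semilinear_map bar W W WE"
    unfolding semilinear_map_def
  proof (intro conjI ballI allI)
    fix u v c assume "u \<in> carrier W" "v \<in> carrier W"
    then obtain f g where fg: "u = \<psi> f" "v = \<psi> g" using W.surj by (metis rangeE)
    show "WE (u \<oplus>\<^bsub>W\<^esub> v) = WE u \<oplus>\<^bsub>W\<^esub> WE v"
      by (simp only: fg W.\<phi>_add[symmetric] WE_\<psi> \<Theta>_simps)
    show "WE (c \<odot>\<^bsub>W\<^esub> v) = bar c \<odot>\<^bsub>W\<^esub> WE v"
      by (simp only: fg W.\<phi>_smult[symmetric] WE_\<psi> \<Theta>_simps)
  qed (rule funcsetI, simp only: WE_def W.\<phi>_closed)
  show "bij_betw WE (carrier W) (carrier W)"
    unfolding bij_betw_def
  proof
    show "inj_on WE (carrier W)"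
    proof (rule inj_onI)
      fix u v assume uv: "u \<in> carrier W" "v \<in> carrier W" "WE u = WE v"
      then obtain f g where fg: "u = \<psi> f" "v = \<psi> g" using W.surj by (metis rangeE)
      have "f - g \<in> K0" using uv(3) by (simp only: fg WE_\<psi> W.\<phi>_eq_iff K0_def mem_Collect_eq \<Theta>_simps)
      then show "u = v" by (simp only: fg W.\<phi>_eq_iff K0_eq)
    qed
    show "WE ` carrier W = carrier W"
    proof
      show "WE ` carrier W \<subseteq> carrier W" by (auto simp only: WE_def W.\<phi>_closed)
      show "carrier W \<subseteq> WE ` carrier W"
      proof
        fix v assume "v \<in> carrier W"
        then obtain g where g: "v = \<psi> g" using W.surj by (metis rangeE)
        obtain f where "g - \<Theta> f \<in> Ker" using \<Theta>_surj by blast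
        then have "v = WE (\<psi> f)" by (simp only: g WE_\<psi> W.\<phi>_eq_iff)
        then show "v \<in> WE ` carrier W" using W.\<phi>_closed by blast
      qed
    qed
  qed
  show "induces_epsilon W WE"
    unfolding induces_epsilon_def
  proof (intro ballI conjI)
    fix v assume "v \<in> carrier W"
    then obtain f where f: "v = \<psi> f" using W.surj by (metis rangeE)
    show "WE (opX W v) = opY W (WE v)" by (simp only: f W.\<phi>_X[symmetric] W.\<phi>_Y[symmetric] WE_\<psi> \<Theta>_simps)
    show "WE (opY W v) = opX W (WE v)"
      unfolding f W.\<phi>_X[symmetric] W.\<phi>_Y[symmetric] WE_\<psi> W.\<phi>_eq_iff by (rule \<Theta>_Y)
    have "opT W = WT" by (rule ext) simp
    then have "op_inv W (opT W) (WE v) = WTi (WE v)" using op_inv_W(3)[of "WE v"] by (simp add: f WE_\<psi>)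
    also have "\<dots> = \<psi> (Ti (\<Theta> f))" by (simp only: f WE_\<psi> \<psi>_Ti)
    also have "\<dots> = \<psi> (\<Theta> (T f))" using W.\<phi>_eq_iff[THEN iffD2, OF \<Theta>_T[of f]] by simp
    also have "\<dots> = WE (opT W v)" by (simp only: f W.\<phi>_T[symmetric] WE_\<psi>)
    finally show "WE (opT W v) = op_inv W (opT W) (WE v)" ..
  qed
  show "WE u1 = \<delta> z0" using WE_\<psi>[of 1] \<Theta>_simps(5)[of 1] by (simp add: u1_eq \<psi>_g0)
qed

lemma tau_epsilon_W: "tau_epsilon_invariant q4 bar W"
proof (rule W.V.tau_epsilon_invariantI[OF q4_nz t2_nz bar schur_W spherical_vector_unique _ _ \<delta>_z0 WG_tau_plus WE_epsilon])
  show "u1 \<in> carrier W" by (simp add: u1_def)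
  have "u1 z0 \<noteq> \<zero>\<^bsub>W\<^esub> z0" using z0_B by (simp add: u1_def)
  then show "u1 \<noteq> \<zero>\<^bsub>W\<^esub>" by metis
qed

lemma perfect_W:
  assumes "X_pseudo_unitary_form bar W F"
  shows "perfect q4 t2 bar W"
proof -
  have "spherical q4 t2 W"
    unfolding spherical_def using W.hom W.surj by (intro exI[of _ \<psi>]) simp
  then show ?thesis
    unfolding perfect_def
    using daha_module_W finite_dim_W irreducible_W tau_epsilon_W assms by blast
qed

end

section \<open>The weights of the invariant form\<close>

text \<open>Here t stands for t^(1/2) and y for q^m. The first two formulas are \<alpha> at 1/x and
  at x for x^2 = t^2 y; the third balances them by the quotient of consecutive weights. The last
  says that this quotient is inverted by y -> 1 / (t^4 y), that is m -> -2k - m.\<close>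

lemma weight_identities:
  fixes t y :: "'a::field"
  assumes "t \<noteq> 0" "y \<noteq> 0"
  shows "(t * inverse (t\<^sup>2 * y) - inverse t) / (inverse (t\<^sup>2 * y) - 1) = t * (1 - y) / (1 - t\<^sup>2 * y)"
    and "(t * (t\<^sup>2 * y) - inverse t) / (t\<^sup>2 * y - 1) = inverse t * (1 - t ^ 4 * y) / (1 - t\<^sup>2 * y)"
    and "y \<noteq> 1 \<Longrightarrow> t * (1 - y) / (1 - t\<^sup>2 * y) * (inverse (t\<^sup>2) * ((1 - t ^ 4 * y) / (1 - y)))
          = inverse t * (1 - t ^ 4 * y) / (1 - t\<^sup>2 * y)"
    and "y \<noteq> 1 \<Longrightarrow> t ^ 4 * y \<noteq> 1 \<Longrightarrow> inverse (t\<^sup>2) * ((1 - t ^ 4 * y) / (1 - y))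
          * (inverse (t\<^sup>2) * ((1 - inverse y) / (1 - inverse (t ^ 4 * y)))) = 1"
proof -
  have 1: "t * inverse (t\<^sup>2 * y) - inverse t = t * (1 - y) * inverse (t\<^sup>2 * y)"
    "inverse (t\<^sup>2 * y) - 1 = (1 - t\<^sup>2 * y) * inverse (t\<^sup>2 * y)"
    using assms by (simp_all add: field_simps power2_eq_square)
  have nz: "inverse (t\<^sup>2 * y) \<noteq> 0" using assms by simp
  show "(t * inverse (t\<^sup>2 * y) - inverse t) / (inverse (t\<^sup>2 * y) - 1) = t * (1 - y) / (1 - t\<^sup>2 * y)"
    unfolding 1 using nz by (rule mult_divide_mult_cancel_right)
  have "t * (t\<^sup>2 * y) - inverse t = - (inverse t * (1 - t ^ 4 * y))" "t\<^sup>2 * y - 1 = - (1 - t\<^sup>2 * y)"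
    using assms by (simp_all add: field_simps power2_eq_square power4_eq_xxxx)
  then show "(t * (t\<^sup>2 * y) - inverse t) / (t\<^sup>2 * y - 1) = inverse t * (1 - t ^ 4 * y) / (1 - t\<^sup>2 * y)"
    by (simp only: minus_divide_divide)
  show "t * (1 - y) / (1 - t\<^sup>2 * y) * (inverse (t\<^sup>2) * ((1 - t ^ 4 * y) / (1 - y)))
          = inverse t * (1 - t ^ 4 * y) / (1 - t\<^sup>2 * y)" if "y \<noteq> 1"
  proof -
    have "1 - y \<noteq> 0" using that by simp
    have "t * (1 - y) / (1 - t\<^sup>2 * y) * (inverse (t\<^sup>2) * ((1 - t ^ 4 * y) / (1 - y)))
        = (t * inverse (t\<^sup>2)) * (1 - t ^ 4 * y) / (1 - t\<^sup>2 * y) * ((1 - y) / (1 - y))" by simp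
    also have "\<dots> = inverse t * (1 - t ^ 4 * y) / (1 - t\<^sup>2 * y)"
      using \<open>1 - y \<noteq> 0\<close> assms(1) by (simp add: power2_eq_square mult.assoc[symmetric])
    finally show ?thesis .
  qed
  show "inverse (t\<^sup>2) * ((1 - t ^ 4 * y) / (1 - y))
          * (inverse (t\<^sup>2) * ((1 - inverse y) / (1 - inverse (t ^ 4 * y)))) = 1" if "y \<noteq> 1" "t ^ 4 * y \<noteq> 1"
  proof -
    have nz: "1 - y \<noteq> 0" "1 - t ^ 4 * y \<noteq> 0" using that by auto
    have c: "u * inverse y / (v * inverse (t ^ 4 * y)) = u / v * t ^ 4" for u v
      using assms by (cases "v = 0") (simp_all add: field_simps)
    have "1 - inverse y = - (1 - y) * inverse y" "1 - inverse (t ^ 4 * y) = - (1 - t ^ 4 * y) * inverse (t ^ 4 * y)"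
      using assms by (simp_all add: field_simps)
    then have "(1 - inverse y) / (1 - inverse (t ^ 4 * y)) = (1 - y) / (1 - t ^ 4 * y) * t ^ 4"
      by (simp only: mult_minus_left minus_divide_divide c)
    then have "inverse (t\<^sup>2) * ((1 - t ^ 4 * y) / (1 - y)) * (inverse (t\<^sup>2) * ((1 - inverse y) / (1 - inverse (t ^ 4 * y))))
        = (inverse (t\<^sup>2) * inverse (t\<^sup>2) * t ^ 4) * ((1 - t ^ 4 * y) / (1 - y) * ((1 - y) / (1 - t ^ 4 * y)))"
      by (simp only: mult_ac)
    also have "inverse (t\<^sup>2) * inverse (t\<^sup>2) * t ^ 4 = 1"
      using assms(1) by (simp add: power2_eq_square power4_eq_xxxx field_simps)
    finally show ?thesis using nz by simp
  qed
qed

context fun_ctx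
begin

lemma q4_powi_4_eq_1_iff: "q4 powi (4 * n) = 1 \<longleftrightarrow> int N dvd n"
  by (simp only: q4_powi_eq_1_iff) simp

text \<open>The quotient of the weights with indices m + 1 and m; its first factor is
  q^(-k).\<close>

definition ratio :: "nat \<Rightarrow> 'k" where
  "ratio m = q4 powi (- 2 * J) * ((1 - q4 powi (4 * (J + int m))) / (1 - q4 powi (4 * int m)))"

abbreviation half_J :: rat where "half_J \<equiv> of_int J / 2"
abbreviation mu :: "nat \<Rightarrow> 'k" where "mu m \<equiv> mu1_value q4 half_J m"

lemma mu_1: "mu 1 = 1" by (simp add: mu1_value_def qpow_def)

lemma mu_Suc: "m \<ge> 1 \<Longrightarrow> mu (Suc m) = mu m * ratio m"
proof -
  assume m: "m \<ge> 1"
  have 1: "qpow q4 (- half_J * (of_nat k - 1)) = q4 powi (- 2 * J * (int k - 1))" for k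
  proof -
    have "4 * (- half_J * (of_nat k - 1)) = (of_int (- 2 * J * (int k - 1)) :: rat)" by (simp add: field_simps)
    then show ?thesis unfolding qpow_def by (simp only: floor_of_int)
  qed
  have 2: "qpow q4 (2 * half_J + of_nat i) = q4 powi (4 * (J + int i))" "qpow q4 (of_nat i) = q4 powi (4 * int i)" for i
  proof -
    have "4 * (2 * half_J + of_nat i) = (of_int (4 * (J + int i)) :: rat)" "4 * of_nat i = (of_int (4 * int i) :: rat)"
      by (simp_all add: algebra_simps)
    then show "qpow q4 (2 * half_J + of_nat i) = q4 powi (4 * (J + int i))" "qpow q4 (of_nat i) = q4 powi (4 * int i)"
      unfolding qpow_def by (simp_all only: floor_of_int)
  qed
  have "{1..Suc m - 1} = insert m {1..m - 1}" using m by auto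
  moreover have "q4 powi (- 2 * J * (int (Suc m) - 1)) = q4 powi (- 2 * J * (int m - 1)) * q4 powi (- 2 * J)"
    using q4_nz by (simp add: algebra_simps flip: power_int_add)
  ultimately show ?thesis using m unfolding mu1_value_def 1 2 ratio_def by simp
qed

lemma one_minus_nz:
  assumes "1 \<le> m" "int m < M"
  shows "1 - q4 powi (4 * (J + int m)) \<noteq> 0" "1 - q4 powi (4 * int m) \<noteq> 0"
  using interior[of "int m"] assms q4_powi_4_eq_1_iff[of "J + int m"] q4_powi_4_eq_1_iff[of "int m"]
  by auto

lemma ratio_nz: "1 \<le> m \<Longrightarrow> int m < M \<Longrightarrow> ratio m \<noteq> 0"
  using one_minus_nz[of m] q4_nz by (simp add: ratio_def)

lemma mu_nz: "1 \<le> m \<Longrightarrow> int m \<le> M \<Longrightarrow> mu m \<noteq> 0"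
proof (induction m rule: dec_induct)
  case base then show ?case using mu_1 by simp
next
  case (step m) then show ?case using mu_Suc[of m] ratio_nz[of m] by simp
qed

text \<open>This is the balance required for adjointness of T: the point
  \<open>pt (J + 2 * int m)\<close> has the weight with index m, its negative the one with index m +
  1.\<close>

lemma a_ratio:
  assumes m: "1 \<le> m" "int m < M"
  shows "a (pt (J + 2 * int m)) = a (pt (- J - 2 * int m)) * ratio m"
proof -
  let ?x = "q4 powi (J + 2 * int m)" and ?y = "q4 powi (4 * int m)"
  have x2: "?x\<^sup>2 = t2\<^sup>2 * ?y" using q4_nz
    by (simp add: t2 power_int_power' algebra_simps flip: power_int_add)
  have "- J - 2 * int m = - (J + 2 * int m)" by simp
  then have ix: "q4 powi (- J - 2 * int m) = inverse ?x" by (simp only: power_int_minus)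
  have t4: "q4 powi (4 * (J + int m)) = t2 ^ 4 * ?y" using q4_nz
    by (simp add: t2 power_int_power' algebra_simps flip: power_int_add)
  have t2': "q4 powi (- 2 * J) = inverse (t2\<^sup>2)"
    by (simp add: t2 power_int_power' mult.commute flip: power_int_minus)
  have y: "?y \<noteq> 0" "?y \<noteq> 1" using one_minus_nz[OF m] q4_nz by auto
  have "a (pt (J + 2 * int m)) = (t2 * (t2\<^sup>2 * ?y) - inverse t2) / (t2\<^sup>2 * ?y - 1)"
    by (simp only: \<alpha>_def e_int x2)
  moreover have "a (pt (- J - 2 * int m)) = (t2 * inverse (t2\<^sup>2 * ?y) - inverse t2) / (inverse (t2\<^sup>2 * ?y) - 1)"
    by (simp only: \<alpha>_def e_int ix power_inverse x2)
  ultimately show ?thesis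
    unfolding ratio_def t4 t2' by (simp only: weight_identities[OF t2_nz y(1)] weight_identities(3)[OF t2_nz y])
qed

lemma sharp_pt: "m > 0 \<Longrightarrow> sharp half_J (int m) = pt (J + 2 * int m)"
  "m > 0 \<Longrightarrow> sharp half_J (1 - int m) = pt (- J - 2 * (int m - 1))"
  by (simp_all add: sharp_def pt_def add_divide_distrib diff_divide_distrib)

lemma pt_inj: "pt u = pt v \<longleftrightarrow> u = v" by (simp add: pt_def)

text \<open>The indices m and 1 - m, which share a weight, are exchanged by the reflection z -> 1/2
  - z. The sign change leads from m to the index -m, whose weight is the next one.\<close>

lemma mu1_properties:
  assumes \<mu>: "is_mu1 q4 half_J B \<mu>"
  shows "\<And>z. z \<in> B \<Longrightarrow> \<mu> z \<noteq> 0" "\<And>z. z \<in> B \<Longrightarrow> \<mu> (1/2 - z) = \<mu> z"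
    "\<And>z. z \<in> B \<Longrightarrow> a z \<noteq> 0 \<Longrightarrow> a z * \<mu> z = a (- z) * \<mu> (- z)"
proof -
  have H: "\<mu> z = mu m" if "m > 0" "z \<in> B" "z = sharp half_J (int m) \<or> z = sharp half_J (1 - int m)" for m z
    using \<mu> that unfolding is_mu1_def by blast
  have \<mu>1: "\<mu> (pt (J + 2 * m)) = mu (nat m)" if "1 \<le> m" "m \<le> M" for m
    by (rule H) (use B_I1[OF that] that sharp_pt(1)[of "nat m"] in simp_all)
  have \<mu>2: "\<mu> (pt (- J - 2 * m)) = mu (nat (m + 1))" if "0 \<le> m" "m < M" for m
    by (rule H) (use B_I2[OF that] that sharp_pt(2)[of "nat (m + 1)"] in simp_all)
  fix z assume z: "z \<in> B"
  show "\<mu> z \<noteq> 0" using z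
  proof (cases rule: B_cases)
    case (1 m) then show ?thesis using \<mu>1 mu_nz[of "nat m"] by simp
  next
    case (2 m) then show ?thesis using \<mu>2 mu_nz[of "nat (m + 1)"] by simp
  qed
  show "\<mu> (1/2 - z) = \<mu> z" using z
  proof (cases rule: B_cases)
    case (1 m)
    have "1/2 - z = pt (- J - 2 * (m - 1))" by (simp add: 1 reflect_pt algebra_simps)
    then show ?thesis using \<mu>1[of m] \<mu>2[of "m - 1"] 1 by simp
  next
    case (2 m)
    have "1/2 - z = pt (J + 2 * (m + 1))" by (simp add: 2 reflect_pt algebra_simps)
    then show ?thesis using \<mu>1[of "m + 1"] \<mu>2[of m] 2 by simp
  qed
  have *: "a (pt (J + 2 * m)) * \<mu> (pt (J + 2 * m)) = a (pt (- J - 2 * m)) * \<mu> (pt (- J - 2 * m))"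
    if "1 \<le> m" "m < M" for m
  proof -
    have n: "nat (m + 1) = Suc (nat m)" using that by simp
    show ?thesis using \<mu>1[of m] \<mu>2[of m] a_ratio[of "nat m"] mu_Suc[of "nat m"] that by (simp add: n)
  qed
  assume az: "a z \<noteq> 0"
  note mz = uminus_B[OF z az]
  show "a z * \<mu> z = a (- z) * \<mu> (- z)" using z
  proof (cases rule: B_cases)
    case (1 m)
    have e: "- z = pt (- J - 2 * m)" by (simp add: 1 uminus_pt algebra_simps)
    have "m \<noteq> M"
    proof
      assume "m = M"
      have "J + (J + 2 * M) = 2 * (J + M)" by simp
      then have "2 * int N dvd J + (J + 2 * M)" using boundary by (simp only: dvd_mult_cancel_left) simp
      then show False using 1 \<open>m = M\<close> a_eq_0_iff[OF B_I1[of M]] M az by simp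
    qed
    then show ?thesis using *[of m] 1 unfolding e by simp
  next
    case (2 m)
    have e: "- z = pt (J + 2 * m)" by (simp add: 2 uminus_pt algebra_simps)
    have "m \<noteq> 0" using 2 a_eq_0_iff[OF B_I2[of 0]] M az by auto
    then show ?thesis using *[of m] 2 unfolding e by simp
  qed
qed

text \<open>A point of \<open>B\<close> has two descriptions only if \<open>J + 2 m = - J - 2 m'\<close>.\<close>

lemma mu1_exists:
  assumes J: "- J \<le> M"
    and cons: "\<And>m m'. 1 \<le> m \<Longrightarrow> m \<le> M \<Longrightarrow> 0 \<le> m' \<Longrightarrow> m' < M \<Longrightarrow> J + 2 * m = - J - 2 * m' \<Longrightarrow> mu (nat m) = mu (nat (m' + 1))"
  shows "\<exists>\<mu>. is_mu1 q4 half_J B \<mu>"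
proof -
  \<comment> \<open>The floor recovers the numerator of z, and from it the index. Points with both
    descriptions get the value of the first one.\<close>
  define \<mu> where "\<mu> z = (if \<exists>m. 1 \<le> m \<and> m \<le> M \<and> z = pt (J + 2 * m) then mu (nat ((\<lfloor>4 * z\<rfloor> - J) div 2))
      else mu (nat ((- J - \<lfloor>4 * z\<rfloor>) div 2 + 1)))" for z
  have f: "\<lfloor>4 * pt u\<rfloor> = u" for u by (simp add: pt_def)
  have \<mu>1: "\<mu> (pt (J + 2 * m)) = mu (nat m)" if "1 \<le> m" "m \<le> M" for m
    using that by (auto simp: \<mu>_def f)
  have \<mu>2: "\<mu> (pt (- J - 2 * m)) = mu (nat (m + 1))" if m: "0 \<le> m" "m < M" for m
  proof (cases "\<exists>m'. 1 \<le> m' \<and> m' \<le> M \<and> pt (- J - 2 * m) = pt (J + 2 * m')")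
    case True
    then obtain m' where m': "1 \<le> m'" "m' \<le> M" "pt (- J - 2 * m) = pt (J + 2 * m')" by blast
    then have "J + 2 * m' = - J - 2 * m" by (simp only: pt_inj)
    then have "mu (nat m') = mu (nat (m + 1))" using cons m m' by blast
    then show ?thesis using \<mu>1[OF m'(1,2)] m'(3) by simp
  next
    case False
    then show ?thesis unfolding \<mu>_def f by (simp only: if_not_P) simp
  qed
  have "is_mu1 q4 half_J B \<mu>"
    unfolding is_mu1_def
  proof (intro allI impI ballI)
    fix m :: nat and z assume m: "m > 0" and z: "z \<in> B" and "z = sharp half_J (int m) \<or> z = sharp half_J (1 - int m)"
    then consider "z = pt (J + 2 * int m)" | "z = pt (- J - 2 * (int m - 1))" by (auto simp only: sharp_pt)
    then show "\<mu> z = mu m"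
    proof cases
      case 1
      \<comment> \<open>The defining condition runs over all m. If z also lies in the second family,
        its two descriptions give m = - J - m', and \<open>- J \<le> M\<close> keeps m in
        range.\<close>
      have "int m \<le> M" using z
      proof (cases rule: B_cases)
        case (1 m') then show ?thesis using \<open>z = pt (J + 2 * int m)\<close> by (simp add: pt_inj)
      next
        case (2 m') 
        then have "J + 2 * int m = - J - 2 * m'" using \<open>z = pt (J + 2 * int m)\<close> by (simp only: pt_inj)
        then show ?thesis using J 2(1,2) by linarith
      qed
      then show ?thesis using \<mu>1[of "int m"] m 1 by simp
    next
      case 2
      have "int m - 1 < M" using z
      proof (cases rule: B_cases)
        case (1 m') 
        then have "J + 2 * m' = - J - 2 * (int m - 1)" using \<open>z = pt (- J - 2 * (int m - 1))\<close> by (simp only: pt_inj)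
        then have "int m - 1 = - J - m'" by simp
        then show ?thesis using J 1(1) by linarith
      next
        case (2 m') then show ?thesis using \<open>z = pt (- J - 2 * (int m - 1))\<close> by (simp add: pt_inj)
      qed
      then show ?thesis using \<mu>2[of "int m - 1"] m 2 by simp
    qed
  qed
  then show ?thesis by blast
qed

lemma ratio_mult:
  assumes "1 \<le> m" "1 \<le> m'" "int m + int m' = - J" "- J = M"
  shows "ratio m * ratio m' = 1"
proof -
  let ?y = "q4 powi (4 * int m)"
  note nz = one_minus_nz[of m] one_minus_nz[of m']
  have t4: "q4 powi (4 * (J + int m)) = t2 ^ 4 * ?y" using q4_nz
    by (simp add: t2 power_int_power' algebra_simps flip: power_int_add)
  have "4 * (J + int m') = - (4 * int m)" "4 * int m' = - (4 * (J + int m))" using assms by simp_all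
  then have y': "q4 powi (4 * (J + int m')) = inverse ?y" "q4 powi (4 * int m') = inverse (t2 ^ 4 * ?y)"
    by (simp_all only: power_int_minus t4)
  have t2': "q4 powi (- 2 * J) = inverse (t2\<^sup>2)"
    by (simp add: t2 power_int_power' mult.commute flip: power_int_minus)
  have y: "?y \<noteq> 0" "?y \<noteq> 1" "t2 ^ 4 * ?y \<noteq> 1" using nz q4_nz assms by (auto simp flip: t4)
  show ?thesis
    unfolding ratio_def y' t4 t2' by (rule weight_identities(4)[OF t2_nz y])
qed

text \<open>In case (b) every point has two indices, with sum 2n + 2, and both must give the same
  weight. Starting in the middle at n + 1, the quotients met on the two sides are inverse to each
  other.\<close>

lemma mu_symmetric:
  assumes n: "J = - 1 - 2 * int n" "M = 2 * int n + 1" and m: "1 \<le> m" "1 \<le> m'" "m + m' = 2 * n + 2"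
  shows "mu m = mu m'"
proof -
  have *: "i \<le> n \<Longrightarrow> mu (n + 1 + i) = mu (n + 1 - i)" for i
  proof (induction i)
    case (Suc i)
    have r: "ratio (n + 1 + i) * ratio (n - i) = 1" by (rule ratio_mult) (use Suc n in auto)
    have "mu (n + 1 + Suc i) = mu (n + 1 + i) * ratio (n + 1 + i)" using mu_Suc[of "n + 1 + i"] by simp
    also have "mu (n + 1 + i) = mu (n + 1 - i)" using Suc by simp
    also have "n + 1 - i = Suc (n - i)" using Suc by simp
    also have "mu (Suc (n - i)) = mu (n - i) * ratio (n - i)" by (rule mu_Suc) (use Suc in simp)
    finally show ?case using r by (simp add: mult_ac)
  qed simp
  show ?thesis
  proof (cases "m \<le> n + 1")
    case True
    define i where "i = n + 1 - m"
    have "m = n + 1 - i" "m' = n + 1 + i" "i \<le> n" using True m by (auto simp: i_def)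
    then show ?thesis using *[of i] by simp
  next
    case False
    define i where "i = m - (n + 1)"
    have "m' = n + 1 - i" "m = n + 1 + i" "i \<le> n" using False m by (auto simp: i_def)
    then show ?thesis using *[of i] by simp
  qed
qed

lemma quotient_by_Rad:
  assumes "\<exists>\<mu>. is_mu1 q4 half_J B \<mu>"
  shows "perfect q4 t2 bar (quot_rep (pol_rep q4 t2) (Rad q4 t2))"
    and "daha_module q4 t2 (quot_rep (pol_rep q4 t2) (Rad q4 t2))"
    and "daha_iso (quot_rep (pol_rep q4 t2) (Rad q4 t2)) (fun_rep q4 t2 B)"
    and "\<exists>\<mu>. is_mu1 q4 half_J B \<mu> \<and> X_pseudo_unitary_form bar (fun_rep q4 t2 B) (fun_form bar B \<mu>) \<and>
             (\<forall>F. star_form bar (fun_rep q4 t2 B) F \<longrightarrow>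
                (\<exists>c. \<forall>f\<in>carrier (fun_rep q4 t2 B). \<forall>g\<in>carrier (fun_rep q4 t2 B).
                   F f g = c * fun_form bar B \<mu> f g))"
proof -
  obtain \<mu> where \<mu>: "is_mu1 q4 half_J B \<mu>" using assms by blast
  note p = mu1_properties[OF \<mu>]
  show q: "daha_module q4 t2 (quot_rep (pol_rep q4 t2) (Rad q4 t2))"
    and i: "daha_iso (quot_rep (pol_rep q4 t2) (Rad q4 t2)) W"
    using W.quot_iso by (simp_all add: Ker_W)
  have pu: "X_pseudo_unitary_form bar W (fun_form bar B \<mu>)" by (rule pseudo_unitary[OF p])
  show "perfect q4 t2 bar (quot_rep (pol_rep q4 t2) (Rad q4 t2))"
    by (rule perfect_iso[OF t2_nz perfect_W[OF pu] q daha_iso_sym[OF q daha_module_W i]])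
  show "\<exists>\<mu>. is_mu1 q4 half_J B \<mu> \<and> X_pseudo_unitary_form bar W (fun_form bar B \<mu>) \<and>
             (\<forall>F. star_form bar W F \<longrightarrow> (\<exists>c. \<forall>f\<in>carrier W. \<forall>g\<in>carrier W. F f g = c * fun_form bar B \<mu> f g))"
    using \<mu> pu star_form_unique[OF p] by blast
qed

end

section \<open>The sets of points in the two cases\<close>

lemma int_dvd_small: "int N dvd m \<Longrightarrow> \<bar>m\<bar> < int N \<Longrightarrow> m = 0"
  using dvd_imp_le_int[of m "int N"] by auto

context daha_root
begin

lemma fun_ctx_a:
  assumes bar: "bar_involution q4 t2 bar" and k: "half_int_exponent q4 t2 k" "0 < k" "k < of_nat N / 2"
  obtains J M where "2 * k = of_int J" "0 < J" "fun_ctx q4 t2 N bar J M (bowtie_a N k)"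
proof -
  obtain J where J: "2 * k = of_int J" "t2 = q4 powi J" using k(1) by (auto simp: half_int_exponent_iff)
  have kJ: "k = of_int J / 2" using J(1) by simp
  have "(0 :: rat) < of_int J" using k(2) J(1) by simp
  then have J0: "0 < J" by simp
  have "(of_int J :: rat) < of_int (int N)" using k(3) J(1) by simp
  then have JN: "J < int N" by (simp only: of_int_less_iff)
  \<comment> \<open>The first positive m for which N divides J + m, since 0 < J < N.\<close>
  define M where "M = int N - J"
  have Bset: "bowtie_a N k = pt ` ((\<lambda>m. J + 2 * m) ` {1..M} \<union> (\<lambda>m. - J - 2 * m) ` {0..<M})"
  proof -
    have 1: "{(k + of_nat i) / 2 | i::nat. 1 \<le> i \<and> (k + of_nat i) / 2 \<le> (of_nat N - k) / 2} = pt ` (\<lambda>m. J + 2 * m) ` {1..M}"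
    proof (intro equalityI subsetI)
      fix z assume "z \<in> {(k + of_nat i) / 2 | i::nat. 1 \<le> i \<and> (k + of_nat i) / 2 \<le> (of_nat N - k) / 2}"
      then obtain i :: nat where i: "z = (k + of_nat i) / 2" "1 \<le> i" "(k + of_nat i) / 2 \<le> (of_nat N - k) / 2" by blast
      have "of_int (int i) \<le> (of_int M :: rat)" using i(3) J(1) unfolding divide_le_cancel
        by (simp add: M_def)
      then have "int i \<le> M" by (simp only: of_int_le_iff)
      moreover have "z = pt (J + 2 * int i)" by (simp add: i kJ pt_def add_divide_distrib diff_divide_distrib)
      ultimately show "z \<in> pt ` (\<lambda>m. J + 2 * m) ` {1..M}" using i(2) by (simp add: image_image)
    next
      fix z assume "z \<in> pt ` (\<lambda>m. J + 2 * m) ` {1..M}"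
      then obtain m where m: "z = pt (J + 2 * m)" "1 \<le> m" "m \<le> M" by auto
      define i where "i = nat m"
      have i: "m = int i" using m by (simp add: i_def)
      have "(of_int (int i) :: rat) \<le> of_int M" using m i by (simp only: of_int_le_iff)
      then have "z = (k + of_nat i) / 2" "1 \<le> i" "(k + of_nat i) / 2 \<le> (of_nat N - k) / 2"
        using m unfolding i divide_le_cancel
        by (simp_all add: kJ pt_def M_def add_divide_distrib diff_divide_distrib)
      then show "z \<in> {(k + of_nat i) / 2 | i::nat. 1 \<le> i \<and> (k + of_nat i) / 2 \<le> (of_nat N - k) / 2}" by blast
    qed
    have 2: "{(k - of_nat N + of_nat i) / 2 | i::nat. 1 \<le> i \<and> (k - of_nat N + of_nat i) / 2 \<le> - k / 2} = pt ` (\<lambda>m. - J - 2 * m) ` {0..<M}"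
    proof (intro equalityI subsetI)
      fix z assume "z \<in> {(k - of_nat N + of_nat i) / 2 | i::nat. 1 \<le> i \<and> (k - of_nat N + of_nat i) / 2 \<le> - k / 2}"
      then obtain i :: nat where i: "z = (k - of_nat N + of_nat i) / 2" "1 \<le> i" "(k - of_nat N + of_nat i) / 2 \<le> - k / 2" by blast
      have "of_int (int i) \<le> (of_int M :: rat)" using i(3) J(1) unfolding divide_le_cancel
        by (simp add: M_def)
      then have "int i \<le> M" by (simp only: of_int_le_iff)
      \<comment> \<open>This half of the set is listed from the left, whereas the path runs from
        right to left; hence the reversed index.\<close>
      moreover have "z = pt (- J - 2 * (M - int i))" by (simp add: i kJ pt_def M_def add_divide_distrib diff_divide_distrib)
      ultimately show "z \<in> pt ` (\<lambda>m. - J - 2 * m) ` {0..<M}"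
        using i(2) by (simp only:) (intro imageI, simp)
    next
      fix z assume "z \<in> pt ` (\<lambda>m. - J - 2 * m) ` {0..<M}"
      then obtain m where m: "z = pt (- J - 2 * m)" "0 \<le> m" "m < M" by auto
      define i where "i = nat (M - m)"
      have i: "m = M - int i" using m by (simp add: i_def)
      have "(0 :: rat) \<le> of_int (M - int i)" using m i by simp
      then have "z = (k - of_nat N + of_nat i) / 2" "1 \<le> i" "(k - of_nat N + of_nat i) / 2 \<le> - k / 2"
        using m unfolding i divide_le_cancel
        by (simp_all add: kJ pt_def M_def add_divide_distrib diff_divide_distrib)
      then show "z \<in> {(k - of_nat N + of_nat i) / 2 | i::nat. 1 \<le> i \<and> (k - of_nat N + of_nat i) / 2 \<le> - k / 2}" by blast
    qed
    show ?thesis unfolding bowtie_a_def 1 2 image_Un by (rule Un_commute)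
  qed
  have "fun_ctx q4 t2 N bar J M (bowtie_a N k)"
  proof unfold_locales
    show "bar_involution q4 t2 bar" by (rule bar)
    show "t2 = q4 powi J" by (rule J)
    show "1 \<le> M" using JN by (simp add: M_def)
    show "bowtie_a N k = pt ` ((\<lambda>m. J + 2 * m) ` {1..M} \<union> (\<lambda>m. - J - 2 * m) ` {0..<M})" by (rule Bset)
    show "\<not> int N dvd m \<and> \<not> int N dvd J + m" if "1 \<le> m" "m < M" for m
      using int_dvd_small[of N m] int_dvd_small[of N "J + m"] that J0 by (auto simp: M_def)
    show "int N dvd J + M" by (simp add: M_def)
    show "\<not> 2 * int N dvd J + 2 * m" if "0 \<le> m" "m \<le> M" for m
      using int_dvd_small[of "2 * N" "J + 2 * m"] that J0 by (auto simp: M_def)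
    show "u = v" if "pt u \<in> bowtie_a N k" "pt v \<in> bowtie_a N k" "4 * int N dvd u - v" for u v
    proof -
      \<comment> \<open>Two numerators differ by at most 4N - 2J, which is below 4N because J is
        positive.\<close>
      have "\<bar>w\<bar> \<le> 2 * int N - J" if "pt w \<in> bowtie_a N k" for w
        using that J0 JN unfolding Bset by (auto simp: pt_def M_def)
      from this[OF that(1)] this[OF that(2)] have "\<bar>u - v\<bar> < int (4 * N)" using J0 by simp
      then show ?thesis using int_dvd_small[of "4 * N" "u - v"] that(3) by simp
    qed
  qed
  then show ?thesis using that J J0 by blast
qed

lemma fun_ctx_b:
  assumes bar: "bar_involution q4 t2 bar" and k: "half_int_exponent q4 t2 k" "k = - 1/2 - of_nat n" "of_nat n < (of_nat N / 2 :: rat)"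
  shows "fun_ctx q4 t2 N bar (- 1 - 2 * int n) (2 * int n + 1) (bowtie_b n)"
proof -
  obtain J where J: "2 * k = of_int J" "t2 = q4 powi J" using k(1) by (auto simp: half_int_exponent_iff)
  have "(of_int J :: rat) = of_int (- 1 - 2 * int n)" using J(1) k(2) by simp
  then have Jn: "J = - 1 - 2 * int n" by (simp only: of_int_eq_iff)
  have "(of_nat (2 * n) :: rat) < of_nat N" using k(3) by simp
  then have nN: "2 * n < N" by (simp only: of_nat_less_iff)
  let ?M = "2 * int n + 1"
  have 1: "bowtie_b n = pt ` (\<lambda>m. J + 2 * m) ` {1..?M}"
  proof (intro equalityI subsetI)
    fix z assume "z \<in> bowtie_b n"
    then obtain i :: nat where i: "z = (1/2 - of_nat n + of_nat i) / 2" "(1/2 - of_nat n + of_nat i) / 2 \<le> (1/2 + of_nat n) / (2 :: rat)"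
      unfolding bowtie_b_def by blast
    have "(of_nat i :: rat) \<le> of_nat (2 * n)" using i(2) unfolding divide_le_cancel by simp
    then have "i \<le> 2 * n" by (simp only: of_nat_le_iff)
    moreover have "z = pt (J + 2 * (int i + 1))" by (simp add: i Jn pt_def add_divide_distrib diff_divide_distrib)
    ultimately show "z \<in> pt ` (\<lambda>m. J + 2 * m) ` {1..?M}" by (simp only:) (intro imageI, simp)
  next
    fix z assume "z \<in> pt ` (\<lambda>m. J + 2 * m) ` {1..?M}"
    then obtain m where m: "z = pt (J + 2 * m)" "1 \<le> m" "m \<le> ?M" by auto
    define i where "i = nat (m - 1)"
    have i: "m = int i + 1" using m by (simp add: i_def)
    have "(of_int (int i) :: rat) \<le> of_int (2 * int n)" using m i by (simp only: of_int_le_iff)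
    then have "z = (1/2 - of_nat n + of_nat i) / 2" "(1/2 - of_nat n + of_nat i) / 2 \<le> (1/2 + of_nat n) / (2 :: rat)"
      using m unfolding i divide_le_cancel
      by (simp_all add: Jn pt_def add_divide_distrib diff_divide_distrib)
    then show "z \<in> bowtie_b n" unfolding bowtie_b_def by blast
  qed
  \<comment> \<open>Here \<open>- J - 2 * m\<close> equals \<open>J + 2 * (- J - m)\<close>, so the
    second family only repeats points of the first.\<close>
  have 2: "(\<lambda>m. - J - 2 * m) ` {0..<?M} \<subseteq> (\<lambda>m. J + 2 * m) ` {1..?M}"
  proof
    fix u assume "u \<in> (\<lambda>m. - J - 2 * m) ` {0..<?M}"
    then obtain m where "u = - J - 2 * m" "0 \<le> m" "m < ?M" by auto
    then show "u \<in> (\<lambda>m. J + 2 * m) ` {1..?M}" by (intro image_eqI[of _ _ "- J - m"]) (auto simp: Jn)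
  qed
  have Bset: "bowtie_b n = pt ` ((\<lambda>m. J + 2 * m) ` {1..?M} \<union> (\<lambda>m. - J - 2 * m) ` {0..<?M})"
    unfolding 1 using 2 by (simp only: Un_absorb2)
  have "fun_ctx q4 t2 N bar J ?M (bowtie_b n)"
  proof unfold_locales
    show "bar_involution q4 t2 bar" by (rule bar)
    show "t2 = q4 powi J" by (rule J)
    show "1 \<le> ?M" by simp
    show "bowtie_b n = pt ` ((\<lambda>m. J + 2 * m) ` {1..?M} \<union> (\<lambda>m. - J - 2 * m) ` {0..<?M})" by (rule Bset)
    show "\<not> int N dvd m \<and> \<not> int N dvd J + m" if "1 \<le> m" "m < ?M" for m
      using int_dvd_small[of N m] int_dvd_small[of N "J + m"] that nN by (auto simp: Jn)
    show "int N dvd J + ?M" by (simp add: Jn)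
    \<comment> \<open>Parity alone suffices, since J is odd.\<close>
    show "\<not> 2 * int N dvd J + 2 * m" if "0 \<le> m" "m \<le> ?M" for m
    proof
      assume "2 * int N dvd J + 2 * m"
      then have "even (J + 2 * m)" using dvd_mult_left by blast
      then show False by (simp add: Jn)
    qed
    show "u = v" if "pt u \<in> bowtie_b n" "pt v \<in> bowtie_b n" "4 * int N dvd u - v" for u v
    proof -
      have "\<bar>w\<bar> \<le> 2 * int n + 1" if "pt w \<in> bowtie_b n" for w
        using that unfolding 1 by (auto simp: pt_def Jn)
      from this[OF that(1)] this[OF that(2)] have "\<bar>u - v\<bar> < int (4 * N)" using nN by simp
      then show ?thesis using int_dvd_small[of "4 * N" "u - v"] that(3) by simp
    qed
  qed
  then show ?thesis by (simp add: Jn)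
qed

lemma perfect_sufficient:
  fixes B :: "rat set"
  assumes bar: "bar_involution q4 t2 bar" and k: "half_int_exponent q4 t2 k"
    and B: "0 < k \<and> k < of_nat N / 2 \<and> B = bowtie_a N k \<or>
      (\<exists>n::nat. k = - 1/2 - of_nat n \<and> of_nat n < (of_nat N / 2 :: rat) \<and> B = bowtie_b n)"
  shows "perfect q4 t2 bar (quot_rep (pol_rep q4 t2) (Rad q4 t2))"
    and "daha_module q4 t2 (quot_rep (pol_rep q4 t2) (Rad q4 t2))"
    and "daha_iso (quot_rep (pol_rep q4 t2) (Rad q4 t2)) (fun_rep q4 t2 B)"
    and "\<exists>\<mu>. is_mu1 q4 k B \<mu> \<and> X_pseudo_unitary_form bar (fun_rep q4 t2 B) (fun_form bar B \<mu>) \<and>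
             (\<forall>F. star_form bar (fun_rep q4 t2 B) F \<longrightarrow>
                (\<exists>c. \<forall>f\<in>carrier (fun_rep q4 t2 B). \<forall>g\<in>carrier (fun_rep q4 t2 B).
                   F f g = c * fun_form bar B \<mu> f g))"
proof -
  obtain J M where J: "k = of_int J / 2" and ctx: "fun_ctx q4 t2 N bar J M B"
    and \<mu>: "\<exists>\<mu>. is_mu1 q4 (of_int J / 2) B \<mu>"
    using B
  proof (elim disjE exE conjE)
    assume a: "0 < k" "k < of_nat N / 2" "B = bowtie_a N k"
    obtain J M where J: "2 * k = of_int J" "0 < J" and ctx: "fun_ctx q4 t2 N bar J M (bowtie_a N k)"
      using fun_ctx_a[OF bar k a(1,2)] by blast
    interpret fun_ctx q4 t2 N bar J M B using ctx a(3) by simp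
    \<comment> \<open>For positive J no point has two descriptions, so consistency is
      vacuous.\<close>
    have "\<exists>\<mu>. is_mu1 q4 (of_int J / 2) B \<mu>"
      by (rule mu1_exists) (use J(2) M in auto)
    moreover have "k = of_int J / 2" using J(1) by simp
    ultimately show thesis using that fun_ctx_axioms by blast
  next
    fix n :: nat assume b: "k = - 1/2 - of_nat n" "of_nat n < (of_nat N / 2 :: rat)" "B = bowtie_b n"
    interpret fun_ctx q4 t2 N bar "- 1 - 2 * int n" "2 * int n + 1" B
      using fun_ctx_b[OF bar k b(1,2)] b(3) by simp
    have "\<exists>\<mu>. is_mu1 q4 (of_int (- 1 - 2 * int n) / 2) B \<mu>"
    proof (rule mu1_exists)
      fix m m' assume m: "1 \<le> m" "m \<le> 2 * int n + 1" "0 \<le> m'" "m' < 2 * int n + 1"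
        "- 1 - 2 * int n + 2 * m = - (- 1 - 2 * int n) - 2 * m'"
      then have "nat m + nat (m' + 1) = 2 * n + 2" by linarith
      then show "mu (nat m) = mu (nat (m' + 1))"
        using m by (intro mu_symmetric[of n]) simp_all
    qed simp
    moreover have "k = of_int (- 1 - 2 * int n) / 2" by (simp add: b(1) diff_divide_distrib)
    ultimately show thesis using that fun_ctx_axioms by blast
  qed
  interpret fun_ctx q4 t2 N bar J M B by (rule ctx)
  show "perfect q4 t2 bar (quot_rep (pol_rep q4 t2) (Rad q4 t2))"
    "daha_module q4 t2 (quot_rep (pol_rep q4 t2) (Rad q4 t2))"
    "daha_iso (quot_rep (pol_rep q4 t2) (Rad q4 t2)) (fun_rep q4 t2 B)"
    "\<exists>\<mu>. is_mu1 q4 k B \<mu> \<and> X_pseudo_unitary_form bar (fun_rep q4 t2 B) (fun_form bar B \<mu>) \<and>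
             (\<forall>F. star_form bar (fun_rep q4 t2 B) F \<longrightarrow>
                (\<exists>c. \<forall>f\<in>carrier (fun_rep q4 t2 B). \<forall>g\<in>carrier (fun_rep q4 t2 B).
                   F f g = c * fun_form bar B \<mu> f g))"
    using quotient_by_Rad[OF \<mu>] by (simp_all add: J)
qed

end

text \<open>If \<open>t2 = - 1\<close>, the exponent would be \<open>k = N\<close>, outside the normalized range.\<close>

lemma t2_sq_neq_1:
  fixes q4 t2 :: "'k::field_char_0"
  assumes N: "N \<ge> 1" and prim: "prim_root_of_unity (2 * N) (q4 ^ 2)"
    and norm: "\<And>k. half_int_exponent q4 t2 k \<Longrightarrow>
           \<exists>k'. half_int_exponent q4 t2 k' \<and> - of_nat N / 2 \<le> k' \<and> k' < of_nat N / 2"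
    and t2: "t2 \<noteq> 1"
  shows "t2\<^sup>2 \<noteq> 1"
proof
  assume "t2\<^sup>2 = 1"
  then have m1: "t2 = - 1" using t2 by (simp add: power2_eq_1_iff)
  have p1: "q4 powi n = 1 \<longleftrightarrow> 4 * int N dvd n" for n
    using prim_root_of_unity_powi[OF prim_root_of_unity_sqrt[OF prim]] by simp
  have q4: "q4 \<noteq> 0" using prim N by (auto simp: prim_root_of_unity_def power_0_left)
  have "q4 ^ (4 * N) = 1" using p1[of "int (4 * N)"] unfolding power_int_of_nat by simp
  then have "(q4 ^ (2 * N))\<^sup>2 = 1" by (simp flip: power_mult add: mult.commute)
  moreover have "q4 powi int (2 * N) \<noteq> 1"
    using p1[of "int (2 * N)"] N zdvd_imp_le[of "4 * int N" "2 * int N"] by auto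
  then have "q4 ^ (2 * N) \<noteq> 1" unfolding power_int_of_nat .
  ultimately have 2: "q4 ^ (2 * N) = - 1" by (simp add: power2_eq_1_iff)
  have "t2 = q4 powi int (2 * N)" unfolding m1 power_int_of_nat 2 ..
  then have "half_int_exponent q4 t2 (of_nat N)" unfolding half_int_exponent_iff by (intro exI[of _ "int (2 * N)"]) simp
  then obtain k where k: "half_int_exponent q4 t2 k" "- of_nat N / 2 \<le> k" "k < of_nat N / 2" using norm by blast
  obtain J where J: "2 * k = of_int J" "t2 = q4 powi J" using k(1) unfolding half_int_exponent_iff by blast
  have "(of_int (- int N) :: rat) \<le> of_int J" "(of_int J :: rat) < of_int (int N)" using k(2,3) J(1) by simp_all
  then have JN: "- int N \<le> J" "J < int N" by (simp_all only: of_int_le_iff of_int_less_iff)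
  have "q4 powi (J - int (2 * N)) = q4 powi J / q4 powi int (2 * N)" using q4 by (intro power_int_diff) simp
  then have "q4 powi (J - int (2 * N)) = 1" by (simp only: power_int_of_nat 2 J(2)[symmetric] m1) simp
  then have "int (4 * N) dvd J - int (2 * N)" by (simp add: p1)
  from int_dvd_small[OF this] show False using JN N by simp
qed

theorem theorem9p7:
  fixes q4 t2 :: "'k::field_char_0" and bar :: "'k \<Rightarrow> 'k" and N :: nat
    and V :: "('k, 'v) daha_rep"
  assumes "N \<ge> 1"
    and "prim_root_of_unity (2 * N) (q4 ^ 2)"
    and "t2 \<noteq> 0"
    and "bar_involution q4 t2 bar"
    and normalization: "\<And>k. half_int_exponent q4 t2 k \<Longrightarrow>
           \<exists>k'. half_int_exponent q4 t2 k' \<and> - of_nat N / 2 \<le> k' \<and> k' < of_nat N / 2"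
    and "t2 \<noteq> 1"
  shows
    "(perfect q4 t2 bar V \<longleftrightarrow>
        (\<exists>k. half_int_exponent q4 t2 k \<and>
             (0 < k \<and> k < of_nat N / 2 \<or>
              (\<exists>n::nat. k = - 1/2 - of_nat n \<and> of_nat n < (of_nat N / 2 :: rat)))) \<and>
        daha_module q4 t2 V \<and>
        daha_iso (quot_rep (pol_rep q4 t2) (Rad q4 t2)) V)
     \<and>
     (\<forall>k B. half_int_exponent q4 t2 k \<and>
        (0 < k \<and> k < of_nat N / 2 \<and> B = bowtie_a N k \<or>
         (\<exists>n::nat. k = - 1/2 - of_nat n \<and> of_nat n < (of_nat N / 2 :: rat) \<and> B = bowtie_b n)) \<longrightarrow>
        perfect q4 t2 bar (quot_rep (pol_rep q4 t2) (Rad q4 t2)) \<and>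
        daha_iso (quot_rep (pol_rep q4 t2) (Rad q4 t2)) (fun_rep q4 t2 B) \<and>
        (\<exists>\<mu>. is_mu1 q4 k B \<mu> \<and>
             X_pseudo_unitary_form bar (fun_rep q4 t2 B) (fun_form bar B \<mu>) \<and>
             (\<forall>F. star_form bar (fun_rep q4 t2 B) F \<longrightarrow>
                (\<exists>c. \<forall>f\<in>carrier (fun_rep q4 t2 B). \<forall>g\<in>carrier (fun_rep q4 t2 B).
                   F f g = c * fun_form bar B \<mu> f g))))"
proof -
  have q4: "q4 \<noteq> 0" using assms(1,2) by (auto simp: prim_root_of_unity_def power_0_left)
  have t2: "t2\<^sup>2 \<noteq> 1" by (rule t2_sq_neq_1[OF assms(1,2) normalization assms(6)])
  interpret daha_root q4 t2 N
    using q4 t2 assms(1-3) by unfold_locales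
  note suff = perfect_sufficient[OF assms(4)]
  show ?thesis
  proof (intro conjI allI impI iffI)
    assume perf: "perfect q4 t2 bar V"
    note nec = perfect_necessary[OF perf assms(4) normalization]
    show "\<exists>k. half_int_exponent q4 t2 k \<and>
             (0 < k \<and> k < of_nat N / 2 \<or>
              (\<exists>n::nat. k = - 1/2 - of_nat n \<and> of_nat n < (of_nat N / 2 :: rat)))"
      by (rule nec(1))
    show "daha_module q4 t2 V" using perf by (simp add: perfect_def)
    show "daha_iso (quot_rep (pol_rep q4 t2) (Rad q4 t2)) V" by (rule nec(2))
  next
    assume r: "(\<exists>k. half_int_exponent q4 t2 k \<and>
             (0 < k \<and> k < of_nat N / 2 \<or>
              (\<exists>n::nat. k = - 1/2 - of_nat n \<and> of_nat n < (of_nat N / 2 :: rat)))) \<and>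
        daha_module q4 t2 V \<and> daha_iso (quot_rep (pol_rep q4 t2) (Rad q4 t2)) V"
    \<comment> \<open>The case in which k falls selects the set of points; it does not occur in the
      claim about V.\<close>
    then obtain k B where "half_int_exponent q4 t2 k"
      "0 < k \<and> k < of_nat N / 2 \<and> B = bowtie_a N k \<or>
         (\<exists>n::nat. k = - 1/2 - of_nat n \<and> of_nat n < (of_nat N / 2 :: rat) \<and> B = bowtie_b n)" by blast
    from suff(1)[OF this] show "perfect q4 t2 bar V"
      using perfect_iso[OF assms(3)] r by blast
  next
    fix k B
    assume "half_int_exponent q4 t2 k \<and>
        (0 < k \<and> k < of_nat N / 2 \<and> B = bowtie_a N k \<or>
         (\<exists>n::nat. k = - 1/2 - of_nat n \<and> of_nat n < (of_nat N / 2 :: rat) \<and> B = bowtie_b n))"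
    then have kB: "half_int_exponent q4 t2 k" "0 < k \<and> k < of_nat N / 2 \<and> B = bowtie_a N k \<or>
         (\<exists>n::nat. k = - 1/2 - of_nat n \<and> of_nat n < (of_nat N / 2 :: rat) \<and> B = bowtie_b n)" by auto
    note s = suff[OF kB]
    show "perfect q4 t2 bar (quot_rep (pol_rep q4 t2) (Rad q4 t2))" by (rule s(1))
    show "daha_iso (quot_rep (pol_rep q4 t2) (Rad q4 t2)) (fun_rep q4 t2 B)" by (rule s(3))
    show "\<exists>\<mu>. is_mu1 q4 k B \<mu> \<and>
             X_pseudo_unitary_form bar (fun_rep q4 t2 B) (fun_form bar B \<mu>) \<and>
             (\<forall>F. star_form bar (fun_rep q4 t2 B) F \<longrightarrow>
                (\<exists>c. \<forall>f\<in>carrier (fun_rep q4 t2 B). \<forall>g\<in>carrier (fun_rep q4 t2 B).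
                   F f g = c * fun_form bar B \<mu> f g))" by (rule s(4))
  qed
qed

end
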